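(* Let $G$ be a finite group. For infinitely many positive integers $d$, there exists an infinite-dimensional graded $\mathbb{C}[G]$-module $$V^G=\bigoplus_{n\in\{-d\}\cup\mathbb{N}} V^G_n$$ (each $V^G_n$ a finite-dimensional $\mathbb{C}[G]$-module) such that for every $g\in G$ the McKay–Thompson series $$\mathrm{Tr}(g\mid V^G):=\sum_{n}\mathrm{Tr}(g\mid V^G_n)\,q^n,\qquad q=e^{2\pi i\tau},$$ is (the $q$-expansion of) a weakly holomorphic modular function strictly of level $\mathrm{ord}(g)$, and $$\mathrm{Tr}(e\mid V^G)=J(\tau)\mid dT(d).$$
   Context: $\mathbb{N}$ denotes the natural numbers; $\mathrm{ord}(g)$ is the order of $g$ and $e$ the identity. $\Gamma_0(N)=\{\begin{pmatrix}a&b\\c&d\end{pmatrix}\in\mathrm{SL}_2(\mathbb{Z}): c\equiv 0 \pmod N\}$. A weakly holomorphic modular function on $\Gamma_0(N)$ is a holomorphic function $f$ on the upper half-plane with $f(\gamma\tau)=f(\tau)$ for all $\gamma\in\Gamma_0(N)$ and at most exponential growth at the cusps (so it has a Laurent expansion in $q$ with finitely many negative powers). Such $f$ is strictly of level $N$ if it is invariant under $\Gamma_0(N)$ but not under $\Gamma_0(M)$ for any proper divisor $M$ of $N$. $J(\tau)=E_4(\tau)^3/\Delta(\tau)-744=q^{-1}+196884q+\cdots$ is the normalized elliptic modular invariant, where $E_4$ is the weight 4 Eisenstein series and $\Delta(\tau)=q\prod_{n\ge1}(1-q^n)^{24}$. For a weight 0 modular form $f$ and positive integer $m$, the normalized Hecke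 operator is $f(\tau)\mid mT(m)=\sum_{ad=m,\ 0\le b<d} f\!\left(\frac{a\tau+b}{d}\right)$. *)

theory Defs
  imports
    "HOL-Analysis.Analysis"
    "HOL-Algebra.Multiplicative_Group"
    "HOL-Library.Poly_Mapping"
begin

section \<open>Graded modules over a complex group algebra\<close>

locale complex_vector_space = vector_space scale
  for scale :: "complex \<Rightarrow> 'b::ab_group_add \<Rightarrow> 'b"
begin

definition finite_dim :: "'b set \<Rightarrow> bool" where
  "finite_dim W \<longleftrightarrow> (\<exists>B. finite B \<and> span B = W)"

definition direct_sum_decomposition :: "'i set \<Rightarrow> ('i \<Rightarrow> 'b set) \<Rightarrow> bool" where
  "direct_sum_decomposition I V \<longleftrightarrow>
     (\<forall>n\<in>I. subspace (V n)) \<and>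
     (\<forall>v. \<exists>!u. (\<forall>n\<in>I. u n \<in> V n) \<and> (\<forall>n. n \<notin> I \<longrightarrow> u n = 0) \<and>
               finite {n. u n \<noteq> 0} \<and> v = (\<Sum>n | u n \<noteq> 0. u n))"

text \<open>Trace of an endomorphism of a finite-dimensional subspace \<open>W\<close>; the choice of basis is
  immaterial by \<open>endo_trace_eq\<close> below.\<close>

definition endo_trace :: "'b set \<Rightarrow> ('b \<Rightarrow> 'b) \<Rightarrow> complex" where
  "endo_trace W f =
     (let B = (SOME B. independent B \<and> span B = W) in \<Sum>b\<in>B. representation B (f b) b)"

lemma endo_trace_basis_indep:
  assumes f: "Vector_Spaces.linear scale scale f"
    and B: "independent B" "finite B" and C: "independent C" "finite C"
    and BC: "span B = span C" and inv: "f ` span B \<subseteq> span B"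
  shows "(\<Sum>b\<in>B. representation B (f b) b) = (\<Sum>c\<in>C. representation C (f c) c)"
proof -
  interpret f: Vector_Spaces.linear scale scale f by (rule f)
  have fB: "f x \<in> span B" if "x \<in> span B" for x using inv that by auto
  have b: "representation B (f b) b = (\<Sum>c\<in>C. representation C b c * representation B (f c) b)"
    if "b \<in> B" for b
  proof -
    have "b \<in> span C" using that BC span_base by blast
    then have "b = (\<Sum>c\<in>C. scale (representation C b c) c)"
      using sum_representation_eq[OF C(1) _ C(2)] by simp
    then have "f b = f (\<Sum>c\<in>C. scale (representation C b c) c)" by (rule arg_cong)
    also have "\<dots> = (\<Sum>c\<in>C. scale (representation C b c) (f c))"
      by (simp add: f.sum f.scale)
    finally have "representation B (f b) =
        representation B (\<Sum>c\<in>C. scale (representation C b c) (f c))" by simp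
    also have "\<dots> = (\<lambda>x. \<Sum>c\<in>C. representation C b c * representation B (f c) x)"
      using B(1) fB BC span_base span_scale
      by (subst representation_sum) (auto simp: representation_scale)
    finally show ?thesis by simp
  qed
  have c: "representation C (f c) c = (\<Sum>b\<in>B. representation B (f c) b * representation C b c)"
    if "c \<in> C" for c
  proof -
    have "f c \<in> span B" using that BC span_base fB by blast
    then have "f c = (\<Sum>b\<in>B. scale (representation B (f c) b) b)"
      using sum_representation_eq[OF B(1) _ B(2)] by simp
    then have "representation C (f c) =
        representation C (\<Sum>b\<in>B. scale (representation B (f c) b) b)" by simp
    also have "\<dots> = (\<lambda>x. \<Sum>b\<in>B. representation B (f c) b * representation C b x)"
      using C(1) BC span_base[of _ B]
      by (subst representation_sum) (auto simp: representation_scale intro: span_scale)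
    finally show ?thesis by simp
  qed
  have "(\<Sum>b\<in>B. representation B (f b) b) =
      (\<Sum>b\<in>B. \<Sum>c\<in>C. representation C b c * representation B (f c) b)"
    by (intro sum.cong refl b)
  also have "\<dots> = (\<Sum>c\<in>C. \<Sum>b\<in>B. representation B (f c) b * representation C b c)"
    by (subst sum.swap) (simp add: mult.commute)
  also have "\<dots> = (\<Sum>c\<in>C. representation C (f c) c)"
    by (intro sum.cong refl c[symmetric])
  finally show ?thesis .
qed

lemma endo_trace_eq:
  assumes f: "Vector_Spaces.linear scale scale f"
    and B: "independent B" "finite B" "span B = W" and inv: "f ` W \<subseteq> W"
  shows "endo_trace W f = (\<Sum>b\<in>B. representation B (f b) b)"
proof -
  define C where "C = (SOME C. independent C \<and> span C = W)"
  have C: "independent C \<and> span C = W"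
    unfolding C_def by (rule someI[of _ B]) (use B in auto)
  have "C \<subseteq> span B" using C B span_base by blast
  then have "finite C" using independent_span_bound[of B C] B C by blast
  then show ?thesis
    unfolding endo_trace_def C_def[symmetric] Let_def
    using endo_trace_basis_indep[OF f, of C B] B C inv by auto
qed

end

text \<open>A \<open>\<complex>[G]\<close>-module is a complex vector space with a linear action \<open>\<rho>\<close> of \<open>G\<close>;
  here the underlying vector space is the whole type \<open>'v\<close> with scalar multiplication
  \<open>scale\<close>, and the grading is by finite-dimensional submodules \<open>V n\<close>, \<open>n \<in> I\<close>.\<close>

locale graded_group_module = group G + complex_vector_space scale
  for G :: "('a, 'b) monoid_scheme" (structure)
    and scale :: "complex \<Rightarrow> 'v::ab_group_add \<Rightarrow> 'v" +
  fixes \<rho> :: "'a \<Rightarrow> 'v \<Rightarrow> 'v"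
    and I :: "int set"
    and V :: "int \<Rightarrow> 'v set"
  assumes action_linear: "g \<in> carrier G \<Longrightarrow> Vector_Spaces.linear scale scale (\<rho> g)"
    and action_one: "\<rho> \<one> v = v"
    and action_mult: "g \<in> carrier G \<Longrightarrow> h \<in> carrier G \<Longrightarrow> \<rho> (g \<otimes> h) v = \<rho> g (\<rho> h v)"
    and decomposition: "direct_sum_decomposition I V"
    and graded_piece_invariant: "g \<in> carrier G \<Longrightarrow> n \<in> I \<Longrightarrow> \<rho> g ` V n \<subseteq> V n"
    and graded_piece_finite_dim: "n \<in> I \<Longrightarrow> finite_dim (V n)"

section \<open>Weakly holomorphic modular functions\<close>

definition upper_half_plane :: "complex set" where
  "upper_half_plane = {\<tau>. Im \<tau> > 0}"

definition Gamma0 :: "nat \<Rightarrow> (int^2^2) set" where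
  "Gamma0 N = {\<gamma>. det \<gamma> = 1 \<and> int N dvd \<gamma> $ 2 $ 1}"

definition act :: "int^2^2 \<Rightarrow> complex \<Rightarrow> complex" where
  "act \<gamma> = moebius (of_int (\<gamma> $ 1 $ 1)) (of_int (\<gamma> $ 1 $ 2))
                   (of_int (\<gamma> $ 2 $ 1)) (of_int (\<gamma> $ 2 $ 2))"

definition modular_invariant :: "nat \<Rightarrow> (complex \<Rightarrow> complex) \<Rightarrow> bool" where
  "modular_invariant N f \<longleftrightarrow> (\<forall>\<gamma>\<in>Gamma0 N. \<forall>\<tau>\<in>upper_half_plane. f (act \<gamma> \<tau>) = f \<tau>)"

text \<open>Every cusp is \<open>\<gamma> \<infinity>\<close> for some \<open>\<gamma> \<in> SL\<^sub>2(\<int>) = \<Gamma>\<^sub>0(1)\<close>, and the behaviour of \<open>f\<close> there is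
  that of \<open>f(\<gamma> \<tau>)\<close> as \<open>Im \<tau> \<rightarrow> \<infinity>\<close>.\<close>

definition exponential_growth_at_cusps :: "(complex \<Rightarrow> complex) \<Rightarrow> bool" where
  "exponential_growth_at_cusps f \<longleftrightarrow>
     (\<forall>\<gamma>\<in>Gamma0 1. \<exists>A C y\<^sub>0 :: real. \<forall>\<tau>\<in>upper_half_plane.
        Im \<tau> > y\<^sub>0 \<longrightarrow> norm (f (act \<gamma> \<tau>)) \<le> A * exp (C * Im \<tau>))"

definition weakly_holomorphic_modular :: "nat \<Rightarrow> (complex \<Rightarrow> complex) \<Rightarrow> bool" where
  "weakly_holomorphic_modular N f \<longleftrightarrow>
     f holomorphic_on upper_half_plane \<and> modular_invariant N f \<and> exponential_growth_at_cusps f"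

definition strictly_of_level :: "nat \<Rightarrow> (complex \<Rightarrow> complex) \<Rightarrow> bool" where
  "strictly_of_level N f \<longleftrightarrow>
     weakly_holomorphic_modular N f \<and> (\<forall>M. M dvd N \<and> M \<noteq> N \<longrightarrow> \<not> modular_invariant M f)"

section \<open>q-expansions, the modular invariant and Hecke operators\<close>

definition nome :: "complex \<Rightarrow> complex" where
  "nome \<tau> = exp (2 * complex_of_real pi * \<i> * \<tau>)"

definition has_q_expansion :: "(complex \<Rightarrow> complex) \<Rightarrow> int set \<Rightarrow> (int \<Rightarrow> complex) \<Rightarrow> bool" where
  "has_q_expansion f I a \<longleftrightarrow>
     (\<forall>\<tau>\<in>upper_half_plane. ((\<lambda>n. a n * nome \<tau> powi n) has_sum f \<tau>) I)"

definition Eisenstein4 :: "complex \<Rightarrow> complex" where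
  "Eisenstein4 \<tau> = 1 + 240 * suminf (\<lambda>n. of_nat (\<Sum>k | k dvd Suc n. k ^ 3) * nome \<tau> ^ Suc n)"

definition modular_discriminant :: "complex \<Rightarrow> complex" where
  "modular_discriminant \<tau> = nome \<tau> * prodinf (\<lambda>n. (1 - nome \<tau> ^ Suc n) ^ 24)"

definition J_invariant :: "complex \<Rightarrow> complex" where
  "J_invariant \<tau> = Eisenstein4 \<tau> ^ 3 / modular_discriminant \<tau> - 744"

text \<open>The weight 0 operator \<open>f | m T(m)\<close>, including its normalizing factor \<open>m\<close>.\<close>

definition hecke :: "nat \<Rightarrow> (complex \<Rightarrow> complex) \<Rightarrow> complex \<Rightarrow> complex" where
  "hecke m f \<tau> =
     (\<Sum>(a, b, d) \<in> {(a, b, d). a * d = m \<and> b < d}. f ((of_nat a * \<tau> + of_nat b) / of_nat d))"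

end

theory Submission
  imports Defs "HOL-Complex_Analysis.Complex_Analysis" "HOL-Number_Theory.Number_Theory"
begin

text \<open>
  Expanding \<open>J | d T(d)\<close> as a sum over the matrices \<open>(a, b; 0, e)\<close> with \<open>a e = d\<close>, its \<open>n\<close>-th coefficient is the
  sum of \<open>e c(e n / a)\<close> over \<open>a | gcd(d, n)\<close>, where \<open>c\<close> denotes the coefficients of \<open>J\<close>. Weighting the terms by a
  function of \<open>gcd(m, a)\<close> keeps the sum invariant under \<open>\<Gamma>\<^sub>0(m)\<close>, because right multiplication by \<open>\<Gamma>\<^sub>0(m)\<close>
  permutes the classes of these matrices and preserves \<open>gcd(m, a)\<close>. For \<open>g\<close> of order \<open>m\<close> the weight is \<open>1\<close> if \<open>m | a\<close> and
  otherwise a tiny positive rational number whose denominator divides \<open>e\<close>, chosen so that all coefficients agree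
  with those of \<open>J | d T(d)\<close> modulo \<open>|G|\<close>. The term \<open>a = 1\<close> dominates, so for large \<open>d\<close> the coefficients at
  \<open>g \<noteq> 1\<close> are negligible compared with the dimension. By Artin induction from cyclic subgroups, class functions that
  depend only on the order of \<open>g\<close>, are congruent to their value at \<open>1\<close> modulo \<open>|G|\<close>, and are dominated by it
  are characters. Comparing leading terms at the cusps \<open>\<infinity>\<close> and \<open>1/M\<close> shows that the level is exactly \<open>m\<close>.

  The invariance of \<open>J\<close> comes from lattice sums for \<open>E\<^sub>4\<close> and, for \<open>\<Delta>\<close>, from the transformation of its logarithmic
  derivative \<open>E\<^sub>2\<close>; the growth of \<open>c\<close> from \<open>n p(n) = 24 \<Sum> \<sigma>(i) p(n - i)\<close> for the coefficients \<open>p\<close> of \<open>q / \<Delta>\<close>.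
\<close>

section \<open>Characters of finite groups\<close>

text \<open>Weight 1 when m divides a and 0 otherwise would already give invariance under level m,
  but its coefficients need not agree modulo |G| with those at the identity, and then the class
  functions they define need not even be generalized characters. Integral weights congruent to 1
  modulo |G| repair this but cannot be made small, so dominance by the dimension is lost. Fractions
  achieve both: with r = m / gcd(m, a), the number 1 = r^B / r^B becomes small when only its
  numerator is reduced modulo a multiple y of |G|. The term of a carries the factor d / a, so the
  denominator does no harm once r^B divides d / a for all m and a that occur; the factor |G|^(B+1)
  of d is there for this. The exponent B is large so that r^B exceeds y by the factor which Artin
  induction demands; this makes the term a = 1 small. The terms a > 1 need no small weight: they are
  small by the growth of c alone, once d is large.\<close>

definition realizable :: "('a, 'b) monoid_scheme \<Rightarrow> ('a \<Rightarrow> complex) \<Rightarrow> bool" where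
  "realizable G X \<longleftrightarrow> (\<exists>(D::nat) R.
     (\<forall>i<D. \<forall>j<D. R \<one>\<^bsub>G\<^esub> i j = of_bool (i = j)) \<and>
     (\<forall>g\<in>carrier G. \<forall>h\<in>carrier G. \<forall>i<D. \<forall>j<D. R (g \<otimes>\<^bsub>G\<^esub> h) i j = (\<Sum>k<D. R g i k * R h k j)) \<and>
     (\<forall>g\<in>carrier G. X g = (\<Sum>i<D. R g i i)))"

text \<open>In \<open>realizable\<close> matrices are plain functions of two indices below
  \<open>D\<close>, so that the dimension may vary with the character and may be 0. Direct sums and
  coset transversals come with other index sets; an enumeration of \<open>S\<close> transports
  them.\<close>

lemma realizableI:
  assumes S: "finite S"
    and one: "\<And>i j. i \<in> S \<Longrightarrow> j \<in> S \<Longrightarrow> R \<one>\<^bsub>G\<^esub> i j = of_bool (i = j)"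
    and mult: "\<And>g h i j. g \<in> carrier G \<Longrightarrow> h \<in> carrier G \<Longrightarrow> i \<in> S \<Longrightarrow> j \<in> S \<Longrightarrow>
                 R (g \<otimes>\<^bsub>G\<^esub> h) i j = (\<Sum>k\<in>S. R g i k * R h k j)"
    and trace: "\<And>g. g \<in> carrier G \<Longrightarrow> X g = (\<Sum>i\<in>S. R g i i)"
  shows "realizable G X"
proof -
  obtain f where f: "bij_betw f {..<card S} S"
    using ex_bij_betw_nat_finite[OF S] by (auto simp: lessThan_atLeast0)
  have fS: "f i \<in> S" if "i < card S" for i using f that by (auto simp: bij_betw_def)
  have finj: "f i = f j \<longleftrightarrow> i = j" if "i < card S" "j < card S" for i j
    using f that by (auto simp: bij_betw_def inj_on_def)
  have sm: "(\<Sum>k\<in>S. F k) = (\<Sum>k<card S. F (f k))" for F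
    by (rule sum.reindex_bij_betw[OF f, symmetric])
  show ?thesis unfolding realizable_def
    by (rule exI[of _ "card S"], rule exI[of _ "\<lambda>g i j. R g (f i) (f j)"])
       (auto simp: one mult trace fS finj sm)
qed

lemma realizable_cong:
  "realizable G X \<Longrightarrow> (\<And>g. g \<in> carrier G \<Longrightarrow> X g = X' g) \<Longrightarrow> realizable G X'"
  unfolding realizable_def by auto

lemma realizable_0: "realizable G (\<lambda>g. 0)"
  by (rule realizableI[where S = "{} :: nat set"]) auto

lemma realizable_1: "realizable G (\<lambda>g. 1)"
  by (rule realizableI[where S = "{()}" and R = "\<lambda>g i j. 1"]) auto

lemma realizable_add:
  assumes "realizable G X" "realizable G Y"
  shows "realizable G (\<lambda>g. X g + Y g)"
proof -
  obtain D :: nat and R where R: "\<forall>i<D. \<forall>j<D. R \<one>\<^bsub>G\<^esub> i j = of_bool (i = j)"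
     "\<forall>g\<in>carrier G. \<forall>h\<in>carrier G. \<forall>i<D. \<forall>j<D. R (g \<otimes>\<^bsub>G\<^esub> h) i j = (\<Sum>k<D. R g i k * R h k j)"
     "\<forall>g\<in>carrier G. X g = (\<Sum>i<D. R g i i)"
    using assms(1) unfolding realizable_def by blast
  obtain E :: nat and Q where Q: "\<forall>i<E. \<forall>j<E. Q \<one>\<^bsub>G\<^esub> i j = of_bool (i = j)"
     "\<forall>g\<in>carrier G. \<forall>h\<in>carrier G. \<forall>i<E. \<forall>j<E. Q (g \<otimes>\<^bsub>G\<^esub> h) i j = (\<Sum>k<E. Q g i k * Q h k j)"
     "\<forall>g\<in>carrier G. Y g = (\<Sum>i<E. Q g i i)"
    using assms(2) unfolding realizable_def by blast
  define B where "B = (\<lambda>g i j. case (i, j) of (Inl i, Inl j) \<Rightarrow> R g i j | (Inr i, Inr j) \<Rightarrow> Q g i j | _ \<Rightarrow> 0)"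
  have P: "(\<Sum>k\<in>{..<D} <+> {..<E}. F k) = (\<Sum>k<D. F (Inl k)) + (\<Sum>k<E. F (Inr k))" for F :: "nat + nat \<Rightarrow> complex"
    by (simp add: sum.Plus)
  show ?thesis
    by (rule realizableI[where S = "{..<D} <+> {..<E}" and R = B])
       (use R Q in \<open>auto simp: B_def P elim!: PlusE\<close>)
qed

lemma realizable_mult_of_nat: "realizable G X \<Longrightarrow> realizable G (\<lambda>g. of_nat n * X g)"
  by (induction n) (auto simp: realizable_0 ring_distribs intro: realizable_add)

lemma realizable_sum:
  "(\<And>i. i \<in> A \<Longrightarrow> realizable G (X i)) \<Longrightarrow> realizable G (\<lambda>g. \<Sum>i\<in>A. X i g)"
  by (induction A rule: infinite_finite_induct) (auto simp: realizable_0 intro: realizable_add)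

section \<open>Characters induced from linear characters of subgroups\<close>

context group
begin

lemma left_transversal:
  assumes C: "subgroup C G"
  obtains T where "T \<subseteq> carrier G" "\<And>x. x \<in> carrier G \<Longrightarrow> \<exists>!t. t \<in> T \<and> inv t \<otimes> x \<in> C"
proof -
  interpret C: subgroup C G by (rule C)
  \<comment> \<open>The choice depends only on the predicate, and the predicate is the same for all
    elements of a left coset; hence \<open>r\<close> is constant on cosets and its image is a
    transversal.\<close>
  define r where "r x = (SOME y. y \<in> carrier G \<and> inv x \<otimes> y \<in> C)" for x
  have r: "r x \<in> carrier G \<and> inv x \<otimes> r x \<in> C" if "x \<in> carrier G" for x
    unfolding r_def by (rule someI[of _ x]) (use that in auto)
  have r': "inv (r x) \<otimes> x \<in> C" if "x \<in> carrier G" for x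
    using C.m_inv_closed[of "inv x \<otimes> r x"] r[OF that] that by (simp add: inv_mult_group)
  have mm: "inv x \<otimes> y \<in> C" if "x \<in> carrier G" "y \<in> carrier G" "z \<in> carrier G"
      "inv x \<otimes> z \<in> C" "inv z \<otimes> y \<in> C" for x y z
  proof -
    have "inv x \<otimes> y = (inv x \<otimes> z) \<otimes> (inv z \<otimes> y)"
      using that(1-3) by (simp add: m_assoc inv_solve_left flip: m_assoc[of z])
    then show ?thesis using that by simp
  qed
  have inv': "inv y \<otimes> x \<in> C" if "x \<in> carrier G" "y \<in> carrier G" "inv x \<otimes> y \<in> C" for x y
    using C.m_inv_closed[OF that(3)] that(1,2) by (simp add: inv_mult_group)
  have req: "r x = r y" if "x \<in> carrier G" "y \<in> carrier G" "inv x \<otimes> y \<in> C" for x y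
  proof -
    have "(\<lambda>z. z \<in> carrier G \<and> inv x \<otimes> z \<in> C) = (\<lambda>z. z \<in> carrier G \<and> inv y \<otimes> z \<in> C)"
      using mm inv' that by (intro ext) metis
    then show ?thesis unfolding r_def by simp
  qed
  show ?thesis
  proof (rule that[of "r ` carrier G"])
    show "r ` carrier G \<subseteq> carrier G" using r by auto
    fix x assume x: "x \<in> carrier G"
    show "\<exists>!t. t \<in> r ` carrier G \<and> inv t \<otimes> x \<in> C"
    proof (rule ex1I[of _ "r x"])
      show "r x \<in> r ` carrier G \<and> inv (r x) \<otimes> x \<in> C" using x r' by auto
      fix t assume t: "t \<in> r ` carrier G \<and> inv t \<otimes> x \<in> C"
      then obtain z where z: "z \<in> carrier G" "t = r z" by auto
      have "inv z \<otimes> x \<in> C" using mm[of z x "r z"] r z x t by auto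
      then show "t = r x" using req[of z x] z x by simp
    qed
  qed
qed

text \<open>Frobenius' formula. Summing over all of \<open>G\<close> and dividing by
  \<open>card C\<close> avoids a choice of coset representatives.\<close>

definition induced_char :: "'a set \<Rightarrow> ('a \<Rightarrow> complex) \<Rightarrow> 'a \<Rightarrow> complex" where
  "induced_char C lam g =
     (\<Sum>x | x \<in> carrier G \<and> inv x \<otimes> g \<otimes> x \<in> C. lam (inv x \<otimes> g \<otimes> x)) / of_nat (card C)"

text \<open>The induced representation is written down as monomial matrices indexed by a
  transversal: the entry at s, t is \<open>lam\<close>, extended by zero, at the element s^-1 g t.
  In a product only one middle index survives, the representative of the coset of h t.\<close>

lemma realizable_induced:
  assumes fin: "finite (carrier G)" and C: "subgroup C G"
    and lam1: "lam \<one> = 1"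
    and lam: "\<And>x y. x \<in> C \<Longrightarrow> y \<in> C \<Longrightarrow> lam (x \<otimes> y) = lam x * lam y"
  shows "realizable G (induced_char C lam)"
proof -
  interpret C: subgroup C G by (rule C)
  obtain T where T: "T \<subseteq> carrier G" "\<And>x. x \<in> carrier G \<Longrightarrow> \<exists>!t. t \<in> T \<and> inv t \<otimes> x \<in> C"
    using left_transversal[OF C] by metis
  have fT: "finite T" using T fin finite_subset by blast
  define L where "L x = (if x \<in> C then lam x else 0)" for x
  have Lin: "L x * L y = L (x \<otimes> y)" if "x \<in> carrier G" "y \<in> C" for x y
  proof -
    have "x \<otimes> y \<in> C \<longleftrightarrow> x \<in> C"
    proof
      assume "x \<otimes> y \<in> C"
      then have "x \<otimes> y \<otimes> inv y \<in> C" using that C.m_inv_closed by blast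
      then show "x \<in> C" using that by (simp add: m_assoc)
    qed (use that in auto)
    then show ?thesis using that lam by (auto simp: L_def)
  qed
  \<comment> \<open>A diagonal entry thus depends only on the coset of its index, which turns the
    trace over \<open>T\<close> into the average over all of \<open>G\<close>.\<close>
  have Lconj: "L (inv c \<otimes> y \<otimes> c) = L y" if "c \<in> C" "y \<in> carrier G" for c y
  proof -
    have iff: "inv c \<otimes> y \<otimes> c \<in> C \<longleftrightarrow> y \<in> C"
    proof
      assume "inv c \<otimes> y \<otimes> c \<in> C"
      then have "c \<otimes> (inv c \<otimes> y \<otimes> c) \<otimes> inv c \<in> C" using that by auto
      moreover have "c \<otimes> (inv c \<otimes> y \<otimes> c) \<otimes> inv c = y"
        using that C.mem_carrier by (simp add: m_assoc flip: m_assoc[of c "inv c"])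
      ultimately show "y \<in> C" by simp
    qed (use that in auto)
    have "lam (inv c) * lam c = 1" using lam[of "inv c" c] that lam1 by simp
    then show ?thesis using iff that lam by (auto simp: L_def)
  qed
  show ?thesis
  proof (rule realizableI[where S = T and R = "\<lambda>g s t. L (inv s \<otimes> g \<otimes> t)"])
    show "finite T" by (rule fT)
    show "L (inv i \<otimes> \<one> \<otimes> j) = of_bool (i = j)" if "i \<in> T" "j \<in> T" for i j
    proof -
      have c: "i \<in> carrier G" "j \<in> carrier G" using that T by auto
      have "inv i \<otimes> j \<in> C \<longleftrightarrow> i = j"
        using T(2)[of j] that c by (metis C.one_closed l_inv)
      then show ?thesis using c lam1 by (auto simp: L_def)
    qed
    show "L (inv i \<otimes> (g \<otimes> h) \<otimes> j) = (\<Sum>k\<in>T. L (inv i \<otimes> g \<otimes> k) * L (inv k \<otimes> h \<otimes> j))"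
      if "g \<in> carrier G" "h \<in> carrier G" "i \<in> T" "j \<in> T" for g h i j
    proof -
      have c: "i \<in> carrier G" "j \<in> carrier G" using that T by auto
      have "h \<otimes> j \<in> carrier G" using c that by auto
      then obtain t where t: "t \<in> T" "inv t \<otimes> (h \<otimes> j) \<in> C"
          "\<And>t'. t' \<in> T \<Longrightarrow> inv t' \<otimes> (h \<otimes> j) \<in> C \<Longrightarrow> t' = t" using T(2) by meson
      have tc: "t \<in> carrier G" using t(1) T(1) by blast
      have "(\<Sum>k\<in>T. L (inv i \<otimes> g \<otimes> k) * L (inv k \<otimes> h \<otimes> j)) =
          (\<Sum>k\<in>T. if k = t then L (inv i \<otimes> g \<otimes> t) * L (inv t \<otimes> h \<otimes> j) else 0)"
      proof (intro sum.cong refl)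
        fix k assume k: "k \<in> T"
        then have kc: "k \<in> carrier G" using T by auto
        have "L (inv k \<otimes> h \<otimes> j) = 0" if "k \<noteq> t"
          using t(3)[OF k] \<open>k \<noteq> t\<close> m_assoc[of "inv k" h j] kc c \<open>h \<in> carrier G\<close> by (auto simp: L_def)
        then show "L (inv i \<otimes> g \<otimes> k) * L (inv k \<otimes> h \<otimes> j) =
            (if k = t then L (inv i \<otimes> g \<otimes> t) * L (inv t \<otimes> h \<otimes> j) else 0)"
          by (cases "k = t") simp_all
      qed
      also have "\<dots> = L (inv i \<otimes> g \<otimes> t) * L (inv t \<otimes> h \<otimes> j)"
        using t(1) fT by simp
      also have "\<dots> = L (inv i \<otimes> g \<otimes> t \<otimes> (inv t \<otimes> h \<otimes> j))"
        using that c tc t(2) by (intro Lin) (simp_all add: m_assoc)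
      also have "inv i \<otimes> g \<otimes> t \<otimes> (inv t \<otimes> h \<otimes> j) = inv i \<otimes> (g \<otimes> h) \<otimes> j"
        using that c tc by (simp add: m_assoc flip: m_assoc[of t "inv t"])
      finally show ?thesis by simp
    qed
    show "induced_char C lam g = (\<Sum>i\<in>T. L (inv i \<otimes> g \<otimes> i))" if g: "g \<in> carrier G" for g
    proof -
      have bij: "bij_betw (\<lambda>(t, c). t \<otimes> c) (T \<times> C) (carrier G)"
      proof (rule bij_betwI')
        fix p q assume p: "p \<in> T \<times> C" and q: "q \<in> T \<times> C"
        obtain t c t' c' where pq: "p = (t, c)" "q = (t', c')" by (cases p; cases q)
        have tt: "t \<in> T" "t' \<in> T" "t \<in> carrier G" "t' \<in> carrier G" "c \<in> C" "c' \<in> C"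
          "c \<in> carrier G" "c' \<in> carrier G"
          using p q pq T by auto
        have "t = t' \<and> c = c'" if "t \<otimes> c = t' \<otimes> c'"
        proof -
          have 1: "inv t \<otimes> (t \<otimes> c) \<in> C" "inv t' \<otimes> (t' \<otimes> c') \<in> C"
            using tt by (simp_all flip: m_assoc)
          have "t = t'" using T(2)[of "t \<otimes> c"] 1 that tt by (metis m_closed)
          then show ?thesis using that tt by simp
        qed
        then show "((case p of (t, c) \<Rightarrow> t \<otimes> c) = (case q of (t, c) \<Rightarrow> t \<otimes> c)) = (p = q)"
          using pq by auto
      next
        show "(case p of (t, c) \<Rightarrow> t \<otimes> c) \<in> carrier G" if "p \<in> T \<times> C" for p
          using that T by auto
        fix x assume x: "x \<in> carrier G"
        then obtain t where t: "t \<in> T" "inv t \<otimes> x \<in> C" using T(2) by metis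
        then have "x = t \<otimes> (inv t \<otimes> x)" using x T by (auto simp flip: m_assoc)
        then show "\<exists>p\<in>T \<times> C. x = (case p of (t, c) \<Rightarrow> t \<otimes> c)" using t by force
      qed
      have cC: "card C > 0" using C.subset fin C.one_closed by (metis card_gt_0_iff empty_iff finite_subset)
      have "(\<Sum>x | x \<in> carrier G \<and> inv x \<otimes> g \<otimes> x \<in> C. lam (inv x \<otimes> g \<otimes> x)) =
            (\<Sum>x\<in>carrier G. L (inv x \<otimes> g \<otimes> x))"
        unfolding L_def using fin by (subst sum.inter_filter) auto
      also have "\<dots> = (\<Sum>p\<in>T\<times>C. L (inv (fst p \<otimes> snd p) \<otimes> g \<otimes> (fst p \<otimes> snd p)))"
        by (subst sum.reindex_bij_betw[OF bij, symmetric]) (simp add: case_prod_unfold)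
      also have "\<dots> = (\<Sum>p\<in>T\<times>C. L (inv (fst p) \<otimes> g \<otimes> fst p))"
      proof (intro sum.cong refl)
        fix p assume "p \<in> T \<times> C"
        then obtain t c where tc: "p = (t, c)" "t \<in> carrier G" "c \<in> C" using T by auto
        have "inv (t \<otimes> c) \<otimes> g \<otimes> (t \<otimes> c) = inv c \<otimes> (inv t \<otimes> g \<otimes> t) \<otimes> c"
          using tc g C.mem_carrier by (simp add: inv_mult_group m_assoc)
        then show "L (inv (fst p \<otimes> snd p) \<otimes> g \<otimes> (fst p \<otimes> snd p)) = L (inv (fst p) \<otimes> g \<otimes> fst p)"
          using tc g Lconj by simp
      qed
      also have "\<dots> = of_nat (card C) * (\<Sum>t\<in>T. L (inv t \<otimes> g \<otimes> t))"
        using sum.cartesian_product[of "\<lambda>t c. L (inv t \<otimes> g \<otimes> t)" C T, symmetric]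
        by (simp add: case_prod_unfold sum_distrib_left)
      finally show ?thesis unfolding induced_char_def using cC by simp
    qed
  qed
qed

lemma induced_char_trivial:
  assumes g: "g \<in> carrier G"
  shows "induced_char {\<one>} (\<lambda>_. 1) g = (if g = \<one> then of_nat (order G) else 0)"
proof -
  have "{x. x \<in> carrier G \<and> inv x \<otimes> g \<otimes> x \<in> {\<one>}} = (if g = \<one> then carrier G else {})"
  proof -
    have "g = \<one>" if "x \<in> carrier G" "inv x \<otimes> g \<otimes> x = \<one>" for x
    proof -
      have "g = x \<otimes> (inv x \<otimes> g \<otimes> x) \<otimes> inv x"
        using that(1) g by (simp add: m_assoc flip: m_assoc[of x "inv x"])
      then show ?thesis using that by simp
    qed
    then show ?thesis by auto
  qed
  then show "induced_char {\<one>} (\<lambda>_. 1) g = (if g = \<one> then of_nat (order G) else 0)"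
    by (simp add: induced_char_def order_def)
qed

lemma realizable_regular:
  assumes "finite (carrier G)"
  shows "realizable G (\<lambda>g. if g = \<one> then of_nat (order G) else 0)"
  using realizable_cong[OF realizable_induced[OF assms triv_subgroup, of "\<lambda>_. 1"] induced_char_trivial]
  by auto

section \<open>Generalized characters and Artin induction\<close>

definition regular_char :: "'a \<Rightarrow> complex" where
  "regular_char g = (if g = \<one> then of_nat (order G) else 0)"

text \<open>Every irreducible character occurs in the regular one, so the generalized characters are
  exactly the functions that become characters after adding enough regular ones. This form avoids
  differences of representations; asking for all large \<open>L\<close> lets thresholds be
  added.\<close>

definition virtual_char :: "('a \<Rightarrow> complex) \<Rightarrow> bool" where
  "virtual_char X \<longleftrightarrow> (\<exists>K. \<forall>L\<ge>K. realizable G (\<lambda>g. X g + of_nat L * regular_char g))"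

lemma virtual_char_cong:
  "virtual_char X \<Longrightarrow> (\<And>g. g \<in> carrier G \<Longrightarrow> X g = X' g) \<Longrightarrow> virtual_char X'"
  unfolding virtual_char_def by (metis (no_types, lifting) realizable_cong)

lemma virtual_char_add:
  assumes "virtual_char X" "virtual_char Y"
  shows "virtual_char (\<lambda>g. X g + Y g)"
proof -
  obtain K where K: "\<And>L. L \<ge> K \<Longrightarrow> realizable G (\<lambda>g. X g + of_nat L * regular_char g)"
    using assms(1) unfolding virtual_char_def by blast
  obtain M where M: "\<And>L. L \<ge> M \<Longrightarrow> realizable G (\<lambda>g. Y g + of_nat L * regular_char g)"
    using assms(2) unfolding virtual_char_def by blast
  show ?thesis unfolding virtual_char_def
  proof (intro exI allI impI)
    fix L assume L: "K + M \<le> L"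
    have "realizable G (\<lambda>g. (X g + of_nat (L - M) * regular_char g) + (Y g + of_nat M * regular_char g))"
      using L by (intro realizable_add K M) auto
    then show "realizable G (\<lambda>g. X g + Y g + of_nat L * regular_char g)"
      by (rule realizable_cong) (use L in \<open>simp add: of_nat_diff algebra_simps\<close>)
  qed
qed

lemma realizable_imp_virtual_char:
  assumes fin: "finite (carrier G)" and X: "realizable G X"
  shows "virtual_char X"
  using realizable_add[OF X realizable_mult_of_nat[OF realizable_regular[OF fin]]]
  unfolding virtual_char_def regular_char_def by blast

lemma virtual_char_sum:
  assumes "finite (carrier G)" "\<And>i. i \<in> A \<Longrightarrow> virtual_char (X i)"
  shows "virtual_char (\<lambda>g. \<Sum>i\<in>A. X i g)"
  using assms(2)
  by (induction A rule: infinite_finite_induct)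
     (auto intro: virtual_char_add realizable_imp_virtual_char[OF assms(1)] realizable_0)

lemma virtual_char_mult_of_nat:
  assumes "finite (carrier G)" "virtual_char X"
  shows "virtual_char (\<lambda>g. of_nat n * X g)"
  using virtual_char_sum[of "{..<n}" "\<lambda>_. X"] assms by simp

text \<open>The characters induced from all linear characters of a cyclic subgroup add up to the
  regular character. Omitting the trivial one leaves a sum of characters, so the negative of the
  permutation character on the cosets is a generalized character too.\<close>

lemma realizable_regular_minus_permutation:
  assumes fin: "finite (carrier G)" and c: "c \<in> carrier G"
  shows "realizable G (\<lambda>g. regular_char g - induced_char (generate G {c}) (\<lambda>_. 1) g)"
proof -
  define C where "C = generate G {c}"
  define m where "m = ord c"
  have m: "m \<ge> 1" using ord_ge_1[OF fin c] by (simp add: m_def)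
  have C: "C = {c [^] k | k. k \<in> (UNIV :: nat set)}"
    unfolding C_def using fin c by (rule generate_pow_on_finite_carrier)
  have sub: "subgroup C G" unfolding C_def using c by (intro generate_is_subgroup) auto
  interpret C: subgroup C G by (rule sub)
  define w where "w k = exp (2 * complex_of_real pi * \<i> * (of_nat k / of_nat m))" for k
  have w_add: "w (a + b) = w a * w b" for a b
    by (simp add: w_def add_divide_distrib ring_distribs exp_add)
  have w_mult: "w (a * b) = w b ^ a" for a b
    by (simp add: w_def flip: exp_of_nat_mult) (simp add: algebra_simps)
  have w_eq: "w a = w b \<longleftrightarrow> [a = b] (mod m)" for a b
    unfolding w_def using complex_root_unity_eq[OF m, of a b] by (simp add: cong_def)
  have w0: "w 0 = 1" by (simp add: w_def)
  have w1: "w a = 1 \<longleftrightarrow> m dvd a" for a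
    using w_eq[of a 0] w0 by (simp add: cong_0_iff)
  \<comment> \<open>A discrete logarithm to the base \<open>c\<close>. Its class modulo
    \<open>m\<close> is all that matters, because \<open>w\<close> has period
    \<open>m\<close>.\<close>
  define k where "k x = (SOME k. x = c [^] (k::nat))" for x
  have k: "x = c [^] k x" if "x \<in> C" for x
    unfolding k_def using that C by (auto intro: someI_ex)
  have c_eq: "c [^] a = c [^] b \<longleftrightarrow> [a = b] (mod m)" for a b :: nat
  proof -
    have "c [^] a = c [^] b \<longleftrightarrow> c [^] (int a) = c [^] (int b)" by (simp add: int_pow_int)
    also have "\<dots> \<longleftrightarrow> int m dvd int b - int a" using int_pow_eq[OF c] m_def by simp
    also have "\<dots> \<longleftrightarrow> [int b = int a] (mod int m)" by (simp add: cong_iff_dvd_diff)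
    finally show ?thesis by (simp add: cong_int_iff cong_sym_eq)
  qed
  have k_mult: "[k (x \<otimes> y) = k x + k y] (mod m)" if "x \<in> C" "y \<in> C" for x y
    using k[of x] k[of y] k[of "x \<otimes> y"] that c nat_pow_mult[OF c, of "k x" "k y"]
    by (metis C.m_closed c_eq)
  have k_1: "m dvd k x \<longleftrightarrow> x = \<one>" if "x \<in> C" for x
    using k[OF that] c by (metis m_def pow_eq_id)
  define lam where "lam j x = w (j * k x)" for j x
  have real_lam: "realizable G (induced_char C (lam j))" for j
  proof (rule realizable_induced[OF fin sub])
    show "lam j \<one> = 1" using k_1[of \<one>] by (simp add: lam_def w1)
    show "lam j (x \<otimes> y) = lam j x * lam j y" if "x \<in> C" "y \<in> C" for x y
    proof -
      have "lam j x * lam j y = w (j * (k x + k y))"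
        by (simp add: lam_def ring_distribs w_add)
      also have "\<dots> = lam j (x \<otimes> y)"
        unfolding lam_def w_eq using k_mult[OF that] by (intro cong_mult cong_refl) (simp add: cong_sym_eq)
      finally show ?thesis by simp
    qed
  qed
  have sum_lam: "(\<Sum>j<m. lam j x) = (if x = \<one> then of_nat m else 0)" if "x \<in> C" for x
  proof (cases "x = \<one>")
    case True
    then have "lam j x = 1" for j using k_1[OF that] by (simp add: lam_def w1)
    then show ?thesis using True by simp
  next
    case False
    then have "w (k x) \<noteq> 1" using k_1[OF that] w1 by simp
    moreover have "w (k x) ^ m = 1" using w_mult[of m "k x"] w1[of "m * k x"] by simp
    ultimately show ?thesis using False geometric_sum[of "w (k x)" m] by (simp add: lam_def w_mult)
  qed
  have cardC: "card C = m" using generate_pow_card[OF c] by (simp add: C_def m_def)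
  have "(\<Sum>j<m. induced_char C (lam j) g) = regular_char g" if g: "g \<in> carrier G" for g
  proof -
    have "(\<Sum>j<m. induced_char C (lam j) g) = induced_char C (\<lambda>x. \<Sum>j<m. lam j x) g"
      unfolding induced_char_def sum_divide_distrib[symmetric] by (subst sum.swap) simp
    also have "\<dots> = induced_char {\<one>} (\<lambda>_. 1) g"
    proof -
      have "(\<Sum>x | x \<in> carrier G \<and> inv x \<otimes> g \<otimes> x \<in> C. \<Sum>j<m. lam j (inv x \<otimes> g \<otimes> x)) =
        (\<Sum>x | x \<in> carrier G \<and> inv x \<otimes> g \<otimes> x \<in> C. if inv x \<otimes> g \<otimes> x = \<one> then of_nat m else 0)"
        by (intro sum.cong refl sum_lam) auto
      also have "\<dots> = (\<Sum>x | x \<in> carrier G \<and> inv x \<otimes> g \<otimes> x \<in> {\<one>}. of_nat m)"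
        using fin C.one_closed by (intro sum.mono_neutral_cong_right) auto
      finally show ?thesis using m by (simp add: induced_char_def cardC)
    qed
    also have "\<dots> = regular_char g" using induced_char_trivial[OF g] by (simp add: regular_char_def)
    finally show ?thesis .
  qed
  moreover have "(\<Sum>j<m. F j) = F 0 + (\<Sum>j\<in>{1..<m}. F j)" for F :: "nat \<Rightarrow> complex"
    using m by (metis One_nat_def lessThan_atLeast0 less_eq_Suc_le sum.atLeast_Suc_lessThan)
  moreover have "lam 0 = (\<lambda>_. 1)" by (simp add: lam_def w0 fun_eq_iff)
  ultimately have eq: "(\<Sum>j\<in>{1..<m}. induced_char C (lam j) g) =
      regular_char g - induced_char C (\<lambda>_. 1) g" if "g \<in> carrier G" for g
    using that by (metis (no_types, lifting) add_diff_cancel_left')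
  have "realizable G (\<lambda>g. \<Sum>j\<in>{1..<m}. induced_char C (lam j) g)"
    by (intro realizable_sum real_lam)
  then show ?thesis unfolding C_def[symmetric] by (rule realizable_cong) (rule eq)
qed

definition cyclic_subgroups_of :: "'a set \<Rightarrow> 'a set set" where
  "cyclic_subgroups_of H = (\<lambda>h. generate G {h}) ` H"

text \<open>For cyclic \<open>H\<close> this is the order of the normalizer of \<open>H\<close>
  times the indicator function of the elements that generate a conjugate of \<open>H\<close>: the
  counted x form a coset of the normalizer, or none exists.\<close>

definition class_count :: "'a set \<Rightarrow> 'a \<Rightarrow> nat" where
  "class_count H g = card {x \<in> carrier G. generate G {inv x \<otimes> g \<otimes> x} = H}"

text \<open>The left side counts the x that conjugate g into \<open>H\<close>; they are sorted by
  the cyclic group which the conjugate generates.\<close>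

lemma sum_class_count:
  assumes fin: "finite (carrier G)" and H: "subgroup H G" and g: "g \<in> carrier G"
  shows "of_nat (card H) * induced_char H (\<lambda>_. 1) g =
           of_nat (\<Sum>K\<in>cyclic_subgroups_of H. class_count K g)"
proof -
  interpret H: subgroup H G by (rule H)
  have finH: "finite H" using H.subset fin finite_subset by blast
  have "{x \<in> carrier G. inv x \<otimes> g \<otimes> x \<in> H} =
      (\<Union>K\<in>cyclic_subgroups_of H. {x \<in> carrier G. generate G {inv x \<otimes> g \<otimes> x} = K})" (is "?L = ?R")
  proof
    show "?L \<subseteq> ?R" by (auto simp: cyclic_subgroups_of_def)
    show "?R \<subseteq> ?L"
    proof
      fix x assume "x \<in> ?R"
      then obtain h where h: "h \<in> H" "x \<in> carrier G" "generate G {inv x \<otimes> g \<otimes> x} = generate G {h}"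
        by (auto simp: cyclic_subgroups_of_def)
      have "generate G {h} \<subseteq> H" using h H by (intro generate_subgroup_incl) auto
      moreover have "inv x \<otimes> g \<otimes> x \<in> generate G {inv x \<otimes> g \<otimes> x}" by (rule generate.incl) auto
      ultimately show "x \<in> ?L" using h by auto
    qed
  qed
  then have "card ?L = (\<Sum>K\<in>cyclic_subgroups_of H. class_count K g)"
    unfolding class_count_def using fin finH
    by (simp only:) (rule card_UN_disjoint, auto simp: cyclic_subgroups_of_def)
  moreover have "card H > 0" using finH H.one_closed card_gt_0_iff by blast
  ultimately show ?thesis by (simp add: induced_char_def)
qed

text \<open>For cyclic \<open>H\<close> the system \<open>sum_class_count\<close> is triangular
  under inclusion with diagonal entries 1, so induction on the order solves it over the integers.
  Each step subtracts the counts of smaller subgroups, hence both signs are carried along.\<close>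

lemma virtual_char_class_count:
  assumes fin: "finite (carrier G)" and c: "c \<in> carrier G"
  shows "virtual_char (\<lambda>g. of_nat (class_count (generate G {c}) g)) \<and>
         virtual_char (\<lambda>g. - of_nat (class_count (generate G {c}) g))"
  using c
proof (induction "card (generate G {c})" arbitrary: c rule: less_induct)
  case (less c)
  define H where "H = generate G {c}"
  have H: "subgroup H G" unfolding H_def using less.prems by (intro generate_is_subgroup) auto
  interpret H: subgroup H G by (rule H)
  have finH: "finite H" using H.subset fin finite_subset by blast
  have cH: "c \<in> H" unfolding H_def by (rule generate.incl) auto
  define S where "S = cyclic_subgroups_of H - {H}"
  have Hin: "H \<in> cyclic_subgroups_of H" using cH by (auto simp: cyclic_subgroups_of_def H_def)
  have finS: "finite (cyclic_subgroups_of H)" using finH by (simp add: cyclic_subgroups_of_def)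
  have IH: "virtual_char (\<lambda>g. of_nat (class_count K g)) \<and> virtual_char (\<lambda>g. - of_nat (class_count K g))"
    if "K \<in> S" for K
  proof -
    obtain h where h: "h \<in> H" "K = generate G {h}" using \<open>K \<in> S\<close> by (auto simp: S_def cyclic_subgroups_of_def)
    have "K \<subset> H" using h H \<open>K \<in> S\<close> generate_subgroup_incl[of "{h}" H] by (auto simp: S_def)
    then have "card K < card H" using finH by (intro psubset_card_mono)
    then show ?thesis using less.hyps[of h] h by (simp add: H_def)
  qed
  have eq: "of_nat (class_count H g) + (\<Sum>K\<in>S. of_nat (class_count K g)) =
      of_nat (card H) * induced_char H (\<lambda>_. 1) g" if "g \<in> carrier G" for g
    using sum_class_count[OF fin H that] sum.remove[OF finS Hin, of "\<lambda>K. class_count K g"]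
    by (simp add: S_def)
  have ind: "virtual_char (induced_char H (\<lambda>_. 1))"
    by (intro realizable_imp_virtual_char fin realizable_induced H) auto
  have neg: "virtual_char (\<lambda>g. - induced_char H (\<lambda>_. 1) g)"
    unfolding virtual_char_def
  proof (intro exI allI impI)
    fix L :: nat assume L: "1 \<le> L"
    have "realizable G (\<lambda>g. (regular_char g - induced_char H (\<lambda>_. 1) g) + of_nat (L - 1) * regular_char g)"
      unfolding H_def using fin less.prems realizable_regular[OF fin]
      by (intro realizable_add realizable_regular_minus_permutation realizable_mult_of_nat)
         (auto simp: regular_char_def[abs_def])
    then show "realizable G (\<lambda>g. - induced_char H (\<lambda>_. 1) g + of_nat L * regular_char g)"
      by (rule realizable_cong) (use L in \<open>simp add: of_nat_diff algebra_simps\<close>)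
  qed
  have "virtual_char (\<lambda>g. of_nat (card H) * induced_char H (\<lambda>_. 1) g + (\<Sum>K\<in>S. - of_nat (class_count K g)))"
    using IH fin by (intro virtual_char_add virtual_char_sum virtual_char_mult_of_nat ind) auto
  then have 1: "virtual_char (\<lambda>g. of_nat (class_count H g))"
    by (rule virtual_char_cong) (simp add: sum_negf flip: eq)
  have "virtual_char (\<lambda>g. of_nat (card H) * - induced_char H (\<lambda>_. 1) g + (\<Sum>K\<in>S. of_nat (class_count K g)))"
    using IH fin by (intro virtual_char_add virtual_char_sum virtual_char_mult_of_nat neg) auto
  then have 2: "virtual_char (\<lambda>g. - of_nat (class_count H g))"
    by (rule virtual_char_cong) (simp flip: eq)
  from 1 2 show ?case by (simp add: H_def)
qed

lemma class_count_one:
  assumes g: "g \<in> carrier G"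
  shows "of_nat (class_count {\<one>} g) = regular_char g"
proof -
  have "generate G {y} = {\<one>} \<longleftrightarrow> y = \<one>" if "y \<in> carrier G" for y
    using generate.incl[of y "{y}" G] generate_one by auto
  then have "{x \<in> carrier G. generate G {inv x \<otimes> g \<otimes> x} = {\<one>}} =
      {x. x \<in> carrier G \<and> inv x \<otimes> g \<otimes> x \<in> {\<one>}}" using g by (auto simp: generate_one)
  then show ?thesis using induced_char_trivial[OF g]
    by (simp add: class_count_def induced_char_def regular_char_def)
qed

text \<open>As H runs through the cyclic subgroups, every x is counted once by
  \<open>class_count\<close>, so the counts weighted by \<open>b (card H)\<close> add up to |G|
  times \<open>b (ord g)\<close>. The trivial subgroup contributes \<open>b 1\<close> regular
  characters, and these pay for the copies that make the other counts characters.\<close>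

lemma realizable_multiple_order_function:
  assumes fin: "finite (carrier G)"
  obtains K where "\<And>b :: nat \<Rightarrow> nat. (\<And>g. g \<in> carrier G \<Longrightarrow> g \<noteq> \<one> \<Longrightarrow> K * b (ord g) \<le> b 1) \<Longrightarrow>
     realizable G (\<lambda>g. of_nat (order G * b (ord g)))"
proof -
  define S where "S = cyclic_subgroups_of (carrier G) - {{\<one>}}"
  have finS: "finite (cyclic_subgroups_of (carrier G))" using fin by (simp add: cyclic_subgroups_of_def)
  have "\<forall>H\<in>S. \<exists>K. \<forall>L\<ge>K. realizable G (\<lambda>g. of_nat (class_count H g) + of_nat L * regular_char g)"
    using virtual_char_class_count[OF fin]
    unfolding virtual_char_def S_def cyclic_subgroups_of_def by blast
  then obtain k where k: "\<And>H L. H \<in> S \<Longrightarrow> L \<ge> k H \<Longrightarrow>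
      realizable G (\<lambda>g. of_nat (class_count H g) + of_nat L * regular_char g)" by metis
  define K where "K = (\<Sum>H\<in>S. k H)"
  \<comment> \<open>The factor \<open>card S\<close> turns the bounds for single subgroups into one
    for their sum: they are added over \<open>S\<close> and \<open>card S\<close> is
    cancelled.\<close>
  show ?thesis
  proof (rule that[of "K * card S"])
    fix b :: "nat \<Rightarrow> nat"
    assume b: "\<And>g. g \<in> carrier G \<Longrightarrow> g \<noteq> \<one> \<Longrightarrow> K * card S * b (ord g) \<le> b 1"
    have cH: "K * card S * b (card H) \<le> b 1" if "H \<in> S" for H
    proof -
      obtain h where h: "h \<in> carrier G" "H = generate G {h}"
        using \<open>H \<in> S\<close> unfolding S_def cyclic_subgroups_of_def by blast
      have "h \<noteq> \<one>" using h \<open>H \<in> S\<close> generate_one by (auto simp: S_def)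
      then show ?thesis using b[of h] h generate_pow_card[of h] by simp
    qed
    have "card S * (K * (\<Sum>H\<in>S. b (card H))) = (\<Sum>H\<in>S. K * card S * b (card H))"
      by (simp add: sum_distrib_left mult_ac)
    also have "\<dots> \<le> (\<Sum>H\<in>S. b 1)" by (intro sum_mono cH)
    also have "\<dots> = card S * b 1" by simp
    finally have "card S * (K * (\<Sum>H\<in>S. b (card H))) \<le> card S * b 1" .
    then have le: "K * (\<Sum>H\<in>S. b (card H)) \<le> b 1"
    proof (cases "S = {}")
      case False
      moreover have "finite S" using finS by (simp add: S_def)
      ultimately have "card S > 0" by (simp add: card_gt_0_iff)
      then show ?thesis using \<open>card S * (K * (\<Sum>H\<in>S. b (card H))) \<le> card S * b 1\<close> by simp
    qed simp
    have kK: "k H \<le> K" if "H \<in> S" for H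
      unfolding K_def using that finS by (intro member_le_sum) (auto simp: S_def)
    have "realizable G (\<lambda>g. (\<Sum>H\<in>S. of_nat (b (card H)) * (of_nat (class_count H g) + of_nat K * regular_char g))
        + of_nat (b 1 - K * (\<Sum>H\<in>S. b (card H))) * regular_char g)"
    proof (intro realizable_add[OF realizable_sum])
      fix H assume "H \<in> S"
      then show "realizable G (\<lambda>g. of_nat (b (card H)) * (of_nat (class_count H g) + of_nat K * regular_char g))"
        by (intro realizable_mult_of_nat k kK)
    next
      show "realizable G (\<lambda>g. of_nat (b 1 - K * (\<Sum>H\<in>S. b (card H))) * regular_char g)"
        using realizable_regular[OF fin] unfolding regular_char_def by (rule realizable_mult_of_nat)
    qed
    then show "realizable G (\<lambda>g. of_nat (order G * b (ord g)))"
    proof (rule realizable_cong)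
      fix g assume g: "g \<in> carrier G"
      have one: "{\<one>} \<in> cyclic_subgroups_of (carrier G)"
        unfolding cyclic_subgroups_of_def by (rule image_eqI[of _ _ \<one>]) (simp_all add: generate_one)
      have ordc: "card (generate G {inv x \<otimes> g \<otimes> x}) = ord g" if x: "x \<in> carrier G" for x
      proof -
        have "(inv x \<otimes> g \<otimes> x) [^] n = inv x \<otimes> (g [^] n) \<otimes> x" for n :: nat
          using x g by (induction n) (simp_all add: m_assoc flip: m_assoc[of x "inv x"])
        moreover have "inv x \<otimes> y \<otimes> x = \<one> \<longleftrightarrow> y = \<one>" if y: "y \<in> carrier G" for y
        proof
          assume *: "inv x \<otimes> y \<otimes> x = \<one>"
          have "y = x \<otimes> (inv x \<otimes> y \<otimes> x) \<otimes> inv x"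
            using x y by (simp add: m_assoc flip: m_assoc[of x "inv x"])
          then show "y = \<one>" using * x by simp
        qed (use x in auto)
        ultimately have "ord (inv x \<otimes> g \<otimes> x) = ord g"
          using x g by (subst ord_unique) (auto simp: pow_eq_id)
        then show ?thesis using generate_pow_card[of "inv x \<otimes> g \<otimes> x"] x g by simp
      qed
      have "(\<Sum>H\<in>cyclic_subgroups_of (carrier G). b (card H) * class_count H g) =
          (\<Sum>H\<in>cyclic_subgroups_of (carrier G). \<Sum>x | x \<in> carrier G \<and> generate G {inv x \<otimes> g \<otimes> x} = H. b (ord g))"
      proof (intro sum.cong refl)
        fix H
        have "(\<Sum>x | x \<in> carrier G \<and> generate G {inv x \<otimes> g \<otimes> x} = H. b (ord g)) =
           (\<Sum>x | x \<in> carrier G \<and> generate G {inv x \<otimes> g \<otimes> x} = H. b (card H))"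
          using ordc by (intro sum.cong refl) auto
        then show "b (card H) * class_count H g =
           (\<Sum>x | x \<in> carrier G \<and> generate G {inv x \<otimes> g \<otimes> x} = H. b (ord g))"
          by (auto simp: class_count_def)
      qed
      also have "\<dots> = (\<Sum>x\<in>carrier G. b (ord g))"
        using fin finS g by (intro sum.group) (auto simp: cyclic_subgroups_of_def)
      finally have tot: "(\<Sum>H\<in>cyclic_subgroups_of (carrier G). b (card H) * class_count H g) = order G * b (ord g)"
        by (simp add: order_def)
      have "of_nat (order G * b (ord g)) =
          of_nat (b 1) * of_nat (class_count {\<one>} g) + (\<Sum>H\<in>S. of_nat (b (card H)) * (of_nat (class_count H g) :: complex))"
        unfolding tot[symmetric] sum.remove[OF finS one] S_def by simp
      then show "(\<Sum>H\<in>S. of_nat (b (card H)) * (of_nat (class_count H g) + of_nat K * regular_char g))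
        + of_nat (b 1 - K * (\<Sum>H\<in>S. b (card H))) * regular_char g = of_nat (order G * b (ord g))"
        using le by (simp add: class_count_one[OF g] of_nat_diff algebra_simps sum.distrib sum_distrib_left sum_distrib_right)
    qed
  qed
qed

text \<open>Division with remainder by |G|: the remainder is common to all orders and gives copies
  of the trivial character, and the quotients inherit the dominance condition.\<close>

lemma realizable_order_function:
  assumes fin: "finite (carrier G)"
  obtains K where "\<And>a :: nat \<Rightarrow> nat.
     (\<And>g. g \<in> carrier G \<Longrightarrow> g \<noteq> \<one> \<Longrightarrow> [a (ord g) = a 1] (mod order G) \<and> K * a (ord g) \<le> a 1) \<Longrightarrow>
     realizable G (\<lambda>g. of_nat (a (ord g)))"
proof -
  obtain K where K: "\<And>b :: nat \<Rightarrow> nat. (\<And>g. g \<in> carrier G \<Longrightarrow> g \<noteq> \<one> \<Longrightarrow> K * b (ord g) \<le> b 1) \<Longrightarrow>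
     realizable G (\<lambda>g. of_nat (order G * b (ord g)))" using realizable_multiple_order_function[OF fin] by blast
  show ?thesis
  proof (rule that[of K])
    fix a :: "nat \<Rightarrow> nat"
    assume a: "\<And>g. g \<in> carrier G \<Longrightarrow> g \<noteq> \<one> \<Longrightarrow> [a (ord g) = a 1] (mod order G) \<and> K * a (ord g) \<le> a 1"
    have "realizable G (\<lambda>g. of_nat (order G * (a (ord g) div order G)))"
    proof (rule K)
      fix g assume g: "g \<in> carrier G" "g \<noteq> \<one>"
      have "K * (a (ord g) div order G) \<le> (K * a (ord g)) div order G"
        by (metis div_mult1_eq le_add1 mult.commute)
      also have "\<dots> \<le> a 1 div order G" using a[OF g] by (intro div_le_mono) auto
      finally show "K * (a (ord g) div order G) \<le> a 1 div order G" .
    qed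
    then have "realizable G (\<lambda>g. of_nat (a 1 mod order G) * 1 + of_nat (order G * (a (ord g) div order G)))"
      by (intro realizable_add realizable_mult_of_nat realizable_1)
    then show "realizable G (\<lambda>g. of_nat (a (ord g)))"
    proof (rule realizable_cong)
      fix g assume g: "g \<in> carrier G"
      have "a (ord g) mod order G = a 1 mod order G"
        using a[OF g] ord_eq_1[OF g] by (cases "g = \<one>") (auto simp: cong_def)
      then have "a 1 mod order G + order G * (a (ord g) div order G) = a (ord g)"
        by (metis mod_mult_div_eq)
      then show "of_nat (a 1 mod order G) * 1 + of_nat (order G * (a (ord g) div order G)) =
          (of_nat (a (ord g)) :: complex)"
        by (metis mult.right_neutral of_nat_add)
    qed
  qed
qed

end

section \<open>Graded modules with prescribed characters\<close>

definition pm_scale :: "complex \<Rightarrow> (nat \<Rightarrow>\<^sub>0 complex) \<Rightarrow> (nat \<Rightarrow>\<^sub>0 complex)" where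
  "pm_scale c f = Poly_Mapping.map ((*) c) f"

lemma lookup_pm_scale [simp]: "poly_mapping.lookup (pm_scale c f) k = c * poly_mapping.lookup f k"
  by (auto simp: pm_scale_def Poly_Mapping.map.rep_eq when_def)

interpretation pm: complex_vector_space pm_scale
  by unfold_locales (auto intro!: poly_mapping_eqI simp: Poly_Mapping.lookup_add algebra_simps)

text \<open>A finite spanning set has its support in finitely many coordinates.\<close>

lemma pm_infinite_dim: "\<not> pm.finite_dim UNIV"
proof
  assume "pm.finite_dim UNIV"
  then obtain B where B: "finite B" "pm.span B = UNIV" unfolding pm.finite_dim_def by auto
  define K where "K = (\<Union>b\<in>B. Poly_Mapping.keys b)"
  have "pm.subspace {f. Poly_Mapping.keys f \<subseteq> K}"
  proof (intro pm.subspaceI)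
    show "x + y \<in> {f. Poly_Mapping.keys f \<subseteq> K}"
      if "x \<in> {f. Poly_Mapping.keys f \<subseteq> K}" "y \<in> {f. Poly_Mapping.keys f \<subseteq> K}" for x y
      using that Poly_Mapping.keys_add[of x y] by blast
    show "pm_scale c x \<in> {f. Poly_Mapping.keys f \<subseteq> K}" if "x \<in> {f. Poly_Mapping.keys f \<subseteq> K}" for c x
      using that by (auto simp: Poly_Mapping.in_keys_iff subset_iff)
  qed simp
  then have "pm.span B \<subseteq> {f. Poly_Mapping.keys f \<subseteq> K}" by (intro pm.span_minimal) (auto simp: K_def)
  then have "Poly_Mapping.keys (Poly_Mapping.single k (1::complex)) \<subseteq> K" for k using B by blast
  then have "UNIV \<subseteq> K" by auto
  moreover have "finite K" using B by (simp add: K_def)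
  ultimately show False using finite_subset infinite_UNIV_nat by blast
qed

text \<open>The module has to fill the whole type of finitely supported functions, so the basis
  vectors of all graded pieces together must be in bijection with the naturals. As pairs of a degree
  and an index they are countable, and they are infinite in number because infinitely many degrees
  have nonzero dimension.\<close>

lemma graded_module_exists:
  fixes G :: "('a, 'b) monoid_scheme" (structure) and I :: "int set" and X :: "int \<Rightarrow> 'a \<Rightarrow> complex"
  assumes "group G" and realz: "\<And>n. n \<in> I \<Longrightarrow> realizable G (X n)"
    and inf: "infinite {n \<in> I. X n \<one>\<^bsub>G\<^esub> \<noteq> 0}"
  shows "\<exists>\<rho> V. graded_group_module G pm_scale \<rho> I V \<and>
           (\<forall>g\<in>carrier G. \<forall>n\<in>I. pm.endo_trace (V n) (\<rho> g) = X n g)"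
proof -
  interpret group G by fact
  define Q where "Q n D R \<longleftrightarrow> (\<forall>i<D. \<forall>j<D. R \<one> i j = of_bool (i = j)) \<and>
     (\<forall>g\<in>carrier G. \<forall>h\<in>carrier G. \<forall>i<D. \<forall>j<D. R (g \<otimes> h) i j = (\<Sum>k<D. R g i k * R h k j)) \<and>
     (\<forall>g\<in>carrier G. X n g = (\<Sum>i<D. R g i i))" for n and D :: nat and R
  have "\<forall>n\<in>I. \<exists>D R. Q n D R" using realz unfolding realizable_def Q_def by blast
  then obtain D R where QDR: "\<And>n. n \<in> I \<Longrightarrow> Q n (D n) (R n)" by metis
  have R1: "R n \<one> i j = of_bool (i = j)" if "n \<in> I" "i < D n" "j < D n" for n i j
    using QDR[OF that(1)] that unfolding Q_def by blast
  have R2: "R n (g \<otimes> h) i j = (\<Sum>k<D n. R n g i k * R n h k j)"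
    if "n \<in> I" "g \<in> carrier G" "h \<in> carrier G" "i < D n" "j < D n" for n g h i j
    using QDR[OF that(1)] that unfolding Q_def by blast
  have R3: "X n g = (\<Sum>i<D n. R n g i i)" if "n \<in> I" "g \<in> carrier G" for n g
    using QDR[OF that(1)] that unfolding Q_def by blast
  define P where "P = Sigma I (\<lambda>n. {..<D n})"
  have "infinite P"
  proof
    assume "finite P"
    moreover have "{n \<in> I. X n \<one> \<noteq> 0} \<subseteq> fst ` P"
    proof
      fix n assume n: "n \<in> {n \<in> I. X n \<one> \<noteq> 0}"
      then have "D n \<noteq> 0" using R3[of n \<one>] by (intro notI) simp
      then have "(n, 0) \<in> P" using n by (auto simp: P_def)
      then show "n \<in> fst ` P" by force
    qed
    ultimately show False using inf by (meson finite_imageI finite_subset)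
  qed
  then obtain f :: "int \<times> nat \<Rightarrow> nat" where f: "bij_betw f P UNIV"
    using countableE_infinite[of P] by auto
  define e where "e = inv_into P f"
  have e: "bij_betw e UNIV P" unfolding e_def by (rule bij_betw_inv_into[OF f])
  define k where "k = (\<lambda>n i. inv_into UNIV e (n, i))"
  have ek: "e (k n i) = (n, i)" if "n \<in> I" "i < D n" for n i
    using bij_betw_inv_into_right[OF e, of "(n, i)"] that by (simp add: P_def k_def)
  have ke: "k (fst (e l)) (snd (e l)) = l" for l
    using bij_betw_inv_into_left[OF e, of l] by (simp add: k_def)
  have "e l \<in> P" for l using e by (auto simp: bij_betw_def)
  then have eP: "fst (e l) \<in> I" "snd (e l) < D (fst (e l))" for l
    unfolding P_def by (metis lessThan_iff mem_Sigma_iff prod.collapse)+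
  have kinj: "k n i = k n j \<longleftrightarrow> i = j" if "n \<in> I" "i < D n" "j < D n" for n i j
    using ek that by (metis prod.inject)
  \<comment> \<open>The block diagonal action: coordinate \<open>l\<close> stands for the pair
    \<open>e l\<close> of a degree and an index, and only coordinates of the same degree
    enter.\<close>
  define F where "F g f l = (\<Sum>j<D (fst (e l)). R (fst (e l)) g (snd (e l)) j * poly_mapping.lookup f (k (fst (e l)) j))" for g f l
  define \<rho> where "\<rho> g f = Abs_poly_mapping (F g f)" for g f
  have finF: "finite {l. F g f l \<noteq> 0}" for g f
  proof (rule finite_subset)
    show "finite ((\<lambda>(n, i). k n i) ` (SIGMA n : (fst \<circ> e) ` Poly_Mapping.keys f. {..<D n}))" by auto
    show "{l. F g f l \<noteq> 0} \<subseteq> (\<lambda>(n, i). k n i) ` (SIGMA n : (fst \<circ> e) ` Poly_Mapping.keys f. {..<D n})"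
    proof
      fix l assume "l \<in> {l. F g f l \<noteq> 0}"
      then obtain j where j: "j < D (fst (e l))" "poly_mapping.lookup f (k (fst (e l)) j) \<noteq> 0"
        unfolding F_def by (auto elim: sum.not_neutral_contains_not_neutral)
      then have "fst (e l) \<in> (fst \<circ> e) ` Poly_Mapping.keys f"
        using ek[OF eP(1) j(1)]
        by (intro image_eqI[of _ _ "k (fst (e l)) j"]) (simp_all add: Poly_Mapping.in_keys_iff)
      then show "l \<in> (\<lambda>(n, i). k n i) ` (SIGMA n : (fst \<circ> e) ` Poly_Mapping.keys f. {..<D n})"
        using eP[of l] ke[of l]
        by (cases "e l") (simp only: prod.sel, intro rev_image_eqI[of "e l"], simp_all)
    qed
  qed
  have rho: "poly_mapping.lookup (\<rho> g f) l = F g f l" for g f l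
    unfolding \<rho>_def using finF by (simp add: Abs_poly_mapping_inverse)
  have rhok: "poly_mapping.lookup (\<rho> g f) (k n i) = (\<Sum>j<D n. R n g i j * poly_mapping.lookup f (k n j))"
    if "n \<in> I" "i < D n" for g f n i
    using ek[OF that] by (simp add: rho F_def)
  define V where "V n = {f :: nat \<Rightarrow>\<^sub>0 complex. \<forall>l. poly_mapping.lookup f l \<noteq> 0 \<longrightarrow> fst (e l) = n}" for n
  have keq: "f = f'" if "\<And>n i. n \<in> I \<Longrightarrow> i < D n \<Longrightarrow> poly_mapping.lookup f (k n i) = poly_mapping.lookup f' (k n i)"
    for f f' :: "nat \<Rightarrow>\<^sub>0 complex"
    using that eP ke by (intro poly_mapping_eqI) metis
  have lin: "Vector_Spaces.linear pm_scale pm_scale (\<rho> g)" for g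
    by (unfold_locales)
       (auto intro!: poly_mapping_eqI simp: rho F_def Poly_Mapping.lookup_add algebra_simps sum.distrib sum_distrib_left)
  have sub: "pm.subspace (V n)" for n
    unfolding pm.subspace_def V_def by (auto simp: Poly_Mapping.lookup_add) (metis add_0)
  have inv: "\<rho> g ` V n \<subseteq> V n" for g n
  proof
    fix y assume "y \<in> \<rho> g ` V n"
    then obtain f where f: "f \<in> V n" "y = \<rho> g f" by auto
    have "fst (e l) = n" if nz: "F g f l \<noteq> 0" for l
    proof -
      obtain j where j: "j < D (fst (e l))" "poly_mapping.lookup f (k (fst (e l)) j) \<noteq> 0"
        using nz unfolding F_def by (auto elim: sum.not_neutral_contains_not_neutral)
      then show ?thesis using f ek[OF eP(1) j(1)] unfolding V_def by force
    qed
    then show "y \<in> V n" using f by (simp add: V_def rho)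
  qed
  define b where "b n i = Poly_Mapping.single (k n i) (1::complex)" for n i
  define B where "B n = b n ` {..<D n}" for n
  have lb: "poly_mapping.lookup (b n i) l = (if l = k n i then 1 else 0)" for n i l
    by (simp add: b_def Poly_Mapping.lookup_single when_def)
  have binj: "inj_on (b n) {..<D n}" if "n \<in> I" for n
  proof (rule inj_onI)
    fix i j assume ij: "i \<in> {..<D n}" "j \<in> {..<D n}" "b n i = b n j"
    then have "poly_mapping.lookup (b n i) (k n i) = poly_mapping.lookup (b n j) (k n i)" by simp
    then have "k n i = k n j" by (simp add: lb split: if_splits)
    then show "i = j" using kinj[OF that] ij by simp
  qed
  have comb: "poly_mapping.lookup (\<Sum>x\<in>B n. pm_scale (c x) x) (k n i) = c (b n i)" if "n \<in> I" "i < D n" for n i c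
  proof -
    have "poly_mapping.lookup (\<Sum>x\<in>B n. pm_scale (c x) x) (k n i) = (\<Sum>j<D n. c (b n j) * poly_mapping.lookup (b n j) (k n i))"
      unfolding B_def by (subst sum.reindex[OF binj]) (auto simp: that Poly_Mapping.lookup_sum)
    also have "\<dots> = (\<Sum>j<D n. if j = i then c (b n i) else 0)"
      using that kinj by (intro sum.cong) (auto simp: lb)
    finally show ?thesis using that by simp
  qed
  have ind: "pm.independent (B n)" if "n \<in> I" for n
  proof (rule pm.independent_if_scalars_zero)
    show "finite (B n)" by (simp add: B_def)
    fix c x assume s: "(\<Sum>x\<in>B n. pm_scale (c x) x) = 0" and x: "x \<in> B n"
    then obtain i where "i < D n" "x = b n i" by (auto simp: B_def)
    then show "c x = 0" using comb[OF that, of i c] s by simp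
  qed
  have spanB: "pm.span (B n) = V n" if n: "n \<in> I" for n
  proof
    show "pm.span (B n) \<subseteq> V n"
      by (intro pm.span_minimal sub) (use n ek in \<open>auto simp: B_def V_def lb split: if_splits\<close>)
    show "V n \<subseteq> pm.span (B n)"
    proof
      fix f assume f: "f \<in> V n"
      have "f = (\<Sum>i<D n. pm_scale (poly_mapping.lookup f (k n i)) (b n i))"
      proof (rule keq)
        fix m i assume m: "m \<in> I" "i < D m"
        show "poly_mapping.lookup f (k m i) = poly_mapping.lookup (\<Sum>i<D n. pm_scale (poly_mapping.lookup f (k n i)) (b n i)) (k m i)"
        proof (cases "m = n")
          case True
          have "poly_mapping.lookup (\<Sum>i<D n. pm_scale (poly_mapping.lookup f (k n i)) (b n i)) (k m i) =
             (\<Sum>j<D n. if j = i then poly_mapping.lookup f (k n i) else 0)"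
            unfolding Poly_Mapping.lookup_sum using m True kinj by (intro sum.cong refl) (auto simp: lb)
          then show ?thesis using True m by simp
        next
          case False
          then have "poly_mapping.lookup f (k m i) = 0" using f ek[OF m] unfolding V_def by force
          moreover have "k m i \<noteq> k n j" if "j < D n" for j using ek[OF m] ek[OF n that] False by auto
          ultimately show ?thesis by (auto simp: Poly_Mapping.lookup_sum lb intro!: sum.neutral)
        qed
      qed
      also have "\<dots> \<in> pm.span (B n)"
        by (intro pm.span_sum pm.span_scale pm.span_base) (auto simp: B_def)
      finally show "f \<in> pm.span (B n)" .
    qed
  qed
  have dec: "pm.direct_sum_decomposition I V"
    unfolding pm.direct_sum_decomposition_def
  proof (intro conjI ballI allI sub)
    fix v :: "nat \<Rightarrow>\<^sub>0 complex"
    define u where "u n = Abs_poly_mapping (\<lambda>l. if fst (e l) = n then poly_mapping.lookup v l else 0)" for n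
    have "finite {l. (if fst (e l) = n then poly_mapping.lookup v l else 0) \<noteq> 0}" for n
      by (rule finite_subset[OF _ Poly_Mapping.finite_keys[of v]]) (auto simp: Poly_Mapping.in_keys_iff)
    then have lu: "poly_mapping.lookup (u n) l = (if fst (e l) = n then poly_mapping.lookup v l else 0)" for n l
      unfolding u_def by (simp add: Abs_poly_mapping_inverse)
    \<comment> \<open>At each coordinate only the summand of its own degree can be nonzero. This
      yields existence as well as uniqueness of the decomposition.\<close>
    have comp: "poly_mapping.lookup (\<Sum>n | w n \<noteq> 0. w n) l = poly_mapping.lookup (w (fst (e l))) l"
      if "\<forall>n\<in>I. w n \<in> V n" "\<forall>n. n \<notin> I \<longrightarrow> w n = 0" "finite {n. w n \<noteq> 0}" for w l
    proof -
      have "poly_mapping.lookup (\<Sum>n | w n \<noteq> 0. w n) l = (\<Sum>n | w n \<noteq> 0. poly_mapping.lookup (w n) l)" by (simp add: Poly_Mapping.lookup_sum)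
      also have "\<dots> = (\<Sum>n | w n \<noteq> 0. if n = fst (e l) then poly_mapping.lookup (w (fst (e l))) l else 0)"
        using that(1,2) by (intro sum.cong refl) (auto simp: V_def)
      also have "\<dots> = poly_mapping.lookup (w (fst (e l))) l" using that(3) by (auto simp: sum.delta)
      finally show ?thesis .
    qed
    have u1: "\<forall>n\<in>I. u n \<in> V n" by (auto simp: V_def lu)
    have u2: "\<forall>n. n \<notin> I \<longrightarrow> u n = 0" using eP by (auto intro!: poly_mapping_eqI simp: lu)
    have u3: "finite {n. u n \<noteq> 0}"
    proof (rule finite_subset)
      show "finite ((fst \<circ> e) ` Poly_Mapping.keys v)" by simp
      show "{n. u n \<noteq> 0} \<subseteq> (fst \<circ> e) ` Poly_Mapping.keys v"
      proof
        fix n assume "n \<in> {n. u n \<noteq> 0}"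
        then obtain l where "poly_mapping.lookup (u n) l \<noteq> 0" by (metis mem_Collect_eq poly_mapping_eqI Poly_Mapping.lookup_zero)
        then show "n \<in> (fst \<circ> e) ` Poly_Mapping.keys v" by (auto simp: lu in_keys_iff split: if_splits)
      qed
    qed
    show "\<exists>!u. (\<forall>n\<in>I. u n \<in> V n) \<and> (\<forall>n. n \<notin> I \<longrightarrow> u n = 0) \<and>
               finite {n. u n \<noteq> 0} \<and> v = (\<Sum>n | u n \<noteq> 0. u n)"
    proof (rule ex1I[of _ u])
      show "(\<forall>n\<in>I. u n \<in> V n) \<and> (\<forall>n. n \<notin> I \<longrightarrow> u n = 0) \<and>
               finite {n. u n \<noteq> 0} \<and> v = (\<Sum>n | u n \<noteq> 0. u n)"
        using u1 u2 u3 comp[OF u1 u2 u3] by (auto intro!: poly_mapping_eqI simp: lu)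
      fix w assume w: "(\<forall>n\<in>I. w n \<in> V n) \<and> (\<forall>n. n \<notin> I \<longrightarrow> w n = 0) \<and>
               finite {n. w n \<noteq> 0} \<and> v = (\<Sum>n | w n \<noteq> 0. w n)"
      show "w = u"
      proof (intro ext poly_mapping_eqI)
        fix n l
        have "poly_mapping.lookup v l = poly_mapping.lookup (w (fst (e l))) l" using comp[of w l] w by simp
        moreover have "poly_mapping.lookup (w n) l = 0" if "fst (e l) \<noteq> n"
          using w that by (cases "n \<in> I") (auto simp: V_def)
        ultimately show "poly_mapping.lookup (w n) l = poly_mapping.lookup (u n) l" by (auto simp: lu)
      qed
    qed
  qed
  have tr: "pm.endo_trace (V n) (\<rho> g) = X n g" if n: "n \<in> I" and g: "g \<in> carrier G" for n g
  proof -
    have "pm.endo_trace (V n) (\<rho> g) = (\<Sum>x\<in>B n. pm.representation (B n) (\<rho> g x) x)"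
      by (rule pm.endo_trace_eq[OF lin ind[OF n] _ spanB[OF n] inv]) (simp add: B_def)
    also have "\<dots> = (\<Sum>i<D n. pm.representation (B n) (\<rho> g (b n i)) (b n i))"
      unfolding B_def by (subst sum.reindex[OF binj[OF n]]) simp
    also have "\<dots> = (\<Sum>i<D n. R n g i i)"
    proof (intro sum.cong refl)
      fix i assume i: "i \<in> {..<D n}"
      have "b n i \<in> V n" using spanB[OF n] i by (auto intro!: pm.span_base simp: B_def)
      then have "\<rho> g (b n i) \<in> pm.span (B n)" using inv spanB[OF n] by blast
      then have "(\<Sum>x\<in>B n. pm_scale (pm.representation (B n) (\<rho> g (b n i)) x) x) = \<rho> g (b n i)"
        by (intro pm.sum_representation_eq ind n) (auto simp: B_def)
      then have "pm.representation (B n) (\<rho> g (b n i)) (b n i) = poly_mapping.lookup (\<rho> g (b n i)) (k n i)"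
        using comb[OF n, of i "pm.representation (B n) (\<rho> g (b n i))"] i by simp
      also have "\<dots> = (\<Sum>j<D n. if j = i then R n g i i else 0)"
        unfolding rhok[OF n, of i, OF i[simplified]] using n i kinj
        by (intro sum.cong) (auto simp: lb)
      finally show "pm.representation (B n) (\<rho> g (b n i)) (b n i) = R n g i i" using i by simp
    qed
    finally show ?thesis using R3[OF n g] by simp
  qed
  have "graded_group_module G pm_scale \<rho> I V"
  proof (intro graded_group_module.intro graded_group_module_axioms.intro)
    show "Group.group G" by (rule group_axioms)
    show "complex_vector_space pm_scale" by (rule pm.complex_vector_space_axioms)
    show "Vector_Spaces.linear pm_scale pm_scale (\<rho> g)" for g by (rule lin)
    show "\<rho> \<one> v = v" for v
    proof (rule keq)
      fix n i assume ni: "n \<in> I" "i < D n"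
      have "poly_mapping.lookup (\<rho> \<one> v) (k n i) = (\<Sum>j<D n. if j = i then poly_mapping.lookup v (k n i) else 0)"
        unfolding rhok[OF ni] using ni R1 by (intro sum.cong) auto
      then show "poly_mapping.lookup (\<rho> \<one> v) (k n i) = poly_mapping.lookup v (k n i)" using ni by simp
    qed
    show "\<rho> (g \<otimes> h) v = \<rho> g (\<rho> h v)" if "g \<in> carrier G" "h \<in> carrier G" for g h v
    proof (rule keq)
      fix n i assume ni: "n \<in> I" "i < D n"
      have "poly_mapping.lookup (\<rho> g (\<rho> h v)) (k n i) = (\<Sum>j<D n. R n g i j * (\<Sum>l<D n. R n h j l * poly_mapping.lookup v (k n l)))"
        unfolding rhok[OF ni] using ni by (intro sum.cong refl) (simp add: rhok)
      also have "\<dots> = (\<Sum>l<D n. (\<Sum>j<D n. R n g i j * R n h j l) * poly_mapping.lookup v (k n l))"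
        unfolding sum_distrib_left sum_distrib_right by (subst sum.swap) (simp add: mult_ac)
      also have "\<dots> = poly_mapping.lookup (\<rho> (g \<otimes> h) v) (k n i)"
        unfolding rhok[OF ni] using R2 ni that by (intro sum.cong refl) simp
      finally show "poly_mapping.lookup (\<rho> (g \<otimes> h) v) (k n i) = poly_mapping.lookup (\<rho> g (\<rho> h v)) (k n i)" by simp
    qed
    show "pm.direct_sum_decomposition I V" by (rule dec)
    show "\<rho> g ` V n \<subseteq> V n" for g n by (rule inv)
    show "pm.finite_dim (V n)" if "n \<in> I" for n
      unfolding pm.finite_dim_def using spanB[OF that] by (intro exI[of _ "B n"]) (auto simp: B_def)
  qed
  then show ?thesis using tr by blast
qed

section \<open>Partial fractions and the Lipschitz formula\<close>

lemma has_sum_int: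
  fixes f :: "int \<Rightarrow> 'a :: {topological_comm_monoid_add, t2_space}"
  assumes "((\<lambda>n::nat. f (int n)) has_sum a) UNIV" "((\<lambda>n::nat. f (- int (Suc n))) has_sum b) UNIV"
  shows "(f has_sum (a + b)) UNIV"
proof -
  have "(f has_sum a) (range int)"
    using assms(1) by (subst has_sum_reindex) (auto simp: o_def)
  moreover have "(f has_sum b) (range (\<lambda>n. - int (Suc n)))"
    using assms(2) by (subst has_sum_reindex) (auto simp: o_def inj_def)
  moreover have "range int \<union> range (\<lambda>n. - int (Suc n)) = UNIV"
  proof -
    have "x \<in> range int \<union> range (\<lambda>n. - int (Suc n))" for x
      by (cases x rule: int_cases) auto
    then show ?thesis by auto
  qed
  moreover have "range int \<inter> range (\<lambda>n. - int (Suc n)) = {}" by auto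
  ultimately show ?thesis using has_sum_Un_disjoint by metis
qed

lemma has_sum_nonzero_int:
  fixes f :: "int \<Rightarrow> 'a :: {topological_comm_monoid_add, t2_space}"
  assumes "((\<lambda>n::nat. f (int (Suc n))) has_sum a) UNIV" "((\<lambda>n::nat. f (- int (Suc n))) has_sum b) UNIV"
  shows "(f has_sum (a + b)) (UNIV - {0})"
proof -
  have "(f has_sum a) (range (\<lambda>n. int (Suc n)))"
    using assms(1) by (subst has_sum_reindex) (auto simp: o_def inj_def)
  moreover have "(f has_sum b) (range (\<lambda>n. - int (Suc n)))"
    using assms(2) by (subst has_sum_reindex) (auto simp: o_def inj_def)
  moreover have "range (\<lambda>n. int (Suc n)) \<union> range (\<lambda>n. - int (Suc n)) = UNIV - {0}"
  proof -
    have "x \<in> range (\<lambda>n. int (Suc n)) \<union> range (\<lambda>n. - int (Suc n))" if "x \<noteq> 0" for x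
    proof (cases "x > 0")
      case True
      then have "x = int (Suc (nat (x - 1)))" by simp
      then show ?thesis by blast
    next
      case False
      then have "x = - int (Suc (nat (- x - 1)))" using that by simp
      then show ?thesis by blast
    qed
    then show ?thesis by auto
  qed
  moreover have "range (\<lambda>n. int (Suc n)) \<inter> range (\<lambda>n. - int (Suc n)) = {}" by auto
  ultimately show ?thesis using has_sum_Un_disjoint by metis
qed

lemma norm_summable_inverse_shift_power:
  fixes z :: complex
  assumes k: "k \<ge> 2"
  shows "summable (\<lambda>n. norm (1 / (z + of_nat n) ^ k))"
proof (rule summable_comparison_test_ev)
  show "summable (\<lambda>n. 2 ^ k * inverse (real n ^ k))"
    using k by (intro summable_mult inverse_power_summable)
  show "\<forall>\<^sub>F n in sequentially. norm (norm (1 / (z + of_nat n) ^ k)) \<le> 2 ^ k * inverse (real n ^ k)"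
    using eventually_ge_at_top[of "nat \<lceil>2 * norm z\<rceil> + 1"]
  proof eventually_elim
    case (elim n)
    then have n: "real n \<ge> 2 * norm z" "n > 0" by linarith+
    have "norm (of_nat n :: complex) \<le> norm (z + of_nat n) + norm z"
      by (metis add_diff_cancel_left' norm_triangle_ineq4)
    then have "norm (z + of_nat n) \<ge> real n / 2" using n by simp
    then have "(real n / 2) ^ k \<le> norm (z + of_nat n) ^ k" using n by (intro power_mono) auto
    then have "inverse (norm (z + of_nat n) ^ k) \<le> inverse ((real n / 2) ^ k)"
      using n by (intro le_imp_inverse_le) auto
    moreover have "norm (norm (1 / (z + of_nat n) ^ k)) = inverse (norm (z + of_nat n) ^ k)"
      by (simp add: norm_divide norm_power inverse_eq_divide)
    moreover have "inverse ((real n / 2) ^ k) = 2 ^ k * inverse (real n ^ k)"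
      by (simp add: power_divide inverse_eq_divide)
    ultimately show ?case by simp
  qed
qed

lemma not_Ints_imp:
  fixes z :: complex
  assumes "z \<notin> \<int>"
  shows "z \<notin> \<int>\<^sub>\<le>\<^sub>0" "1 - z \<notin> \<int>\<^sub>\<le>\<^sub>0" "sin (of_real pi * z) \<noteq> 0" "z + of_int n \<noteq> 0" "z \<noteq> 0" "- z \<notin> \<int>"
proof -
  show "z \<notin> \<int>\<^sub>\<le>\<^sub>0" using assms nonpos_Ints_Int by blast
  show "1 - z \<notin> \<int>\<^sub>\<le>\<^sub>0" using assms nonpos_Ints_Int[of "1 - z"] Ints_diff[OF Ints_1, of "1 - z"] by auto
  show "sin (of_real pi * z) \<noteq> 0"
  proof
    assume "sin (of_real pi * z) = 0"
    then obtain n where "of_real pi * z = of_real (real_of_int n * pi)" by (auto simp: sin_eq_0)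
    then have "of_real pi * z = of_real pi * of_int n" by simp
    then have "z = of_int n" by (simp only: mult_cancel_left) simp
    then show False using assms by simp
  qed
  show "z + of_int n \<noteq> 0" using assms by (metis Ints_minus Ints_of_int add_eq_0_iff2)
  show "z \<noteq> 0" using assms by auto
  show "- z \<notin> \<int>" using assms minus_in_Ints_iff by blast
qed

text \<open>Both sides of the reflection formula for the entire function \<open>rGamma\<close> are
  differentiated; dividing by the formula itself gives the cotangent.\<close>

lemma Digamma_reflection:
  fixes z :: complex
  assumes z: "z \<notin> \<int>"
  shows "Digamma (1 - z) - Digamma z = of_real pi * cot (of_real pi * z)"
proof -
  note nz = not_Ints_imp[OF z]
  have eq: "rGamma w * rGamma (1 - w) = sin (of_real pi * w) / of_real pi" for w :: complex
    by (rule rGamma_reflection_complex)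
  have "((\<lambda>w. rGamma w * rGamma (1 - w)) has_field_derivative
      (- rGamma z * Digamma z) * rGamma (1 - z) + (rGamma (1 - z) * Digamma (1 - z)) * rGamma z) (at z)"
    using nz by (auto intro!: derivative_eq_intros)
  moreover have "((\<lambda>w. rGamma w * rGamma (1 - w)) has_field_derivative cos (of_real pi * z)) (at z)"
    unfolding eq by (auto intro!: derivative_eq_intros)
  ultimately have "(- rGamma z * Digamma z) * rGamma (1 - z) + (rGamma (1 - z) * Digamma (1 - z)) * rGamma z
       = cos (of_real pi * z)" by (rule DERIV_unique)
  then have "(rGamma z * rGamma (1 - z)) * (Digamma (1 - z) - Digamma z) = cos (of_real pi * z)"
    by (simp add: algebra_simps)
  then show ?thesis using nz by (simp add: eq cot_def field_simps)
qed

lemma cot_partial_fractions: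
  fixes z :: complex
  assumes z: "z \<notin> \<int>"
  shows "(\<lambda>m. 1 / (z + of_nat (Suc m)) + 1 / (z - of_nat (Suc m))) sums
           (of_real pi * cot (of_real pi * z) - 1 / z)"
proof -
  note nz = not_Ints_imp[OF z]
  have z1: "1 - z \<noteq> 0" using z by auto
  have D: "(\<lambda>n. inverse (of_nat (Suc n)) - inverse (w + of_nat n)) sums (Digamma w + euler_mascheroni)"
    if "w \<noteq> 0" for w :: complex
    unfolding Digamma_def using summable_Digamma[OF that] by (simp add: summable_sums)
  have 1: "(\<lambda>n. inverse (z + of_nat n) - inverse (1 - z + of_nat n)) sums (of_real pi * cot (of_real pi * z))"
    using sums_diff[OF D[OF z1] D[OF nz(5)]] Digamma_reflection[OF z] by simp
  \<comment> \<open>Shifts the first half of the series by one step, so that z + (n + 1) is paired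
    with z - (n + 1); the price is the term 1 / z.\<close>
  have 2: "(\<lambda>n. inverse (z + of_nat (Suc n)) - inverse (z + of_nat n)) sums (0 - inverse (z + of_nat 0))"
    by (intro telescope_sums filterlim_compose[OF tendsto_inverse_0]
              tendsto_add_filterlim_at_infinity[OF tendsto_const] tendsto_of_nat)
  have "inverse (1 - z + of_nat n) = - (1 / (z - of_nat (Suc n)))" for n
    by (simp add: divide_inverse flip: inverse_minus_eq)
  then show ?thesis using sums_add[OF 1 2] by (simp add: divide_inverse add_ac)
qed

text \<open>The terms with n >= 0 form the series at z and those with n < 0 the series at 1 - z; the
  sign (-1)^(k+1) from reversing the denominators is 1 because k is odd.\<close>

lemma Polygamma_series:
  fixes z :: complex
  assumes z: "z \<notin> \<int>" and k: "k \<ge> 1" "odd k"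
  shows "((\<lambda>n::int. fact k / (z + of_int n) ^ Suc k) has_sum (Polygamma k z + Polygamma k (1 - z))) UNIV"
proof (rule has_sum_int)
  have P: "((\<lambda>n. fact k / (w + of_nat n) ^ Suc k) has_sum Polygamma k w) UNIV" if "w \<noteq> 0" for w :: complex
  proof (rule norm_summable_imp_has_sum)
    have "summable (\<lambda>n. fact k * norm (1 / (w + of_nat n) ^ Suc k))"
      by (intro summable_mult norm_summable_inverse_shift_power) (use k in auto)
    then show "summable (\<lambda>n. norm (fact k / (w + of_nat n) ^ Suc k))"
      by (simp add: norm_divide)
    have "summable (\<lambda>n. inverse ((w + of_nat n) ^ Suc k))"
      using k that by (intro Polygamma_converges') auto
    then have "(\<lambda>n. fact k * inverse ((w + of_nat n) ^ Suc k)) sums (fact k * suminf (\<lambda>n. inverse ((w + of_nat n) ^ Suc k)))"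
      by (intro sums_mult summable_sums)
    then show "(\<lambda>n. fact k / (w + of_nat n) ^ Suc k) sums Polygamma k w"
      using k by (simp add: Polygamma_def divide_inverse)
  qed
  show "((\<lambda>n. fact k / (z + of_int (int n)) ^ Suc k) has_sum Polygamma k z) UNIV"
    using P[of z] not_Ints_imp[OF z] by simp
  have "(z + of_int (- int (Suc n))) ^ Suc k = (1 - z + of_nat n) ^ Suc k" for n
  proof -
    have e: "z + of_int (- int (Suc n)) = - (1 - z + of_nat n)" by simp
    show ?thesis unfolding e by (rule power_minus_even) (use k in simp)
  qed
  moreover have "1 - z \<noteq> 0" using z by auto
  ultimately show "((\<lambda>n. fact k / (z + of_int (- int (Suc n))) ^ Suc k) has_sum Polygamma k (1 - z)) UNIV"
    using P[of "1 - z"] by (simp del: power_Suc)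
qed

lemma open_not_Ints: "open (- \<int> :: complex set)"
  using closed_Ints by (simp add: open_Compl)

lemma csc_squared_partial_fractions:
  fixes z :: complex
  assumes z: "z \<notin> \<int>"
  shows "((\<lambda>n::int. 1 / (z + of_int n) ^ 2) has_sum (of_real pi / sin (of_real pi * z)) ^ 2) UNIV"
    "Polygamma 1 z + Polygamma 1 (1 - z) = (of_real pi / sin (of_real pi * z)) ^ 2"
proof -
  note nz = not_Ints_imp[OF z]
  have "((\<lambda>z. Digamma (1 - z) - Digamma z) has_field_derivative (- Polygamma 1 (1 - z) - Polygamma 1 z)) (at z)"
    using nz by (auto intro!: derivative_eq_intros)
  moreover have "((\<lambda>z. Digamma (1 - z) - Digamma z) has_field_derivative
      (- ((of_real pi / sin (of_real pi * z)) ^ 2))) (at z)"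
  proof (rule has_field_derivative_transform_within_open[OF _ open_not_Ints])
    show "((\<lambda>z. of_real pi * (cos (of_real pi * z) / sin (of_real pi * z))) has_field_derivative
      (- ((of_real pi / sin (of_real pi * z)) ^ 2))) (at z)"
    proof -
      have "- (s * p * p * s) - p * c * (c * p) = - (p * p)" if "s ^ 2 + c ^ 2 = 1" for s c p :: complex
      proof -
        have "- (s * p * p * s) - p * c * (c * p) = - (p * p) * (s ^ 2 + c ^ 2)"
          by (simp add: power2_eq_square algebra_simps)
        then show ?thesis using that by simp
      qed
      note * = this[OF sin_cos_squared_add[of "of_real pi * z"]]
      then show ?thesis using nz
        by (auto intro!: derivative_eq_intros simp: divide_simps power2_eq_square)
    qed
    show "of_real pi * (cos (of_real pi * x) / sin (of_real pi * x)) = Digamma (1 - x) - Digamma x"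
      if "x \<in> - \<int>" for x :: complex using Digamma_reflection[of x] that by (simp add: cot_def)
  qed (use z in auto)
  ultimately have "- Polygamma 1 (1 - z) - Polygamma 1 z = - ((of_real pi / sin (of_real pi * z)) ^ 2)"
    by (rule DERIV_unique)
  then show 1: "Polygamma 1 z + Polygamma 1 (1 - z) = (of_real pi / sin (of_real pi * z)) ^ 2"
    by (simp add: algebra_simps)
  show "((\<lambda>n::int. 1 / (z + of_int n) ^ 2) has_sum (of_real pi / sin (of_real pi * z)) ^ 2) UNIV"
    using Polygamma_series[OF z, of 1] unfolding 1 by (simp add: power2_eq_square)
qed

text \<open>The identity for \<open>Polygamma 1\<close> is differentiated twice more; the factor 3!
  = 6 that the terms acquire is divided out at the end.\<close>

lemma csc_fourth_partial_fractions:
  fixes z :: complex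
  assumes z: "z \<notin> \<int>"
  defines "s \<equiv> sin (of_real pi * z)"
  shows "((\<lambda>n::int. 1 / (z + of_int n) ^ 4) has_sum (of_real pi ^ 4 * (1 / s ^ 4 - 2 / (3 * s ^ 2)))) UNIV"
proof -
  note nz = not_Ints_imp[OF z]
  define S C where "S = (\<lambda>z::complex. sin (of_real pi * z))" and "C = (\<lambda>z::complex. cos (of_real pi * z))"
  have CS: "C w ^ 2 = 1 - S w ^ 2" for w using sin_cos_squared_add2[of "of_real pi * w"]
    by (simp add: S_def C_def algebra_simps eq_diff_eq)
  have dS: "(S has_field_derivative (of_real pi * C w)) (at w)" for w
    unfolding S_def C_def by (auto intro!: derivative_eq_intros)
  have dC: "(C has_field_derivative (- of_real pi * S w)) (at w)" for w
    unfolding S_def C_def by (auto intro!: derivative_eq_intros)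
  have d1: "Polygamma 2 w - Polygamma 2 (1 - w) = - 2 * of_real pi ^ 3 * C w / S w ^ 3" if w: "w \<notin> \<int>" for w
  proof -
    note nw = not_Ints_imp[OF w]
    have nS: "S w \<noteq> 0" using nw by (simp add: S_def)
    have "((\<lambda>z. Polygamma 1 z + Polygamma 1 (1 - z)) has_field_derivative (Polygamma 2 w - Polygamma 2 (1 - w))) (at w)"
      using nw by (auto intro!: derivative_eq_intros simp: numeral_2_eq_2)
    moreover have "((\<lambda>z. Polygamma 1 z + Polygamma 1 (1 - z)) has_field_derivative
        (- 2 * of_real pi ^ 3 * C w / S w ^ 3)) (at w)"
    proof (rule has_field_derivative_transform_within_open[OF _ open_not_Ints])
      show "((\<lambda>z. (of_real pi / S z) ^ 2) has_field_derivative (- 2 * of_real pi ^ 3 * C w / S w ^ 3)) (at w)"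
        using nS by (auto intro!: derivative_eq_intros dS simp: field_simps power2_eq_square power3_eq_cube)
      show "(of_real pi / S x) ^ 2 = Polygamma 1 x + Polygamma 1 (1 - x)" if "x \<in> - \<int>" for x
        using csc_squared_partial_fractions(2)[of x] that by (simp add: S_def)
    qed (use w in auto)
    ultimately show ?thesis by (rule DERIV_unique)
  qed
  have nS: "S z \<noteq> 0" using nz by (simp add: S_def)
  have "((\<lambda>z. Polygamma 2 z - Polygamma 2 (1 - z)) has_field_derivative (Polygamma 3 z + Polygamma 3 (1 - z))) (at z)"
    using nz by (auto intro!: derivative_eq_intros simp: numeral_3_eq_3 numeral_2_eq_2)
  moreover have "((\<lambda>z. Polygamma 2 z - Polygamma 2 (1 - z)) has_field_derivative
      (of_real pi ^ 4 * (6 / S z ^ 4 - 4 / S z ^ 2))) (at z)"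
  proof (rule has_field_derivative_transform_within_open[OF _ open_not_Ints])
    show "((\<lambda>w. - 2 * of_real pi ^ 3 * C w / S w ^ 3) has_field_derivative
        (of_real pi ^ 4 * (6 / S z ^ 4 - 4 / S z ^ 2))) (at z)"
    proof (rule DERIV_cong)
      show "((\<lambda>w. - 2 * of_real pi ^ 3 * C w / S w ^ 3) has_field_derivative
          ((- 2 * of_real pi ^ 3 * (- of_real pi * S z)) * S z ^ 3 -
            (- 2 * of_real pi ^ 3 * C z) * (of_nat 3 * (of_real pi * C z * S z ^ (3 - Suc 0)))) / (S z ^ 3 * S z ^ 3)) (at z)"
        using nS by (intro DERIV_divide DERIV_cmult DERIV_power dS dC) auto
      have "((- 2 * of_real pi ^ 3 * (- of_real pi * S z)) * S z ^ 3 -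
            (- 2 * of_real pi ^ 3 * C z) * (of_nat 3 * (of_real pi * C z * S z ^ (3 - Suc 0)))) / (S z ^ 3 * S z ^ 3)
          = of_real pi ^ 4 * (2 * S z ^ 2 + 6 * C z ^ 2) / S z ^ 4"
        using nS by (simp add: divide_simps) (simp add: algebra_simps power_numeral_reduce)
      also have "\<dots> = of_real pi ^ 4 * (6 / S z ^ 4 - 4 / S z ^ 2)"
        unfolding CS using nS by (simp add: divide_simps) (simp add: algebra_simps power_numeral_reduce)
      finally show "((- 2 * of_real pi ^ 3 * (- of_real pi * S z)) * S z ^ 3 -
            (- 2 * of_real pi ^ 3 * C z) * (of_nat 3 * (of_real pi * C z * S z ^ (3 - Suc 0)))) / (S z ^ 3 * S z ^ 3)
          = of_real pi ^ 4 * (6 / S z ^ 4 - 4 / S z ^ 2)" .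
    qed
    show "- 2 * of_real pi ^ 3 * C x / S x ^ 3 = Polygamma 2 x - Polygamma 2 (1 - x)" if "x \<in> - \<int>" for x
      using d1 that by simp
  qed (use z in auto)
  ultimately have *: "Polygamma 3 z + Polygamma 3 (1 - z) = of_real pi ^ 4 * (6 / S z ^ 4 - 4 / S z ^ 2)"
    by (rule DERIV_unique)
  have "((\<lambda>n::int. fact 3 / (z + of_int n) ^ Suc 3) has_sum (of_real pi ^ 4 * (6 / S z ^ 4 - 4 / S z ^ 2))) UNIV"
    unfolding *[symmetric] using z by (intro Polygamma_series) auto
  then have "((\<lambda>n::int. (1 / 6) * (fact 3 / (z + of_int n) ^ Suc 3)) has_sum
      (1 / 6) * (of_real pi ^ 4 * (6 / S z ^ 4 - 4 / S z ^ 2))) UNIV"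
    by (rule has_sum_cmult_right)
  then show ?thesis by (simp add: fact_numeral s_def S_def algebra_simps power_numeral_reduce)
qed

lemma norm_nome_less_1: "Im z > 0 \<Longrightarrow> norm (nome z) < 1"
  by (simp add: nome_def)

lemma nome_nonzero [simp]: "nome z \<noteq> 0" by (simp add: nome_def)

lemma sin_pi_nome:
  assumes "Im z > 0"
  shows "1 / sin (of_real pi * z) ^ 2 = - 4 * nome z / (1 - nome z) ^ 2"
proof -
  define e where "e = exp (\<i> * (of_real pi * z))"
  have q: "nome z = e ^ 2" unfolding nome_def e_def by (simp flip: exp_of_nat_mult) (simp add: algebra_simps)
  have e0: "e \<noteq> 0" by (simp add: e_def)
  have "e ^ 2 \<noteq> 1" using norm_nome_less_1[OF assms] q by auto
  have "sin (of_real pi * z) = \<i> * (1 / e - e) / 2"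
    by (simp add: sin_exp_eq' e_def exp_minus inverse_eq_divide)
  also have "\<dots> = \<i> * (1 - e ^ 2) / (2 * e)" using e0 by (simp add: field_simps power2_eq_square)
  finally show ?thesis unfolding q using e0 by (simp add: power_divide power_mult_distrib)
qed

text \<open>Derivatives of the geometric series. For the cubes, n^3 = (n - 1) n (n + 1) + n, where
  the product is the coefficient of a third derivative.\<close>

lemma sums_n_power:
  fixes q :: complex
  assumes q: "norm q < 1"
  shows "(\<lambda>n. of_nat (Suc n) * q ^ Suc n) sums (q / (1 - q) ^ 2)"
    and "(\<lambda>n. of_nat (Suc n) ^ 3 * q ^ Suc n) sums (6 * q ^ 2 / (1 - q) ^ 4 + q / (1 - q) ^ 2)"
proof -
  have ne: "1 - z \<noteq> 0" if "norm z < 1" for z :: complex using that by auto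
  have D: "((\<lambda>z. c * inverse (1 - z) ^ k) has_field_derivative c * of_nat k * inverse (1 - z) ^ Suc k) (at z)"
    if "norm z < 1" "k \<ge> 1" for z c :: complex and k
  proof -
    obtain j where j: "k = Suc j" using \<open>k \<ge> 1\<close> by (cases k) auto
    have "((\<lambda>z. inverse (1 - z)) has_field_derivative inverse (1 - z) ^ 2) (at z)"
      using ne[OF that(1)] by (auto intro!: derivative_eq_intros simp: power2_eq_square)
    from DERIV_cmult[OF DERIV_power[OF this, of k], of c] show ?thesis
      by (rule DERIV_cong) (simp add: j power2_eq_square mult_ac)
  qed
  have 0: "(\<lambda>n. 1 * z ^ n) sums (1 * inverse (1 - z) ^ 1)" if "norm z < 1" for z :: complex
    using geometric_sums[OF that] by (simp add: inverse_eq_divide)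
  have 1: "(\<lambda>n. diffs (\<lambda>_. 1) n * z ^ n) sums (1 * inverse (1 - z) ^ 2)" if "norm z < 1" for z :: complex
    using termdiffs_sums_strong[OF 0 D[OF that, of 1 1] that] by (simp add: numeral_2_eq_2)
  have 2: "(\<lambda>n. diffs (diffs (\<lambda>_. 1)) n * z ^ n) sums (2 * inverse (1 - z) ^ 3)" if "norm z < 1" for z :: complex
    using termdiffs_sums_strong[OF 1 D[OF that, of 2 1] that] by (simp add: numeral_3_eq_3 numeral_2_eq_2)
  have 3: "(\<lambda>n. diffs (diffs (diffs (\<lambda>_. 1))) n * z ^ n) sums (6 * inverse (1 - z) ^ 4)" if "norm z < 1" for z :: complex
    using termdiffs_sums_strong[OF 2 D[OF that, of 3 2] that] by (simp add: eval_nat_numeral)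
  from sums_mult[OF 1[OF q], of q]
  show A: "(\<lambda>n. of_nat (Suc n) * q ^ Suc n) sums (q / (1 - q) ^ 2)"
    by (simp add: diffs_def mult_ac divide_inverse power_inverse)
  define F where "F n = of_nat n * of_nat (Suc n) * of_nat (Suc (Suc n)) * q ^ Suc n" for n
  have "(\<lambda>n. q ^ 2 * (diffs (diffs (diffs (\<lambda>_. 1))) n * q ^ n)) sums (q ^ 2 * (6 * inverse (1 - q) ^ 4))"
    by (rule sums_mult[OF 3[OF q]])
  then have "(\<lambda>n. F (Suc n)) sums (q ^ 2 * (6 * inverse (1 - q) ^ 4))"
    by (simp add: F_def diffs_def power2_eq_square mult_ac)
  then have "F sums (q ^ 2 * (6 * inverse (1 - q) ^ 4))"
    using sums_Suc_iff[of F] by (simp add: F_def)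
  from sums_add[OF this A] have "(\<lambda>n. F n + of_nat (Suc n) * q ^ Suc n) sums
      (q ^ 2 * (6 * inverse (1 - q) ^ 4) + q / (1 - q) ^ 2)" .
  moreover have "F n + of_nat (Suc n) * q ^ Suc n = of_nat (Suc n) ^ 3 * q ^ Suc n" for n
    by (simp add: F_def algebra_simps power_numeral_reduce)
  moreover have "q ^ 2 * (6 * inverse (1 - q) ^ 4) + q / (1 - q) ^ 2 = 6 * q ^ 2 / (1 - q) ^ 4 + q / (1 - q) ^ 2"
    by (simp add: divide_inverse power_inverse)
  ultimately show "(\<lambda>n. of_nat (Suc n) ^ 3 * q ^ Suc n) sums (6 * q ^ 2 / (1 - q) ^ 4 + q / (1 - q) ^ 2)"
    by (simp only:)
qed

lemma not_Ints_if_Im: "Im z \<noteq> 0 \<Longrightarrow> z \<notin> \<int>"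
  by (auto elim!: Ints_cases)

text \<open>By \<open>sin_pi_nome\<close> the partial fractions become rational functions of q =
  \<open>nome z\<close>, which \<open>sums_n_power\<close> expands.\<close>

lemma lipschitz_formulas:
  assumes z: "Im z > 0"
  shows "((\<lambda>n::int. 1 / (z + of_int n) ^ 2) has_sum
            (- 4 * of_real pi ^ 2 * suminf (\<lambda>r. of_nat (Suc r) * nome z ^ Suc r))) UNIV"
    and "((\<lambda>n::int. 1 / (z + of_int n) ^ 4) has_sum
            (8 / 3 * of_real pi ^ 4 * suminf (\<lambda>r. of_nat (Suc r) ^ 3 * nome z ^ Suc r))) UNIV"
proof -
  have zi: "z \<notin> \<int>" using z by (intro not_Ints_if_Im) auto
  note q = norm_nome_less_1[OF z]
  note s = sin_pi_nome[OF z]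
  have "(of_real pi / sin (of_real pi * z)) ^ 2 = of_real pi ^ 2 * (1 / sin (of_real pi * z) ^ 2)"
    by (simp add: power_divide)
  then show "((\<lambda>n::int. 1 / (z + of_int n) ^ 2) has_sum
            (- 4 * of_real pi ^ 2 * suminf (\<lambda>r. of_nat (Suc r) * nome z ^ Suc r))) UNIV"
    unfolding sums_unique[OF sums_n_power(1)[OF q], symmetric]
    using csc_squared_partial_fractions(1)[OF zi] unfolding s by (simp add: divide_inverse mult_ac)
  have "1 / sin (of_real pi * z) ^ 4 = (1 / sin (of_real pi * z) ^ 2) ^ 2" by (simp add: power_divide)
  also have "\<dots> = 16 * nome z ^ 2 / (1 - nome z) ^ 4" unfolding s by (simp add: power_divide power_mult_distrib)
  finally have "of_real pi ^ 4 * (1 / sin (of_real pi * z) ^ 4 - 2 / (3 * sin (of_real pi * z) ^ 2)) =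
     of_real pi ^ 4 * (16 * nome z ^ 2 / (1 - nome z) ^ 4 - 2 / 3 * (1 / sin (of_real pi * z) ^ 2))" by simp
  also have "\<dots> = 8 / 3 * of_real pi ^ 4 * (6 * nome z ^ 2 / (1 - nome z) ^ 4 + nome z / (1 - nome z) ^ 2)"
    unfolding s by (simp add: algebra_simps)
  finally have fin: "of_real pi ^ 4 * (1 / sin (of_real pi * z) ^ 4 - 2 / (3 * sin (of_real pi * z) ^ 2)) =
      8 / 3 * of_real pi ^ 4 * (6 * nome z ^ 2 / (1 - nome z) ^ 4 + nome z / (1 - nome z) ^ 2)" .
  show "((\<lambda>n::int. 1 / (z + of_int n) ^ 4) has_sum
            (8 / 3 * of_real pi ^ 4 * suminf (\<lambda>r. of_nat (Suc r) ^ 3 * nome z ^ Suc r))) UNIV"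
    unfolding sums_unique[OF sums_n_power(2)[OF q], symmetric]
    using csc_fourth_partial_fractions[OF zi] unfolding fin .
qed

text \<open>The value of zeta(4) from the partial fractions at z = 1/2. With \<open>H\<close> the
  sum of 1 / (n + 1/2)^4 they give 2 H = pi^4 / 3, while splitting zeta(4) = \<open>Z\<close> into
  odd and even terms gives 16 Z = H + Z.\<close>

lemma inverse_fourth_powers_has_sum:
  "((\<lambda>n. 1 / of_nat (Suc n) ^ 4 :: complex) has_sum (of_real pi ^ 4 / 90)) UNIV"
proof -
  have sm: "summable (\<lambda>n. norm (1 / (1 + of_nat n) ^ 4 :: complex))"
    by (rule norm_summable_inverse_shift_power) auto
  define Z where "Z = suminf (\<lambda>n. 1 / (of_nat (Suc n)) ^ 4 :: complex)"
  have sm': "summable (\<lambda>n. 1 / (of_nat (Suc n)) ^ 4 :: complex)"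
    using summable_norm_cancel[OF sm] by (simp add: add.commute)
  then have Z: "(\<lambda>n. 1 / (of_nat (Suc n)) ^ 4 :: complex) sums Z" by (simp add: Z_def summable_sums)
  have half: "(1 / 2 :: complex) \<notin> \<int>" using fraction_not_in_Ints[of 2 1, where 'a = complex] by simp
  have T: "((\<lambda>n::int. 1 / (1 / 2 + of_int n) ^ 4 :: complex) has_sum (of_real pi ^ 4 / 3)) UNIV"
    using csc_fourth_partial_fractions[OF half] by (simp add: sin_of_real[symmetric] flip: of_real_divide)
  have sh: "summable (\<lambda>n. norm (1 / (1 / 2 + of_nat n) ^ 4 :: complex))"
    by (rule norm_summable_inverse_shift_power) auto
  define H where "H = suminf (\<lambda>n. 1 / (1 / 2 + of_nat n) ^ 4 :: complex)"
  have H: "(\<lambda>n. 1 / (1 / 2 + of_nat n) ^ 4 :: complex) sums H"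
    using summable_norm_cancel[OF sh] by (simp add: H_def summable_sums)
  have Hs: "((\<lambda>n. 1 / (1 / 2 + of_nat n) ^ 4 :: complex) has_sum H) UNIV"
    by (rule norm_summable_imp_has_sum[OF sh H])
  have neg: "1 / (1 / 2 + of_int (- int (Suc n))) ^ 4 = (1 / (1 / 2 + of_nat n) ^ 4 :: complex)" for n
  proof -
    have "(1 / 2 + of_int (- int (Suc n)) :: complex) = - (1 / 2 + of_nat n)" by simp
    then show ?thesis by (simp only: power_minus_even even_numeral)
  qed
  have "((\<lambda>n::int. 1 / (1 / 2 + of_int n) ^ 4 :: complex) has_sum (H + H)) UNIV"
    by (rule has_sum_int) (use Hs neg in simp_all)
  then have HH: "H + H = of_real pi ^ 4 / 3" using T has_sum_unique by blast
  have "(\<lambda>n. (1 / of_nat (Suc (2 * n)) ^ 4 + 1 / of_nat (Suc (2 * n + 1)) ^ 4 :: complex)) sums Z"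
  proof -
    define f where "f i = (1 / of_nat (Suc i) ^ 4 :: complex)" for i
    have "(\<lambda>n. \<Sum>i\<in>{n * 2..<n * 2 + 2}. f i) sums Z"
      by (rule sums_group) (use Z in \<open>simp_all add: f_def\<close>)
    moreover have "{n * 2..<n * 2 + 2} = {2 * n, 2 * n + 1}" for n :: nat by auto
    ultimately have "(\<lambda>n. f (2 * n) + f (2 * n + 1)) sums Z" by (simp add: mult.commute)
    then show ?thesis unfolding f_def .
  qed
  moreover have "(\<lambda>n. 1 / 16 * (1 / (1 / 2 + of_nat n) ^ 4) + 1 / 16 * (1 / of_nat (Suc n) ^ 4) :: complex) sums
      (1 / 16 * H + 1 / 16 * Z)"
    by (intro sums_add sums_mult H Z)
  moreover have "1 / 16 * (1 / (1 / 2 + of_nat n) ^ 4) + 1 / 16 * (1 / of_nat (Suc n) ^ 4) =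
      (1 / of_nat (Suc (2 * n)) ^ 4 + 1 / of_nat (Suc (2 * n + 1)) ^ 4 :: complex)" for n
  proof -
    have "(of_nat (Suc (2 * n)) :: complex) = 2 * (1 / 2 + of_nat n)" "(of_nat (Suc (2 * n + 1)) :: complex) = 2 * of_nat (Suc n)"
      by simp_all
    then show ?thesis by (simp only: power_mult_distrib) simp
  qed
  ultimately have "Z = 1 / 16 * H + 1 / 16 * Z" using sums_unique2 by simp
  then have "H = 15 * Z" by (simp add: field_simps)
  then have Z90: "Z = of_real pi ^ 4 / 90" using HH by (simp add: field_simps)
  show ?thesis unfolding Z90[symmetric]
    using norm_summable_imp_has_sum[OF _ Z] sm by (simp add: add.commute)
qed

section \<open>The Eisenstein series of weight 4\<close>

definition divisor_series :: "nat \<Rightarrow> complex \<Rightarrow> complex" where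
  "divisor_series k q = suminf (\<lambda>n. of_nat (\<Sum>d | d dvd Suc n. d ^ k) * q ^ Suc n)"

lemma summable_power_times_geometric:
  fixes x :: "'a :: {real_normed_field, banach}"
  assumes "norm x < 1"
  shows "summable (\<lambda>n. of_nat n ^ k * x ^ n)"
  using assms
proof (induction k arbitrary: x)
  case 0
  then show ?case by simp
next
  case (Suc k)
  have "summable (\<lambda>n. diffs (\<lambda>n. of_nat n ^ k) n * x ^ n)"
    by (rule termdiff_converges[of _ 1]) (use Suc in auto)
  then have "summable (\<lambda>n. x * (diffs (\<lambda>n. of_nat n ^ k) n * x ^ n))" by (rule summable_mult)
  then have "summable (\<lambda>n. of_nat (Suc n) ^ Suc k * x ^ Suc n)" by (simp add: diffs_def mult_ac)
  then show ?case by (subst (asm) summable_Suc_iff)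
qed

text \<open>Since (m + 1) (r + 1) >= m + (r + 1), the double series is dominated by a product of two
  convergent series.\<close>

lemma lambert_series_summable:
  fixes q :: complex
  assumes q: "norm q < 1"
  shows "(\<lambda>(m, r). of_nat (Suc r) ^ k * q ^ (Suc m * Suc r)) summable_on UNIV"
proof -
  define x where "x = norm q"
  have x: "0 \<le> x" "x < 1" using q by (auto simp: x_def)
  have 1: "summable (\<lambda>r. real (Suc r) ^ k * x ^ Suc r)"
    using summable_power_times_geometric[of x k] x by (subst summable_Suc_iff) auto
  have 2: "summable (\<lambda>m. x ^ m)" using x by (simp add: summable_geometric)
  have 3: "(\<lambda>(m, r). x ^ m * (real (Suc r) ^ k * x ^ Suc r)) summable_on UNIV \<times> UNIV"
  proof (rule summable_on_SigmaI)
    show "((\<lambda>r. case (m, r) of (m, r) \<Rightarrow> x ^ m * (real (Suc r) ^ k * x ^ Suc r)) has_sum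
        x ^ m * suminf (\<lambda>r. real (Suc r) ^ k * x ^ Suc r)) UNIV" for m
      unfolding prod.case using 1 x
      by (intro has_sum_cmult_right sums_nonneg_imp_has_sum summable_sums) auto
    show "(\<lambda>m. x ^ m * suminf (\<lambda>r. real (Suc r) ^ k * x ^ Suc r)) summable_on UNIV"
      using 2 x by (intro summable_on_cmult_left summable_nonneg_imp_summable_on) auto
  qed (use x in auto)
  have "(\<lambda>p. norm (case p of (m, r) \<Rightarrow> of_nat (Suc r) ^ k * q ^ (Suc m * Suc r))) summable_on UNIV"
  proof (rule Infinite_Sum.abs_summable_on_comparison_test'[OF 3[unfolded UNIV_Times_UNIV]])
    fix p :: "nat \<times> nat"
    obtain m r where p: "p = (m, r)" by (cases p)
    have "x ^ (Suc m * Suc r) \<le> x ^ (m + Suc r)"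
      using x by (intro power_decreasing) auto
    then have "x ^ (Suc m * Suc r) \<le> x ^ m * x ^ Suc r" by (simp only: power_add)
    then have "real (Suc r) ^ k * x ^ (Suc m * Suc r) \<le> real (Suc r) ^ k * (x ^ m * x ^ Suc r)"
      by (intro mult_left_mono) auto
    then show "norm (case p of (m, r) \<Rightarrow> of_nat (Suc r) ^ k * q ^ (Suc m * Suc r)) \<le>
        (case p of (m, r) \<Rightarrow> x ^ m * (real (Suc r) ^ k * x ^ Suc r))"
      unfolding p prod.case norm_mult norm_power norm_of_nat x_def[symmetric]
      by (simp only: mult_ac)
  qed
  then show ?thesis by (rule abs_summable_summable)
qed

text \<open>The terms with (m + 1) (r + 1) = N + 1 are collected; the divisor is d = r + 1.\<close>

lemma lambert_series_has_sum:
  fixes q :: complex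
  assumes q: "norm q < 1"
  shows "((\<lambda>(m, r). of_nat (Suc r) ^ k * q ^ (Suc m * Suc r)) has_sum divisor_series k q) UNIV"
    and "(\<lambda>n. of_nat (\<Sum>d | d dvd Suc n. d ^ k) * q ^ Suc n) sums divisor_series k q"
proof -
  define f where "f = (\<lambda>(m, r). of_nat (Suc r) ^ k * q ^ (Suc m * Suc r))"
  obtain S where S: "(f has_sum S) UNIV"
    using lambert_series_summable[OF q, of k] unfolding summable_on_def f_def by blast
  have "((\<lambda>(N, d). of_nat d ^ k * q ^ Suc N) has_sum S) (Sigma UNIV (\<lambda>N. {d. d dvd Suc N}))"
  proof (subst has_sum_reindex_bij_witness[where T = UNIV and h = f and s' = S
        and j = "\<lambda>(N, d). (Suc N div d - 1, d - 1)" and i = "\<lambda>(m, r). (Suc m * Suc r - 1, Suc r)"])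
    fix a :: "nat \<times> nat" assume a: "a \<in> Sigma UNIV (\<lambda>N. {d. d dvd Suc N})"
    obtain N d where Nd: "a = (N, d)" "d dvd Suc N" using a by auto
    then obtain e where e: "Suc N = d * e" by (auto elim: dvdE)
    then have pos: "d > 0" "e > 0" by (metis nat.distinct(1) mult_0 mult_0_right gr0I)+
    then have "Suc N div d = e" using e by simp
    then show "(case case a of (N, d) \<Rightarrow> (Suc N div d - 1, d - 1) of (m, r) \<Rightarrow> (Suc m * Suc r - 1, Suc r)) = a"
      using Nd e pos by (simp add: mult.commute del: mult_Suc mult_Suc_right)
    show "f (case a of (N, d) \<Rightarrow> (Suc N div d - 1, d - 1)) = (case a of (N, d) \<Rightarrow> of_nat d ^ k * q ^ Suc N)"
      using \<open>Suc N div d = e\<close> Nd e pos by (simp add: f_def mult.commute del: mult_Suc mult_Suc_right power_Suc)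
  next
    fix b :: "nat \<times> nat"
    show "(case case b of (m, r) \<Rightarrow> (Suc m * Suc r - 1, Suc r) of (N, d) \<Rightarrow> (Suc N div d - 1, d - 1)) = b"
      by (cases b) (simp del: mult_Suc mult_Suc_right)
    show "(case b of (m, r) \<Rightarrow> (Suc m * Suc r - 1, Suc r)) \<in> Sigma UNIV (\<lambda>N. {d. d dvd Suc N})"
      by (cases b) (simp del: mult_Suc mult_Suc_right)
  qed (use S in auto)
  then have "((\<lambda>N. \<Sum>d | d dvd Suc N. of_nat d ^ k * q ^ Suc N) has_sum S) UNIV"
    by (rule has_sum_SigmaD) (auto intro!: has_sum_finiteI)
  then have "((\<lambda>N. of_nat (\<Sum>d | d dvd Suc N. d ^ k) * q ^ Suc N) has_sum S) UNIV"
    by (simp add: sum_distrib_right del: power_Suc)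
  then have "(\<lambda>N. of_nat (\<Sum>d | d dvd Suc N. d ^ k) * q ^ Suc N) sums S"
    by (rule has_sum_imp_sums)
  moreover from this have "S = divisor_series k q"
    unfolding divisor_series_def by (rule sums_unique)
  ultimately show "((\<lambda>(m, r). of_nat (Suc r) ^ k * q ^ (Suc m * Suc r)) has_sum divisor_series k q) UNIV"
    "(\<lambda>n. of_nat (\<Sum>d | d dvd Suc n. d ^ k) * q ^ Suc n) sums divisor_series k q"
    using S by (simp_all only: f_def)
qed

lemma norm_power_Suc_less_1:
  fixes q :: complex
  assumes "norm q < 1"
  shows "norm (q ^ Suc m) < 1"
  using assms power_Suc_less_one[of "norm q" m]
  by (cases "q = 0") (auto simp: norm_power simp del: power_Suc)

text \<open>For q = \<open>nome t\<close> the inner series is the one of the Lipschitz formula at (m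
  + 1) t, so this order of summation matches the rows of a lattice sum.\<close>

lemma lambert_series_rows:
  fixes q :: complex
  assumes q: "norm q < 1"
  shows "((\<lambda>m. suminf (\<lambda>r. of_nat (Suc r) ^ k * (q ^ Suc m) ^ Suc r)) has_sum divisor_series k q) UNIV"
proof (rule has_sum_SigmaD)
  show "((\<lambda>(m, r). of_nat (Suc r) ^ k * q ^ (Suc m * Suc r)) has_sum divisor_series k q) (UNIV \<times> UNIV)"
    using lambert_series_has_sum(1)[OF q] by simp
  fix m :: nat
  have qm: "norm (q ^ Suc m) < 1" by (rule norm_power_Suc_less_1[OF q])
  have "summable (\<lambda>r. of_nat r ^ k * norm (q ^ Suc m) ^ r)"
    by (rule summable_power_times_geometric) (use qm in simp)
  then have "summable (\<lambda>r. of_nat (Suc r) ^ k * norm (q ^ Suc m) ^ Suc r)"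
    by (subst summable_Suc_iff)
  then have sm: "summable (\<lambda>r. norm (of_nat (Suc r) ^ k * (q ^ Suc m) ^ Suc r))"
    by (simp add: norm_mult norm_power del: of_nat_Suc power_Suc)
  have "((\<lambda>r. of_nat (Suc r) ^ k * (q ^ Suc m) ^ Suc r) has_sum
      suminf (\<lambda>r. of_nat (Suc r) ^ k * (q ^ Suc m) ^ Suc r)) UNIV"
    using norm_summable_imp_has_sum[OF sm] summable_norm_cancel[OF sm] summable_sums by blast
  then show "((\<lambda>r. case (m, r) of (m, r) \<Rightarrow> of_nat (Suc r) ^ k * q ^ (Suc m * Suc r)) has_sum
      suminf (\<lambda>r. of_nat (Suc r) ^ k * (q ^ Suc m) ^ Suc r)) UNIV"
    by (simp only: prod.case power_mult)
qed

text \<open>The other order of summation, which produces, up to sign, the logarithmic derivative of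
  the Euler product.\<close>

lemma lambert_series_columns:
  fixes q :: complex
  assumes q: "norm q < 1"
  shows "(\<lambda>r. of_nat (Suc r) * (q ^ Suc r / (1 - q ^ Suc r))) sums divisor_series 1 q"
proof -
  have "((\<lambda>(r, m). of_nat (Suc r) ^ 1 * q ^ (Suc m * Suc r)) has_sum divisor_series 1 q) (UNIV \<times> UNIV)"
    using lambert_series_has_sum(1)[OF q, of 1] has_sum_swap[where f = "\<lambda>(m, r). of_nat (Suc r) ^ 1 * q ^ (Suc m * Suc r)" and A = UNIV and B = UNIV]
    by simp
  then have "((\<lambda>r. of_nat (Suc r) * (q ^ Suc r / (1 - q ^ Suc r))) has_sum divisor_series 1 q) UNIV"
  proof (rule has_sum_SigmaD)
    fix r :: nat
    define w where "w = q ^ Suc r"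
    have w: "norm w < 1" unfolding w_def by (rule norm_power_Suc_less_1[OF q])
    have "((\<lambda>m. w ^ m) has_sum (1 / (1 - w))) UNIV"
      using w by (intro norm_summable_imp_has_sum geometric_sums) (auto simp: norm_power)
    then have "((\<lambda>m. of_nat (Suc r) * w * w ^ m) has_sum (of_nat (Suc r) * w * (1 / (1 - w)))) UNIV"
      by (rule has_sum_cmult_right)
    moreover have "q ^ (Suc m * Suc r) = w * w ^ m" for m
      unfolding w_def by (metis mult.commute power_Suc power_mult)
    ultimately show "((\<lambda>m. case (r, m) of (r, m) \<Rightarrow> of_nat (Suc r) ^ 1 * q ^ (Suc m * Suc r)) has_sum
        of_nat (Suc r) * (q ^ Suc r / (1 - q ^ Suc r))) UNIV"
      by (simp add: w_def[symmetric] mult.assoc del: mult_Suc mult_Suc_right power_Suc of_nat_Suc)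
  qed
  then show ?thesis by (rule has_sum_imp_sums)
qed

text \<open>The imaginary part of z = m t + n controls m, and then n = z - m t is controlled as
  well.\<close>

lemma lattice_norm_bound:
  assumes t: "Im t > 0"
  obtains K where "K > 0" "\<And>m n :: int. real_of_int (\<bar>m\<bar> + \<bar>n\<bar>) \<le> K * norm (of_int m * t + of_int n)"
proof (rule that[of "1 / Im t + 1 + norm t / Im t"])
  show "1 / Im t + 1 + norm t / Im t > 0" using t by (intro add_pos_nonneg) auto
  fix m n :: int
  define z where "z = of_int m * t + of_int n"
  have "\<bar>Im z\<bar> \<le> norm z" by (rule abs_Im_le_cmod)
  moreover have "Im z = of_int m * Im t" by (simp add: z_def)
  ultimately have m: "real_of_int \<bar>m\<bar> \<le> norm z / Im t"
    using t by (simp add: abs_mult field_simps)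
  have "real_of_int \<bar>n\<bar> = norm (of_int n :: complex)" by simp
  also have "of_int n = z - of_int m * t" by (simp add: z_def)
  also have "norm \<dots> \<le> norm z + norm (of_int m * t)" by (rule norm_triangle_ineq4)
  also have "\<dots> = norm z + real_of_int \<bar>m\<bar> * norm t" by (simp add: norm_mult)
  also have "\<dots> \<le> norm z + norm z / Im t * norm t" using m by (intro add_left_mono mult_right_mono) auto
  finally show "real_of_int (\<bar>m\<bar> + \<bar>n\<bar>) \<le> (1 / Im t + 1 + norm t / Im t) * norm z"
    using m by (simp add: algebra_simps)
qed

lemma summable_on_int_powr:
  "(\<lambda>n::int. (1 + real_of_int \<bar>n\<bar>) powr (-3/2)) summable_on UNIV"
proof -
  have "summable (\<lambda>n. real n powr (-3/2))" by (subst summable_real_powr_iff) auto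
  then have "summable (\<lambda>n. real (Suc n) powr (-3/2))" by (subst summable_Suc_iff)
  then have s: "summable (\<lambda>n. (1 + real n) powr (-3/2))" by (simp add: add.commute)
  then have "((\<lambda>n. (1 + real n) powr (-3/2)) has_sum suminf (\<lambda>n. (1 + real n) powr (-3/2))) UNIV"
    by (intro sums_nonneg_imp_has_sum summable_sums) auto
  moreover have "summable (\<lambda>n. (1 + real (Suc n)) powr (-3/2))" using s by (subst summable_Suc_iff)
  then have "((\<lambda>n. (1 + real (Suc n)) powr (-3/2)) has_sum suminf (\<lambda>n. (1 + real (Suc n)) powr (-3/2))) UNIV"
    by (intro sums_nonneg_imp_has_sum summable_sums) auto
  moreover have "1 + real_of_int \<bar>- int (Suc n)\<bar> = 1 + real (Suc n)" for n by simp
  ultimately have "((\<lambda>n::int. (1 + real_of_int \<bar>n\<bar>) powr (-3/2)) has_sum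
      (suminf (\<lambda>n. (1 + real n) powr (-3/2)) + suminf (\<lambda>n. (1 + real (Suc n)) powr (-3/2)))) UNIV"
    by (intro has_sum_int) (simp_all only:, simp)
  then show ?thesis unfolding summable_on_def by blast
qed

text \<open>The exponent 3/2 exceeds 1, and with s = |m| + |n| the bound (1 + |m|) (1 + |n|) <= (2
  s)^2 becomes one by 8 s^3 when raised to it. The lattice sum is therefore dominated by a product
  of two convergent series as soon as k >= 3.\<close>

lemma lattice_summable:
  assumes t: "Im t > 0" and k: "k \<ge> 3"
  shows "(\<lambda>(m :: int, n :: int). norm (1 / (of_int m * t + of_int n) ^ k)) summable_on UNIV"
proof -
  obtain K where K: "K > 0" "\<And>m n :: int. real_of_int (\<bar>m\<bar> + \<bar>n\<bar>) \<le> K * norm (of_int m * t + of_int n)"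
    using lattice_norm_bound[OF t] by blast
  define h where "h n = (1 + real_of_int \<bar>n\<bar>) powr (-3/2)" for n :: int
  have h: "h summable_on UNIV" unfolding h_def by (rule summable_on_int_powr)
  have "(\<lambda>(m, n). h m * h n) summable_on UNIV \<times> UNIV"
  proof (rule summable_on_SigmaI)
    show "((\<lambda>n. case (m, n) of (m, n) \<Rightarrow> h m * h n) has_sum h m * infsum h UNIV) UNIV" for m
      using h by (simp add: has_sum_cmult_right)
    show "(\<lambda>m. h m * infsum h UNIV) summable_on UNIV" using h by (rule summable_on_cmult_left)
  qed (auto simp: h_def)
  then have hs: "(\<lambda>p. 8 * K ^ k * (case p of (m, n) \<Rightarrow> h m * h n)) summable_on UNIV"
    by (intro summable_on_cmult_right) simp
  have le: "norm (1 / (of_int m * t + of_int n) ^ k) \<le> 8 * K ^ k * (h m * h n)" for m n :: int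
  proof (cases "m = 0 \<and> n = 0")
    \<comment> \<open>At the origin the term is 1 / 0 = 0.\<close>
    case True
    then show ?thesis using k K by (simp add: h_def power_0_left)
  next
    case False
    define s where "s = real_of_int (\<bar>m\<bar> + \<bar>n\<bar>)"
    define N where "N = norm (of_int m * t + of_int n)"
    have s1: "s \<ge> 1" using False unfolding s_def by linarith
    have sK: "s \<le> K * N" using K by (simp add: s_def N_def)
    have N0: "N > 0" using s1 sK K by (metis N_def less_le_trans mult_zero_right norm_ge_zero order_le_less zero_less_one not_less)
    have "(1 + real_of_int \<bar>m\<bar>) * (1 + real_of_int \<bar>n\<bar>) \<le> (2 * s) * (2 * s)"
      using s1 unfolding s_def by (intro mult_mono) auto
    then have "((1 + real_of_int \<bar>m\<bar>) * (1 + real_of_int \<bar>n\<bar>)) powr (3/2) \<le> ((2 * s) ^ 2) powr (3/2)"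
      by (intro powr_mono2) (auto simp: power2_eq_square)
    also have "((2 * s) ^ 2) powr (3/2) = (2 * s) ^ 3"
    proof -
      have p2: "(2 * s) powr 2 = (2 * s) ^ 2" using s1 by (intro powr_numeral) auto
      have p3: "(2 * s) powr 3 = (2 * s) ^ 3" using s1 by (intro powr_numeral) auto
      show ?thesis unfolding p2[symmetric] p3[symmetric] powr_powr by simp
    qed
    also have "\<dots> = 8 * s ^ 3" by (simp add: power_mult_distrib)
    also have "\<dots> \<le> 8 * s ^ k" using s1 k by (intro mult_left_mono power_increasing) auto
    also have "\<dots> \<le> 8 * (K * N) ^ k" using s1 sK by (intro mult_left_mono power_mono) auto
    finally have A: "((1 + real_of_int \<bar>m\<bar>) * (1 + real_of_int \<bar>n\<bar>)) powr (3/2) \<le> 8 * K ^ k * N ^ k"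
      by (simp add: power_mult_distrib)
    define Q where "Q = ((1 + real_of_int \<bar>m\<bar>) * (1 + real_of_int \<bar>n\<bar>)) powr (3/2)"
    have "1 + real_of_int \<bar>m\<bar> > 0" "1 + real_of_int \<bar>n\<bar> > 0" by linarith+
    then have Q0: "Q > 0" by (simp add: Q_def)
    have "h m * h n = 1 / Q" unfolding h_def Q_def
      by (simp add: powr_mult powr_minus_divide)
    moreover have "1 / N ^ k \<le> 8 * K ^ k * (1 / Q)" using A N0 Q0 unfolding Q_def[symmetric] by (simp add: field_simps)
    ultimately show ?thesis by (simp add: norm_divide norm_power N_def)
  qed
  have "(\<lambda>p. norm (case p of (m :: int, n :: int) \<Rightarrow> 1 / (of_int m * t + of_int n) ^ k)) summable_on UNIV"
    by (rule Infinite_Sum.abs_summable_on_comparison_test'[OF hs]) (use le in auto)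
  then show ?thesis by (simp add: case_prod_unfold)
qed

lemma nome_of_nat_mult: "nome (of_nat m * t) = nome t ^ m"
  by (simp add: nome_def flip: exp_of_nat_mult) (simp add: algebra_simps)

lemma lattice_row_sum:
  assumes t: "Im t > 0"
  shows "m \<noteq> 0 \<Longrightarrow> ((\<lambda>n::int. 1 / (of_int m * t + of_int n) ^ 4) has_sum
           (8 / 3 * of_real pi ^ 4 * suminf (\<lambda>r. of_nat (Suc r) ^ 3 * (nome t ^ nat \<bar>m\<bar>) ^ Suc r))) UNIV"
    and "m \<noteq> 0 \<Longrightarrow> ((\<lambda>n::int. 1 / (of_int m * t + of_int n) ^ 2) has_sum
           (- 4 * of_real pi ^ 2 * suminf (\<lambda>r. of_nat (Suc r) * (nome t ^ nat \<bar>m\<bar>) ^ Suc r))) UNIV"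
proof -
  assume m: "m \<noteq> 0"
  have pos: "((\<lambda>n::int. 1 / (of_nat j * t + of_int n) ^ 4) has_sum
           (8 / 3 * of_real pi ^ 4 * suminf (\<lambda>r. of_nat (Suc r) ^ 3 * (nome t ^ j) ^ Suc r))) UNIV"
     "((\<lambda>n::int. 1 / (of_nat j * t + of_int n) ^ 2) has_sum
           (- 4 * of_real pi ^ 2 * suminf (\<lambda>r. of_nat (Suc r) * (nome t ^ j) ^ Suc r))) UNIV"
    if "j > 0" for j :: nat
    using lipschitz_formulas[of "of_nat j * t"] t that by (simp_all add: nome_of_nat_mult)
  have neg: "(f has_sum S) UNIV" if "((\<lambda>n. f (- n)) has_sum S) UNIV" for f :: "int \<Rightarrow> complex" and S
    using that has_sum_reindex_bij_betw[of uminus UNIV UNIV f S] bij_uminus by simp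
  \<comment> \<open>Negative m are reduced to positive ones by changing the signs of both m and n,
    since the exponents are even.\<close>
  have flip: "(of_int m * t + of_int (- n)) = - (of_nat (nat \<bar>m\<bar>) * t + of_int n)" if "m < 0" for n
    using that by simp
  show "((\<lambda>n::int. 1 / (of_int m * t + of_int n) ^ 4) has_sum
           (8 / 3 * of_real pi ^ 4 * suminf (\<lambda>r. of_nat (Suc r) ^ 3 * (nome t ^ nat \<bar>m\<bar>) ^ Suc r))) UNIV"
  proof (cases "m > 0")
    case True
    then show ?thesis using pos(1)[of "nat \<bar>m\<bar>"] by simp
  next
    case False
    then have "m < 0" using m by simp
    show ?thesis
    proof (rule neg)
      show "((\<lambda>n::int. 1 / (of_int m * t + of_int (- n)) ^ 4) has_sum
           (8 / 3 * of_real pi ^ 4 * suminf (\<lambda>r. of_nat (Suc r) ^ 3 * (nome t ^ nat \<bar>m\<bar>) ^ Suc r))) UNIV"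
        unfolding flip[OF \<open>m < 0\<close>] power_minus_even[OF even_numeral] using pos(1)[of "nat \<bar>m\<bar>"] m by simp
    qed
  qed
  show "((\<lambda>n::int. 1 / (of_int m * t + of_int n) ^ 2) has_sum
           (- 4 * of_real pi ^ 2 * suminf (\<lambda>r. of_nat (Suc r) * (nome t ^ nat \<bar>m\<bar>) ^ Suc r))) UNIV"
  proof (cases "m > 0")
    case True
    then show ?thesis using pos(2)[of "nat \<bar>m\<bar>"] by simp
  next
    case False
    then have "m < 0" using m by simp
    show ?thesis
    proof (rule neg)
      show "((\<lambda>n::int. 1 / (of_int m * t + of_int (- n)) ^ 2) has_sum
           (- 4 * of_real pi ^ 2 * suminf (\<lambda>r. of_nat (Suc r) * (nome t ^ nat \<bar>m\<bar>) ^ Suc r))) UNIV"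
        unfolding flip[OF \<open>m < 0\<close>] power_minus_even[OF even_numeral] using pos(2)[of "nat \<bar>m\<bar>"] m by simp
    qed
  qed
qed

lemma Eisenstein4_divisor_series: "Eisenstein4 t = 1 + 240 * divisor_series 3 (nome t)"
  by (simp add: Eisenstein4_def divisor_series_def)

lemma Eisenstein4_lattice_sum:
  assumes t: "Im t > 0"
  shows "((\<lambda>(m :: int, n :: int). 1 / (of_int m * t + of_int n) ^ 4) has_sum
           (of_real pi ^ 4 / 45 * Eisenstein4 t)) UNIV"
proof -
  define f where "f = (\<lambda>(m :: int, n :: int). 1 / (of_int m * t + of_int n) ^ 4)"
  have "(\<lambda>p. norm (f p)) summable_on UNIV"
    using lattice_summable[OF t, of 4] by (simp add: f_def case_prod_unfold)
  then obtain S where S: "(f has_sum S) (UNIV \<times> UNIV)"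
    using abs_summable_summable unfolding summable_on_def by auto
  define L where "L j = 8 / 3 * of_real pi ^ 4 * suminf (\<lambda>r. of_nat (Suc r) ^ 3 * (nome t ^ j) ^ Suc r)" for j
  define g where "g m = (if m = 0 then of_real pi ^ 4 / 45 else L (nat \<bar>m\<bar>))" for m :: int
  have row: "((\<lambda>n. f (m, n)) has_sum g m) UNIV" for m
  proof (cases "m = 0")
    case True
    have "((\<lambda>n::int. 1 / of_int n ^ 4 :: complex) has_sum (of_real pi ^ 4 / 90 + of_real pi ^ 4 / 90)) (UNIV - {0})"
    proof (rule has_sum_nonzero_int)
      have "(of_int (- int (Suc n)) :: complex) ^ 4 = of_nat (Suc n) ^ 4" for n
        by (simp only: of_int_minus power_minus_even even_numeral of_int_of_nat_eq)
      then show "((\<lambda>n. 1 / of_int (- int (Suc n)) ^ 4 :: complex) has_sum (of_real pi ^ 4 / 90)) UNIV"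
        using inverse_fourth_powers_has_sum by simp
    qed (use inverse_fourth_powers_has_sum in simp)
    then have "((\<lambda>n::int. 1 / of_int n ^ 4 :: complex) has_sum (of_real pi ^ 4 / 45)) UNIV"
      by (subst has_sum_cong_neutral[where T = "UNIV - {0}" and g = "\<lambda>n::int. 1 / of_int n ^ 4"]) auto
    then show ?thesis using True by (simp add: f_def g_def)
  next
    case False
    then show ?thesis using lattice_row_sum(1)[OF t False] by (simp add: f_def g_def L_def)
  qed
  have gS: "(g has_sum S) UNIV" using S row by (rule has_sum_SigmaD)
  have "((\<lambda>j. L (Suc j)) has_sum (8 / 3 * of_real pi ^ 4 * divisor_series 3 (nome t))) UNIV"
    unfolding L_def using norm_nome_less_1[OF t] by (intro has_sum_cmult_right lambert_series_rows)
  then have "(g has_sum (8 / 3 * of_real pi ^ 4 * divisor_series 3 (nome t) + 8 / 3 * of_real pi ^ 4 * divisor_series 3 (nome t))) (UNIV - {0})"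
    by (intro has_sum_nonzero_int) (simp_all add: g_def nat_add_distrib)
  moreover have "(g has_sum g 0) {0}" by (rule has_sum_finiteI) auto
  ultimately have "(g has_sum (8 / 3 * of_real pi ^ 4 * divisor_series 3 (nome t) +
      8 / 3 * of_real pi ^ 4 * divisor_series 3 (nome t) + g 0)) (UNIV - {0} \<union> {0})"
    by (rule has_sum_Un_disjoint) auto
  moreover have "UNIV - {0} \<union> {0} = (UNIV :: int set)" by auto
  ultimately have "S = 8 / 3 * of_real pi ^ 4 * divisor_series 3 (nome t) +
      8 / 3 * of_real pi ^ 4 * divisor_series 3 (nome t) + of_real pi ^ 4 / 45"
    using gS has_sum_unique by (fastforce simp: g_def)
  also have "\<dots> = of_real pi ^ 4 / 45 * Eisenstein4 t"
    by (simp add: Eisenstein4_divisor_series algebra_simps)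
  finally have eqS: "S = of_real pi ^ 4 / 45 * Eisenstein4 t" .
  show ?thesis using S unfolding eqS f_def by simp
qed

lemma Im_minus_inverse_pos: "Im t > 0 \<Longrightarrow> Im (- (1 / t)) > 0"
  by (auto simp: Im_divide intro!: divide_pos_pos) (metis add_nonneg_pos not_less_iff_gr_or_eq zero_le_power2 zero_less_power2)

text \<open>Sending (m, n) to (n, -m) permutes the index set and carries t^4 times the sum at t to
  the sum at -1/t; the sums are unordered, so they agree.\<close>

lemma Eisenstein4_S:
  assumes t: "Im t > 0"
  shows "Eisenstein4 (- (1 / t)) = t ^ 4 * Eisenstein4 t"
proof -
  have t0: "t \<noteq> 0" using t by auto
  have "((\<lambda>(m :: int, n :: int). 1 / (of_int m * (- (1 / t)) + of_int n) ^ 4) has_sum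
      (t ^ 4 * (of_real pi ^ 4 / 45 * Eisenstein4 t))) UNIV"
  proof -
    have "((\<lambda>p. t ^ 4 * (case p of (m :: int, n :: int) \<Rightarrow> 1 / (of_int m * t + of_int n) ^ 4)) has_sum
      (t ^ 4 * (of_real pi ^ 4 / 45 * Eisenstein4 t))) UNIV"
      using Eisenstein4_lattice_sum[OF t] by (rule has_sum_cmult_right)
    moreover have "bij_betw (\<lambda>(m :: int, n :: int). (n, - m)) UNIV UNIV"
      by (rule bij_betwI[where g = "\<lambda>(a, b). (- b, a)"]) auto
    ultimately have "((\<lambda>p. t ^ 4 * (case (case p of (m :: int, n :: int) \<Rightarrow> (n, - m)) of (m :: int, n :: int) \<Rightarrow> 1 / (of_int m * t + of_int n) ^ 4)) has_sum
      (t ^ 4 * (of_real pi ^ 4 / 45 * Eisenstein4 t))) UNIV"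
      by (subst has_sum_reindex_bij_betw[where f = "\<lambda>p. t ^ 4 * (case p of (m :: int, n :: int) \<Rightarrow> 1 / (of_int m * t + of_int n) ^ 4)"])
    moreover have "t ^ 4 * (1 / (of_int n * t + of_int (- m)) ^ 4) = 1 / (of_int m * (- (1 / t)) + of_int n) ^ 4" for m n :: int
    proof -
      have "of_int m * (- (1 / t)) + of_int n = (of_int n * t + of_int (- m)) / t"
        using t0 by (simp add: field_simps)
      then show ?thesis by (simp only: power_divide) simp
    qed
    ultimately show ?thesis by (simp add: case_prod_unfold)
  qed
  then have "of_real pi ^ 4 / 45 * Eisenstein4 (- (1 / t)) = t ^ 4 * (of_real pi ^ 4 / 45 * Eisenstein4 t)"
    using Eisenstein4_lattice_sum[OF Im_minus_inverse_pos[OF t]] has_sum_unique by blast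
  then show ?thesis by simp
qed

section \<open>The quasimodular Eisenstein series of weight 2\<close>

definition Eisenstein2 :: "complex \<Rightarrow> complex" where
  "Eisenstein2 t = 1 - 24 * divisor_series 1 (nome t)"

text \<open>The rows m /= 0 of the weight 2 lattice sum, each already summed over n. The double
  series itself does not converge absolutely.\<close>

lemma csc_squared_row_sum_nonzero:
  assumes t: "Im t > 0"
  shows "((\<lambda>m. (of_real pi / sin (of_real pi * (of_int m * t))) ^ 2) has_sum
           (- 8 * of_real pi ^ 2 * divisor_series 1 (nome t))) (UNIV - {0})"
proof -
  define L where "L j = - 4 * of_real pi ^ 2 * suminf (\<lambda>r. of_nat (Suc r) ^ 1 * (nome t ^ j) ^ Suc r)" for j
  have eq: "(of_real pi / sin (of_real pi * (of_int m * t))) ^ 2 = L (nat \<bar>m\<bar>)" if "m \<noteq> 0" for m :: int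
  proof -
    have "of_int m * t \<notin> \<int>" using t that by (intro not_Ints_if_Im) auto
    moreover have "((\<lambda>n::int. 1 / (of_int m * t + of_int n) ^ 2) has_sum L (nat \<bar>m\<bar>)) UNIV"
      using lattice_row_sum(2)[OF t that] by (simp only: L_def power_one_right)
    ultimately show ?thesis using has_sum_unique[OF csc_squared_partial_fractions(1)] by blast
  qed
  have "((\<lambda>j. L (Suc j)) has_sum (- 4 * of_real pi ^ 2 * divisor_series 1 (nome t))) UNIV"
    unfolding L_def using norm_nome_less_1[OF t] by (intro has_sum_cmult_right lambert_series_rows)
  then have "((\<lambda>m. L (nat \<bar>m\<bar>)) has_sum (- 4 * of_real pi ^ 2 * divisor_series 1 (nome t) + - 4 * of_real pi ^ 2 * divisor_series 1 (nome t))) (UNIV - {0})"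
    by (intro has_sum_nonzero_int) (simp_all add: nat_add_distrib)
  then have "((\<lambda>m. L (nat \<bar>m\<bar>)) has_sum (- 8 * of_real pi ^ 2 * divisor_series 1 (nome t))) (UNIV - {0})"
    by (simp add: algebra_simps)
  then show ?thesis by (rule has_sum_cong[THEN iffD1, rotated]) (use eq in auto)
qed

lemma inverse_squares_nonzero_int_has_sum:
  "((\<lambda>n::int. 1 / of_int n ^ 2 :: complex) has_sum (of_real pi ^ 2 / 3)) (UNIV - {0})"
proof -
  have "((\<lambda>n. 1 / (real n + 1) ^ 2) has_sum (pi ^ 2 / 6)) UNIV"
    using inverse_squares_sums by (intro sums_nonneg_imp_has_sum) (auto simp: add.commute)
  then have "((\<lambda>n. complex_of_real (1 / (real n + 1) ^ 2)) has_sum of_real (pi ^ 2 / 6)) UNIV"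
    by (rule has_sum_of_real)
  then have *: "((\<lambda>n. 1 / of_nat (Suc n) ^ 2 :: complex) has_sum (of_real pi ^ 2 / 6)) UNIV"
    by (simp add: add.commute)
  have "((\<lambda>n::int. 1 / of_int n ^ 2 :: complex) has_sum (of_real pi ^ 2 / 6 + of_real pi ^ 2 / 6)) (UNIV - {0})"
  proof (rule has_sum_nonzero_int)
    have "(of_int (- int (Suc n)) :: complex) ^ 2 = of_nat (Suc n) ^ 2" for n
      by (simp only: of_int_minus power_minus_even even_numeral of_int_of_nat_eq)
    then show "((\<lambda>n. 1 / of_int (- int (Suc n)) ^ 2 :: complex) has_sum (of_real pi ^ 2 / 6)) UNIV"
      using * by simp
  qed (use * in simp)
  then show ?thesis by simp
qed

lemma has_sum_difference:
  fixes f g :: "'a \<Rightarrow> complex"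
  assumes "(f has_sum a) A" "(g has_sum b) A"
  shows "((\<lambda>x. f x - g x) has_sum (a - b)) A"
  using has_sum_add[OF assms(1) has_sum_uminusI[OF assms(2)]] by simp

text \<open>The differences decay quadratically, which makes the sum unordered; its two halves
  telescope to 1 / w and - 1 / w.\<close>

lemma telescoping_has_sum_int:
  fixes w :: complex
  assumes w: "Im w \<noteq> 0"
  shows "((\<lambda>n::int. 1 / (w + of_int n) - 1 / (w + of_int n + 1)) has_sum 0) UNIV"
proof -
  have nz: "w + of_int n \<noteq> 0" for n using w by (auto simp: complex_eq_iff)
  have nz': "w + of_nat n \<noteq> 0" "w + 1 + of_nat n \<noteq> 0" "w - of_nat n \<noteq> 0" for n
    using w by (auto simp: complex_eq_iff)
  have lim: "(\<lambda>n. 1 / (w + of_nat n)) \<longlonglongrightarrow> 0" "(\<lambda>n. 1 / (w - of_nat n)) \<longlonglongrightarrow> 0"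
  proof -
    show "(\<lambda>n. 1 / (w + of_nat n)) \<longlonglongrightarrow> 0"
      by (intro tendsto_divide_0[OF tendsto_const] tendsto_add_filterlim_at_infinity[OF tendsto_const] tendsto_of_nat)
    have "(\<lambda>n. - (1 / (- w + of_nat n))) \<longlonglongrightarrow> - 0"
      by (intro tendsto_minus tendsto_divide_0[OF tendsto_const] tendsto_add_filterlim_at_infinity[OF tendsto_const] tendsto_of_nat)
    moreover have "- (1 / (- w + of_nat n)) = 1 / (w - of_nat n)" for n
      by (metis add_uminus_conv_diff minus_add_distrib minus_divide_right minus_minus)
    ultimately show "(\<lambda>n. 1 / (w - of_nat n)) \<longlonglongrightarrow> 0" by simp
  qed
  have bound: "norm (1 / a - 1 / (a + 1)) \<le> norm (1 / a ^ 2) + norm (1 / (a + 1) ^ 2)"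
    if "a \<noteq> 0" "a + 1 \<noteq> 0" for a :: complex
  proof -
    have "1 / a - 1 / (a + 1) = (1 / a) * (1 / (a + 1))" using that by (simp add: field_simps)
    then have "norm (1 / a - 1 / (a + 1)) = norm (1 / a) * norm (1 / (a + 1))" by (simp only: norm_mult)
    also have "\<dots> \<le> norm (1 / a) ^ 2 + norm (1 / (a + 1)) ^ 2"
      using sum_squares_bound[of "norm (1 / a)" "norm (1 / (a + 1))"]
        mult_nonneg_nonneg[OF norm_ge_zero[of "1 / a"] norm_ge_zero[of "1 / (a + 1)"]] by linarith
    finally show ?thesis by (simp only: norm_power[symmetric] power_one_over)
  qed
  have "((\<lambda>n::int. 1 / (w + of_int n) - 1 / (w + of_int n + 1)) has_sum (1 / w + - (1 / w))) UNIV"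
  proof (rule has_sum_int)
    have s: "summable (\<lambda>n. norm (1 / (w + of_nat n) ^ 2) + norm (1 / (w + 1 + of_nat n) ^ 2))"
      by (intro summable_add norm_summable_inverse_shift_power) auto
    show "((\<lambda>n. 1 / (w + of_int (int n)) - 1 / (w + of_int (int n) + 1)) has_sum 1 / w) UNIV"
    proof (rule norm_summable_imp_has_sum)
      show "summable (\<lambda>n. norm (1 / (w + of_int (int n)) - 1 / (w + of_int (int n) + 1)))"
      proof (rule summable_comparison_test'[OF s])
        fix n :: nat
        show "norm (norm (1 / (w + of_int (int n)) - 1 / (w + of_int (int n) + 1))) \<le>
            norm (1 / (w + of_nat n) ^ 2) + norm (1 / (w + 1 + of_nat n) ^ 2)"
          using bound[of "w + of_nat n"] nz'[of n] by (simp add: add_ac)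
      qed
      have "(\<lambda>n. 1 / (w + of_nat n) - 1 / (w + of_nat (Suc n))) sums (1 / (w + of_nat 0) - 0)"
        by (rule telescope_sums'[OF lim(1)])
      then show "(\<lambda>n. 1 / (w + of_int (int n)) - 1 / (w + of_int (int n) + 1)) sums (1 / w)"
        by (simp add: add_ac)
    qed
    have s: "summable (\<lambda>n. norm (1 / (- w + 1 + of_nat n) ^ 2) + norm (1 / (- w + of_nat n) ^ 2))"
      by (intro summable_add norm_summable_inverse_shift_power) auto
    show "((\<lambda>n. 1 / (w + of_int (- int (Suc n))) - 1 / (w + of_int (- int (Suc n)) + 1)) has_sum - (1 / w)) UNIV"
    proof (rule norm_summable_imp_has_sum)
      have eq: "w + of_int (- int (Suc n)) = - (- w + 1 + of_nat n)" "w + of_int (- int (Suc n)) + 1 = - (- w + of_nat n)" for n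
        by simp_all
      show "summable (\<lambda>n. norm (1 / (w + of_int (- int (Suc n))) - 1 / (w + of_int (- int (Suc n)) + 1)))"
      proof (rule summable_comparison_test'[OF s])
        fix n :: nat
        have "norm (1 / (w + of_int (- int (Suc n))) - 1 / (w + of_int (- int (Suc n)) + 1)) \<le>
          norm (1 / (w + of_int (- int (Suc n))) ^ 2) + norm (1 / (w + of_int (- int (Suc n)) + 1) ^ 2)"
          by (rule bound) (use nz[of "- int (Suc n)"] nz[of "- int n"] in \<open>auto simp: algebra_simps\<close>)
        moreover have "norm (1 / (w + of_int (- int (Suc n))) ^ 2) = norm (1 / (- w + 1 + of_nat n) ^ 2)"
          by (subst eq(1), subst power_minus_even) simp_all
        moreover have "norm (1 / (w + of_int (- int (Suc n)) + 1) ^ 2) = norm (1 / (- w + of_nat n) ^ 2)"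
          by (subst eq(2), subst power_minus_even) simp_all
        ultimately show "norm (norm (1 / (w + of_int (- int (Suc n))) - 1 / (w + of_int (- int (Suc n)) + 1))) \<le>
            norm (1 / (- w + 1 + of_nat n) ^ 2) + norm (1 / (- w + of_nat n) ^ 2)"
          by (simp only: real_norm_def abs_norm_cancel)
      qed
      have "(\<lambda>n. 1 / (w - of_nat (Suc n)) - 1 / (w - of_nat n)) sums (0 - 1 / (w - of_nat 0))"
        by (rule telescope_sums[OF lim(2)])
      then show "(\<lambda>n. 1 / (w + of_int (- int (Suc n))) - 1 / (w + of_int (- int (Suc n)) + 1)) sums (- (1 / w))"
        by (simp add: algebra_simps)
    qed
  qed
  then show ?thesis by simp
qed

text \<open>In the lower half-plane exp(i w) dominates exp(-i w), so the cotangent tends to i. This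
  limit is the source of the non-modular term in \<open>Eisenstein2_S\<close>.\<close>

lemma cot_tendsto:
  assumes s: "Im s < 0"
  shows "(\<lambda>N. cot (of_real pi * (of_nat N * s))) \<longlonglongrightarrow> \<i>"
proof -
  define q where "q = nome (- s)"
  have q: "norm q < 1" using norm_nome_less_1[of "- s"] s by (simp add: q_def)
  have "cot (of_real pi * (of_nat N * s)) = \<i> * (1 + q ^ N) / (1 - q ^ N)" for N
  proof -
    define e where "e = exp (\<i> * (of_real pi * (of_nat N * s)))"
    have e0: "e \<noteq> 0" by (simp add: e_def)
    have qe: "q ^ N = (1 / e) ^ 2"
      unfolding q_def e_def nome_def by (simp add: inverse_eq_divide[symmetric] flip: exp_of_nat_mult exp_minus) (simp add: algebra_simps)
    have "cos (of_real pi * (of_nat N * s)) = (e + 1 / e) / 2" "sin (of_real pi * (of_nat N * s)) = \<i> * (- (e - 1 / e)) / 2"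
      by (simp_all add: cos_exp_eq sin_exp_eq' e_def exp_minus inverse_eq_divide)
    then have "cot (of_real pi * (of_nat N * s)) = ((e + 1 / e) / 2) / (\<i> * (- (e - 1 / e)) / 2)"
      by (simp only: cot_def)
    also have "\<dots> = \<i> * ((e + 1 / e) / (e - 1 / e))"
    proof -
      have "(a / 2) / (\<i> * (- y) / 2) = \<i> * (a / y)" for a y :: complex
        by (cases "y = 0") (simp_all add: field_simps)
      then show ?thesis .
    qed
    also have "(e + 1 / e) / (e - 1 / e) = (e * (1 + q ^ N)) / (e * (1 - q ^ N))"
    proof -
      have "e * (1 + q ^ N) = e + 1 / e" "e * (1 - q ^ N) = e - 1 / e"
        unfolding qe using e0 by (simp_all add: field_simps power2_eq_square)
      then show ?thesis by simp
    qed
    also have "\<dots> = (1 + q ^ N) / (1 - q ^ N)" using e0 by simp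
    finally show ?thesis by simp
  qed
  moreover have "(\<lambda>N. \<i> * (1 + q ^ N) / (1 - q ^ N)) \<longlonglongrightarrow> \<i> * (1 + 0) / (1 - 0)"
    using q by (intro tendsto_intros LIMSEQ_power_zero) auto
  ultimately show ?thesis by simp
qed

text \<open>Summing 1 / (m t + n)^2 first over n leads to \<open>Eisenstein2\<close> at t, first
  over m to its value at -1/t, and the two orders disagree. The absolutely convergent
  \<open>b\<close> has one value in both orders; comparing them, the whole discrepancy is the sum of
  the differences c n - c (n + 1), which the limits of the cotangent at both ends evaluate to - 2 pi
  i / t.\<close>

lemma Eisenstein2_S:
  assumes t: "Im t > 0"
  shows "Eisenstein2 (- (1 / t)) = t ^ 2 * Eisenstein2 t + 6 * t / (of_real pi * \<i>)"
proof -
  have t0: "t \<noteq> 0" using t by auto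
  define M where "M = (UNIV - {0} :: int set)"
  define b where "b = (\<lambda>(m :: int, n :: int). 1 / (of_int m * t + of_int n) ^ 2 -
     (1 / (of_int m * t + of_int n) - 1 / (of_int m * t + of_int n + 1)))"
  define P where "P t = - 8 * of_real pi ^ 2 * divisor_series 1 (nome t)" for t
  have nz: "of_int m * t + of_int n \<noteq> 0" "of_int m * t + of_int n + 1 \<noteq> 0" if "m \<noteq> 0" for m n :: int
    using that t by (auto simp: complex_eq_iff)
  \<comment> \<open>Here \<open>b = 1 / (z\<^sup>2 (z + 1))\<close> with \<open>z = m t + n\<close>, so its double series converges absolutely, while
    subtracting the telescoping part leaves the row sums unchanged and shifts the column sums.\<close>
  have bsum: "b summable_on M \<times> UNIV"
  proof -
    have s: "(\<lambda>p. norm (case p of (m :: int, n :: int) \<Rightarrow> 1 / (of_int m * t + of_int n) ^ 3)) summable_on UNIV"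
      using lattice_summable[OF t, of 3] by (simp add: case_prod_unfold)
    have "bij_betw (\<lambda>(m :: int, n :: int). (m, n + 1)) UNIV UNIV"
      by (rule bij_betwI[where g = "\<lambda>(a, b). (a, b - 1)"]) auto
    then have s': "(\<lambda>p. norm (case (case p of (m, n) \<Rightarrow> (m, n + 1)) of (m :: int, n :: int) \<Rightarrow> 1 / (of_int m * t + of_int n) ^ 3)) summable_on UNIV"
      using s summable_on_reindex_bij_betw[where f = "\<lambda>p. norm (case p of (m :: int, n :: int) \<Rightarrow> 1 / (of_int m * t + of_int n) ^ 3)"] by blast
    have ss: "(\<lambda>p. norm (case p of (m :: int, n :: int) \<Rightarrow> 1 / (of_int m * t + of_int n) ^ 3) +
      norm (case (case p of (m, n) \<Rightarrow> (m, n + 1)) of (m :: int, n :: int) \<Rightarrow> 1 / (of_int m * t + of_int n) ^ 3)) summable_on (M \<times> UNIV)"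
      by (rule summable_on_subset_banach[OF summable_on_add[OF s s']]) auto
    have "(\<lambda>p. norm (b p)) summable_on (M \<times> UNIV)"
    proof (rule Infinite_Sum.abs_summable_on_comparison_test'[OF ss])
      fix p :: "int \<times> int" assume "p \<in> M \<times> UNIV"
      then obtain m n where p: "p = (m, n)" "m \<noteq> 0" by (auto simp: M_def)
      define z where "z = of_int m * t + of_int n"
      have z: "z \<noteq> 0" "z + 1 \<noteq> 0" using nz[OF p(2)] by (auto simp: z_def)
      have "1 / z ^ 2 - (1 / z - 1 / (z + 1)) = 1 / (z ^ 2 * (z + 1))"
        using z by (simp add: divide_simps) (simp add: algebra_simps power2_eq_square)
      then have "norm (b p) = 1 / (norm z ^ 2 * norm (z + 1))"
        by (simp add: b_def p z_def[symmetric] norm_divide norm_mult norm_power)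
      also have "\<dots> \<le> 1 / norm z ^ 3 + 1 / norm (z + 1) ^ 3"
      proof -
        have le: "1 / (x ^ 2 * y) \<le> 1 / x ^ 3 + 1 / y ^ 3" if xy: "x > 0" "y > 0" for x y :: real
        proof (cases "x \<le> y")
          case True
          then have "x ^ 2 * x \<le> x ^ 2 * y" using xy by (intro mult_left_mono) auto
          then have "1 / (x ^ 2 * y) \<le> 1 / x ^ 3" using xy by (intro divide_left_mono) (auto simp: power_numeral_reduce)
          then show ?thesis using xy by (simp add: add_increasing2)
        next
          case False
          then have "y ^ 2 * y \<le> x ^ 2 * y" using xy by (intro mult_right_mono power_mono) auto
          then have "1 / (x ^ 2 * y) \<le> 1 / y ^ 3" using xy by (intro divide_left_mono) (auto simp: power_numeral_reduce)
          then show ?thesis using xy by (simp add: add_increasing)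
        qed
        show ?thesis using z by (intro le) auto
      qed
      finally show "norm (b p) \<le> norm (case p of (m :: int, n :: int) \<Rightarrow> 1 / (of_int m * t + of_int n) ^ 3) +
          norm (case (case p of (m, n) \<Rightarrow> (m, n + 1)) of (m :: int, n :: int) \<Rightarrow> 1 / (of_int m * t + of_int n) ^ 3)"
        by (simp add: p z_def norm_divide norm_power add_ac)
    qed
    then show ?thesis by (rule abs_summable_summable)
  qed
  then obtain T where T: "(b has_sum T) (M \<times> UNIV)" unfolding summable_on_def by blast
  have rows: "((\<lambda>n. b (m, n)) has_sum (of_real pi / sin (of_real pi * (of_int m * t))) ^ 2) UNIV" if "m \<in> M" for m
  proof -
    have im: "Im (of_int m * t) \<noteq> 0" using that t by (simp add: M_def)
    from has_sum_difference[OF csc_squared_partial_fractions(1)[OF not_Ints_if_Im[OF im]] telescoping_has_sum_int[OF im]]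
    show ?thesis by (simp add: b_def)
  qed
  have "((\<lambda>m. (of_real pi / sin (of_real pi * (of_int m * t))) ^ 2) has_sum T) M"
    using T rows by (rule has_sum_SigmaD)
  then have TP: "T = P t" using csc_squared_row_sum_nonzero[OF t] has_sum_unique unfolding M_def P_def by blast
  define s where "s = 1 / t"
  have ims: "Im s < 0" using Im_minus_inverse_pos[OF t] by (simp add: s_def)
  \<comment> \<open>The sum of 1 / (m t + n) over m /= 0 with m and -m paired, rewritten by the
    partial fractions of the cotangent at n s; for n = 0 the pairs cancel.\<close>
  define c where "c n = (if n = 0 then 0 else s * (of_real pi * cot (of_real pi * (of_int n * s)) - 1 / (of_int n * s)))" for n :: int
  \<comment> \<open>The column sum of the squares: the cosecant expansion at n s without its term m
    = 0, and 2 zeta(2) s^2 for n = 0.\<close>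
  define A where "A n = (if n = 0 then s ^ 2 * (of_real pi ^ 2 / 3)
      else s ^ 2 * (of_real pi / sin (of_real pi * (of_int n * s))) ^ 2 - 1 / of_int n ^ 2)" for n :: int
  have nI: "of_int n * s \<notin> \<int>" if "n \<noteq> 0" for n :: int using that ims by (intro not_Ints_if_Im) auto
  have csum: "(\<lambda>j. 1 / (of_int (int (Suc j)) * t + of_int n) + 1 / (of_int (- int (Suc j)) * t + of_int n)) sums c n" for n :: int
  proof (cases "n = 0")
    case True
    have "1 / (of_int (int (Suc j)) * t + of_int n) + 1 / (of_int (- int (Suc j)) * t + of_int n) = 0" for j
      unfolding True of_int_0 add_0_right of_int_minus mult_minus_left by (simp add: divide_minus_right del: of_nat_Suc of_int_of_nat_eq)
    then show ?thesis using True by (simp only: c_def simp_thms if_True sums_zero)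
  next
    case False
    have "(\<lambda>m. s * (1 / (of_int n * s + of_nat (Suc m)) + 1 / (of_int n * s - of_nat (Suc m)))) sums
      (s * (of_real pi * cot (of_real pi * (of_int n * s)) - 1 / (of_int n * s)))"
      by (intro sums_mult cot_partial_fractions nI False)
    moreover have "s * (1 / (of_int n * s + w) + 1 / (of_int n * s - w)) = 1 / (w * t + of_int n) + 1 / (- w * t + of_int n)" for w
    proof -
      have "of_int n * s + w = (w * t + of_int n) * s" "of_int n * s - w = (- w * t + of_int n) * s"
        using t0 by (simp_all add: s_def field_simps)
      moreover have "s \<noteq> 0" using t0 by (simp add: s_def)
      ultimately show ?thesis by (simp add: distrib_left)
    qed
    ultimately show ?thesis using False by (simp add: c_def)
  qed
  have cols2: "((\<lambda>m. 1 / (of_int m * t + of_int n) ^ 2) has_sum A n) M" for n :: int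
  proof (cases "n = 0")
    case True
    have "((\<lambda>m::int. s ^ 2 * (1 / of_int m ^ 2)) has_sum (s ^ 2 * (of_real pi ^ 2 / 3))) M"
      unfolding M_def by (intro has_sum_cmult_right inverse_squares_nonzero_int_has_sum)
    then show ?thesis using True by (simp add: A_def s_def power_mult_distrib power_divide mult_ac)
  next
    case False
    have "((\<lambda>m::int. s ^ 2 * (1 / (of_int n * s + of_int m) ^ 2)) has_sum (s ^ 2 * (of_real pi / sin (of_real pi * (of_int n * s))) ^ 2)) UNIV"
      by (intro has_sum_cmult_right csc_squared_partial_fractions nI False)
    moreover have "s ^ 2 * (1 / (of_int n * s + of_int m) ^ 2) = 1 / (of_int m * t + of_int n) ^ 2" for m :: int
    proof -
      have "of_int n * s + of_int m = (of_int m * t + of_int n) * s" using t0 by (simp add: s_def field_simps)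
      moreover have "s \<noteq> 0" using t0 by (simp add: s_def)
      ultimately show ?thesis by (simp add: power_mult_distrib)
    qed
    ultimately have "((\<lambda>m::int. 1 / (of_int m * t + of_int n) ^ 2) has_sum (s ^ 2 * (of_real pi / sin (of_real pi * (of_int n * s))) ^ 2)) UNIV"
      by simp
    moreover have "((\<lambda>m::int. 1 / (of_int m * t + of_int n) ^ 2) has_sum (1 / of_int n ^ 2)) {0}"
      by (rule has_sum_finiteI) auto
    ultimately show ?thesis unfolding M_def using False by (auto simp: A_def intro: has_sum_Diff)
  qed
  have cols: "((\<lambda>m. b (m, n)) has_sum (A n - (c n - c (n + 1)))) M" for n :: int
  proof -
    have "(\<lambda>m. b (m, n)) summable_on M"
    proof -
      have "(\<lambda>(n, m). b (m, n)) summable_on (UNIV \<times> M)" using bsum summable_on_swap by blast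
      then show ?thesis by (rule summable_on_SigmaD1[where f = "\<lambda>n m. b (m, n)"]) auto
    qed
    then have "(\<lambda>m. 1 / (of_int m * t + of_int n) ^ 2 - b (m, n)) summable_on M"
      using cols2[of n] has_sum_difference unfolding summable_on_def by blast
    then obtain U where U: "((\<lambda>m. 1 / (of_int m * t + of_int n) ^ 2 - b (m, n)) has_sum U) M"
      unfolding summable_on_def by blast
    \<comment> \<open>The part subtracted from the squares in column n. It is summable as a
      difference of two summable families, so it may be evaluated with m and -m paired, although
      neither of its two terms is summable alone.\<close>
    define u where "u m = 1 / (of_int m * t + of_int n) - 1 / (of_int m * t + of_int (n + 1))" for m :: int
    have Uu: "(u has_sum U) M" using U by (simp add: b_def u_def[abs_def] add_ac)
    have us: "u summable_on M" using Uu unfolding summable_on_def by blast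
    have "u summable_on {0<..}" "u summable_on {..<0}"
      by (rule summable_on_subset_banach[OF us], auto simp: M_def)+
    then have pos: "(u has_sum infsum u {0<..}) {0<..}" and neg: "(u has_sum infsum u {..<0}) {..<0}"
      by (auto intro: has_sum_infsum)
    have "(u has_sum (infsum u {0<..} + infsum u {..<0})) ({0<..} \<union> {..<0})"
      by (rule has_sum_Un_disjoint[OF pos neg]) auto
    moreover have "{0<..} \<union> {..<0} = M" by (auto simp: M_def)
    ultimately have UU: "U = infsum u {0<..} + infsum u {..<0}" using Uu has_sum_unique by metis
    have "bij_betw (\<lambda>j. int (Suc j)) UNIV {0<..}"
      by (rule bij_betwI[where g = "\<lambda>x. nat (x - 1)"]) auto
    then have "((\<lambda>j. u (int (Suc j))) has_sum infsum u {0<..}) UNIV"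
      using pos has_sum_reindex_bij_betw by blast
    then have 1: "(\<lambda>j. u (int (Suc j))) sums infsum u {0<..}" by (rule has_sum_imp_sums)
    have "bij_betw (\<lambda>j. - int (Suc j)) UNIV {..<0}"
      by (rule bij_betwI[where g = "\<lambda>x. nat (- x - 1)"]) auto
    then have "((\<lambda>j. u (- int (Suc j))) has_sum infsum u {..<0}) UNIV"
      using neg has_sum_reindex_bij_betw by blast
    then have 2: "(\<lambda>j. u (- int (Suc j))) sums infsum u {..<0}" by (rule has_sum_imp_sums)
    have "(\<lambda>j. u (int (Suc j)) + u (- int (Suc j))) sums U" unfolding UU by (rule sums_add[OF 1 2])
    moreover have "(\<lambda>j. u (int (Suc j)) + u (- int (Suc j))) sums (c n - c (n + 1))"
      using sums_diff[OF csum[of n] csum[of "n + 1"]] unfolding u_def by (simp add: algebra_simps)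
    ultimately have "U = c n - c (n + 1)" using sums_unique2 by blast
    with has_sum_difference[OF cols2[of n] U] show ?thesis by simp
  qed
  have "((\<lambda>(n, m). b (m, n)) has_sum T) (UNIV \<times> M)" using T has_sum_swap by blast
  then have main: "((\<lambda>n. A n - (c n - c (n + 1))) has_sum T) UNIV"
    by (rule has_sum_SigmaD) (use cols in simp)
  have Asum: "(A has_sum (s ^ 2 * P (- s) - of_real pi ^ 2 / 3 + s ^ 2 * (of_real pi ^ 2 / 3))) UNIV"
  proof -
    have "((\<lambda>n. s ^ 2 * (of_real pi / sin (of_real pi * (of_int n * (- s)))) ^ 2) has_sum (s ^ 2 * P (- s))) M"
      unfolding M_def P_def using ims by (intro has_sum_cmult_right csc_squared_row_sum_nonzero) auto
    then have "((\<lambda>n. s ^ 2 * (of_real pi / sin (of_real pi * (of_int n * s))) ^ 2) has_sum (s ^ 2 * P (- s))) M"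
      by (simp add: power_divide)
    from has_sum_difference[OF this inverse_squares_nonzero_int_has_sum[folded M_def]]
    have "(A has_sum (s ^ 2 * P (- s) - of_real pi ^ 2 / 3)) M"
      by (rule has_sum_cong[THEN iffD1, rotated]) (auto simp: A_def M_def)
    moreover have "(A has_sum A 0) {0}" by (rule has_sum_finiteI) auto
    ultimately have "(A has_sum (s ^ 2 * P (- s) - of_real pi ^ 2 / 3 + A 0)) (M \<union> {0})"
      by (rule has_sum_Un_disjoint) (auto simp: M_def)
    moreover have "M \<union> {0} = UNIV" by (auto simp: M_def)
    ultimately show ?thesis by (simp add: A_def)
  qed
  \<comment> \<open>Comparing \<open>Asum\<close> with \<open>main\<close> shows that
    \<open>R\<close> is the sum of all c n - c (n + 1). It is then computed a second time by
    telescoping from 0 towards both ends; as c is odd, each half is - s pi i.\<close>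
  define R where "R = s ^ 2 * P (- s) - of_real pi ^ 2 / 3 + s ^ 2 * (of_real pi ^ 2 / 3) - T"
  have Rsum: "((\<lambda>n. c n - c (n + 1)) has_sum R) UNIV"
    using has_sum_difference[OF Asum main] by (simp add: R_def)
  have climit: "(\<lambda>N. c (int N)) \<longlonglongrightarrow> s * (of_real pi * \<i>)"
  proof -
    have "(\<lambda>N. s * (of_real pi * cot (of_real pi * (of_nat N * s)) - 1 / of_nat N * (1 / s))) \<longlonglongrightarrow>
        s * (of_real pi * \<i> - 0 * (1 / s))"
      by (intro tendsto_intros cot_tendsto ims lim_1_over_n)
    then have "(\<lambda>N. s * (of_real pi * cot (of_real pi * (of_nat N * s)) - 1 / of_nat N * (1 / s))) \<longlonglongrightarrow> s * (of_real pi * \<i>)"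
      by simp
    then show ?thesis
      by (rule Lim_transform_eventually) (use eventually_gt_at_top[of "0 :: nat"] in eventually_elim, auto simp: c_def)
  qed
  have codd: "c (- n) = - c n" for n
    by (cases "n = 0") (simp_all add: c_def cot_def algebra_simps)
  have "R = - 2 * (s * (of_real pi * \<i>))"
  proof -
    have su: "(\<lambda>n. c n - c (n + 1)) summable_on UNIV" using Rsum unfolding summable_on_def by blast
    have "(\<lambda>n. c n - c (n + 1)) summable_on {0..}" "(\<lambda>n. c n - c (n + 1)) summable_on {..<0}"
      by (rule summable_on_subset_banach[OF su], simp)+
    then have pos: "((\<lambda>n. c n - c (n + 1)) has_sum infsum (\<lambda>n. c n - c (n + 1)) {0..}) {0..}"
      and neg: "((\<lambda>n. c n - c (n + 1)) has_sum infsum (\<lambda>n. c n - c (n + 1)) {..<0}) {..<0}"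
      by (auto intro: has_sum_infsum)
    have "bij_betw int UNIV {0..}" by (rule bij_betwI[where g = nat]) auto
    then have "((\<lambda>j. c (int j) - c (int j + 1)) has_sum infsum (\<lambda>n. c n - c (n + 1)) {0..}) UNIV"
      using pos has_sum_reindex_bij_betw[of int UNIV "{0..}" "\<lambda>n. c n - c (n + 1)"] by blast
    then have "(\<lambda>j. c (int j) - c (int (Suc j))) sums infsum (\<lambda>n. c n - c (n + 1)) {0..}"
      using has_sum_imp_sums by (force simp: add_ac)
    moreover have "(\<lambda>j. c (int j) - c (int (Suc j))) sums (c (int 0) - s * (of_real pi * \<i>))"
      by (rule telescope_sums'[OF climit])
    ultimately have 1: "infsum (\<lambda>n. c n - c (n + 1)) {0..} = - (s * (of_real pi * \<i>))"
      using sums_unique2 by (fastforce simp: c_def)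
    have "bij_betw (\<lambda>j. - int (Suc j)) UNIV {..<0}"
      by (rule bij_betwI[where g = "\<lambda>x. nat (- x - 1)"]) auto
    then have "((\<lambda>j. c (- int (Suc j)) - c (- int (Suc j) + 1)) has_sum infsum (\<lambda>n. c n - c (n + 1)) {..<0}) UNIV"
      using neg has_sum_reindex_bij_betw[of "\<lambda>j. - int (Suc j)" UNIV "{..<0}" "\<lambda>n. c n - c (n + 1)"] by blast
    moreover have "c (- int (Suc j)) - c (- int (Suc j) + 1) = c (int j) - c (int (Suc j))" for j
    proof -
      have "- int (Suc j) + 1 = - int j" by simp
      then show ?thesis by (simp only: codd) simp
    qed
    ultimately have "(\<lambda>j. c (int j) - c (int (Suc j))) sums infsum (\<lambda>n. c n - c (n + 1)) {..<0}"
      using has_sum_imp_sums by (simp only:)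
    moreover have "(\<lambda>j. c (int j) - c (int (Suc j))) sums (c (int 0) - s * (of_real pi * \<i>))"
      by (rule telescope_sums'[OF climit])
    ultimately have 2: "infsum (\<lambda>n. c n - c (n + 1)) {..<0} = - (s * (of_real pi * \<i>))"
      using sums_unique2 by (fastforce simp: c_def)
    have "((\<lambda>n. c n - c (n + 1)) has_sum (infsum (\<lambda>n. c n - c (n + 1)) {0..} + infsum (\<lambda>n. c n - c (n + 1)) {..<0})) ({0..} \<union> {..<0})"
      by (rule has_sum_Un_disjoint[OF pos neg]) auto
    moreover have "{0..} \<union> {..<0} = (UNIV :: int set)" by auto
    ultimately have "((\<lambda>n. c n - c (n + 1)) has_sum (- (s * (of_real pi * \<i>)) + - (s * (of_real pi * \<i>)))) UNIV"
      by (simp only: 1 2)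
    from has_sum_unique[OF Rsum this] show ?thesis by simp
  qed
  then have "s ^ 2 * P (- s) - of_real pi ^ 2 / 3 + s ^ 2 * (of_real pi ^ 2 / 3) - P t = - 2 * (s * (of_real pi * \<i>))"
    by (simp add: R_def TP)
  moreover have "P u = of_real pi ^ 2 / 3 * Eisenstein2 u - of_real pi ^ 2 / 3" for u
    by (simp add: P_def Eisenstein2_def algebra_simps)
  ultimately have "of_real pi ^ 2 / 3 * (s ^ 2 * Eisenstein2 (- s) - Eisenstein2 t) = - 2 * (s * (of_real pi * \<i>))"
    by (simp add: algebra_simps)
  then have "of_real pi * (of_real pi * (s ^ 2 * Eisenstein2 (- s) - Eisenstein2 t)) = of_real pi * (- 6 * (s * \<i>))"
    by (simp add: power2_eq_square mult_ac)
  then have "of_real pi * (s ^ 2 * Eisenstein2 (- s) - Eisenstein2 t) = - 6 * (s * \<i>)"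
    by (subst (asm) mult_left_cancel) auto
  then have "s ^ 2 * Eisenstein2 (- s) = Eisenstein2 t - 6 * (s * \<i>) / of_real pi"
    by (simp add: field_simps)
  then have "t ^ 2 * (s ^ 2 * Eisenstein2 (- s)) = t ^ 2 * (Eisenstein2 t - 6 * (s * \<i>) / of_real pi)" by simp
  moreover have "t ^ 2 * (s ^ 2 * Eisenstein2 (- s)) = Eisenstein2 (- (1 / t))"
    using t0 by (simp add: s_def power_divide)
  moreover have "t ^ 2 * (Eisenstein2 t - 6 * (s * \<i>) / of_real pi) = t ^ 2 * Eisenstein2 t + 6 * t / (of_real pi * \<i>)"
  proof -
    have "t ^ 2 * (6 * (s * \<i>) / of_real pi) = 6 * t * \<i> / of_real pi"
      using t0 by (simp add: s_def power2_eq_square)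
    moreover have "6 * t / (of_real pi * \<i>) = - (6 * t * \<i> / of_real pi)" by (simp add: field_simps)
    ultimately show ?thesis by (simp add: right_diff_distrib)
  qed
  ultimately show ?thesis by simp
qed

section \<open>The discriminant and the modular invariant\<close>

definition euler_product :: "complex \<Rightarrow> complex" where
  "euler_product q = prodinf (\<lambda>n. 1 - q ^ Suc n)"

lemma one_minus_power_nonzero:
  fixes q :: complex
  assumes "norm q < 1"
  shows "1 - q ^ Suc n \<noteq> 0"
  using norm_power_Suc_less_1[OF assms, of n] by (metis eq_iff_diff_eq_0 less_irrefl norm_one)

lemma euler_product_props:
  fixes q :: complex
  assumes q: "norm q < 1"
  shows "(\<lambda>N. \<Prod>n<N. 1 - q ^ Suc n) \<longlonglongrightarrow> euler_product q" "euler_product q \<noteq> 0"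
proof -
  have "summable (\<lambda>n. norm q ^ n)" using q by (simp add: summable_geometric)
  then have "summable (\<lambda>n. norm q ^ Suc n)" by (subst summable_Suc_iff)
  then have "summable (\<lambda>n. norm ((1 - q ^ Suc n) - 1))" by (simp add: norm_power norm_mult)
  then have "abs_convergent_prod (\<lambda>n. 1 - q ^ Suc n)" by (rule summable_imp_abs_convergent_prod)
  then have c: "convergent_prod (\<lambda>n. 1 - q ^ Suc n)" by (rule abs_convergent_prod_imp_convergent_prod)
  show "(\<lambda>N. \<Prod>n<N. 1 - q ^ Suc n) \<longlonglongrightarrow> euler_product q"
    using convergent_prod_LIMSEQ[OF c] unfolding euler_product_def by (simp only: LIMSEQ_lessThan_iff_atMost)
  show "euler_product q \<noteq> 0"
    unfolding euler_product_def using c one_minus_power_nonzero[OF q] by (intro prodinf_nonzero) auto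
qed

lemma modular_discriminant_euler:
  assumes t: "Im t > 0"
  shows "modular_discriminant t = nome t * euler_product (nome t) ^ 24"
proof -
  note e = euler_product_props[OF norm_nome_less_1[OF t]]
  have "(\<lambda>N. (\<Prod>n<N. 1 - nome t ^ Suc n) ^ 24) \<longlonglongrightarrow> euler_product (nome t) ^ 24"
    by (intro tendsto_power e)
  then have "(\<lambda>N. \<Prod>n<N. (1 - nome t ^ Suc n) ^ 24) \<longlonglongrightarrow> euler_product (nome t) ^ 24"
    by (simp only: prod_power_distrib)
  then have "prodinf (\<lambda>n. (1 - nome t ^ Suc n) ^ 24) = euler_product (nome t) ^ 24"
    by (rule prodinf_eq_prod_lim') (use e in simp)
  then show ?thesis by (simp add: modular_discriminant_def)
qed

lemma euler_product_uniform_limit: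
  assumes r: "r < 1"
  shows "uniform_limit (cball 0 r) (\<lambda>N q. \<Prod>n<N. 1 - q ^ Suc n) euler_product sequentially"
proof (cases "r < 0")
  case True
  then show ?thesis by (simp add: cball_empty)
next
  case False
  have "uniformly_convergent_on (cball 0 r) (\<lambda>N q :: complex. \<Prod>n<N. 1 - q ^ Suc n)"
  proof (rule uniformly_convergent_on_prod')
    have "summable (\<lambda>n. r ^ n)" using r False by (simp add: summable_geometric)
    then have s: "summable (\<lambda>n. r ^ Suc n)" by (subst summable_Suc_iff)
    show "uniformly_convergent_on (cball 0 r) (\<lambda>N x :: complex. \<Sum>n<N. norm (1 - x ^ Suc n - 1))"
    proof (rule Weierstrass_m_test'[OF _ s])
      fix n and x :: complex assume "x \<in> cball 0 r"
      then have "norm x ^ Suc n \<le> r ^ Suc n" by (intro power_mono) auto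
      then show "norm (norm (1 - x ^ Suc n - 1)) \<le> r ^ Suc n" by (simp add: norm_power norm_mult)
    qed
  qed (auto intro!: continuous_intros)
  then obtain l where l: "uniform_limit (cball 0 r) (\<lambda>N q :: complex. \<Prod>n<N. 1 - q ^ Suc n) l sequentially"
    unfolding uniformly_convergent_on_def by blast
  have "l q = euler_product q" if "q \<in> cball 0 r" for q
    using tendsto_uniform_limitI[OF l that] euler_product_props(1)[of q] that r LIMSEQ_unique by auto
  then show ?thesis using l by (metis (no_types, lifting) uniform_limit_cong')
qed

lemma euler_product_holomorphic: "euler_product holomorphic_on ball 0 1"
proof (rule holomorphic_uniform_sequence)
  show "open (ball (0 :: complex) 1)" by simp
  show "(\<lambda>q. \<Prod>n<N. 1 - q ^ Suc n) holomorphic_on ball 0 1" for N by (intro holomorphic_intros)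
  fix x :: complex assume x: "x \<in> ball 0 1"
  define d where "d = (1 - norm x) / 2"
  have "d > 0" using x by (simp add: d_def)
  moreover have sub: "cball x d \<subseteq> cball 0 (norm x + d)"
    by (auto simp: dist_norm) (smt (verit) norm_minus_commute norm_triangle_sub)
  moreover have lt: "norm x + d < 1" using x by (simp add: d_def field_simps)
  moreover have "cball x d \<subseteq> ball 0 1" using sub lt by force
  ultimately show "\<exists>d>0. cball x d \<subseteq> ball 0 1 \<and>
      uniform_limit (cball x d) (\<lambda>N q. \<Prod>n<N. 1 - q ^ Suc n) euler_product sequentially"
    using uniform_limit_on_subset[OF euler_product_uniform_limit[OF lt] sub] by blast
qed

text \<open>Termwise, q times the logarithmic derivative of 1 - q^n is - n q^n / (1 - q^n), and the
  sum is the column form of the Lambert series.\<close>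

lemma euler_product_logderiv:
  assumes q: "norm q < 1"
  shows "q * deriv euler_product q / euler_product q = - divisor_series 1 q"
proof -
  define r where "r = (1 + norm q) / 2"
  have r: "norm q < r" "r < 1" using q by (auto simp: r_def)
  have "(\<lambda>k. deriv (\<lambda>q. 1 - q ^ Suc k) q / (1 - q ^ Suc k)) sums (deriv euler_product q / euler_product q)"
  proof (rule logderiv_prodinf_complex_uniform_limit)
    show "uniform_limit (ball 0 r) (\<lambda>n x. \<Prod>k<n. 1 - x ^ Suc k) euler_product sequentially"
      by (rule uniform_limit_on_subset[OF euler_product_uniform_limit[OF r(2)]]) auto
    show "(\<lambda>q. 1 - q ^ Suc k) holomorphic_on ball 0 r" for k by (intro holomorphic_intros)
    show "euler_product q \<noteq> 0" by (rule euler_product_props(2)[OF q])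
  qed (use r in auto)
  moreover have "deriv (\<lambda>q. 1 - q ^ Suc k) q = - (of_nat (Suc k) * q ^ k)" for k
    by (rule DERIV_imp_deriv) (auto intro!: derivative_eq_intros simp del: power_Suc)
  ultimately have "(\<lambda>k. - (of_nat (Suc k) * q ^ k) / (1 - q ^ Suc k)) sums (deriv euler_product q / euler_product q)"
    by simp
  then have "(\<lambda>k. - q * (- (of_nat (Suc k) * q ^ k) / (1 - q ^ Suc k))) sums (- q * (deriv euler_product q / euler_product q))"
    by (rule sums_mult)
  moreover have "- q * (- (of_nat (Suc k) * q ^ k) / (1 - q ^ Suc k)) = of_nat (Suc k) * (q ^ Suc k / (1 - q ^ Suc k))" for k
    by (simp add: mult_ac)
  ultimately have "(\<lambda>k. of_nat (Suc k) * (q ^ Suc k / (1 - q ^ Suc k))) sums (- q * (deriv euler_product q / euler_product q))"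
    by (simp only:)
  then have "- q * (deriv euler_product q / euler_product q) = divisor_series 1 q"
    using lambert_series_columns[OF q] sums_unique2 by blast
  then show ?thesis by (simp add: minus_equation_iff[of "_ / _"])
qed

lemma nome_has_field_derivative:
  "(nome has_field_derivative (2 * of_real pi * \<i> * nome t)) (at t within A)"
  unfolding nome_def[abs_def] by (auto intro!: derivative_eq_intros)

lemma modular_discriminant_nonzero: "Im t > 0 \<Longrightarrow> modular_discriminant t \<noteq> 0"
  using euler_product_props(2)[OF norm_nome_less_1] by (simp add: modular_discriminant_euler)

lemma open_upper_half_plane: "open upper_half_plane"
  unfolding upper_half_plane_def by (rule open_halfspace_Im_gt)

text \<open>In the logarithmic derivative the factor q contributes 1 and the 24th power of the
  product contributes -24 times the divisor series; together these are
  \<open>Eisenstein2\<close>.\<close>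

lemma modular_discriminant_has_field_derivative:
  assumes t: "Im t > 0"
  shows "(modular_discriminant has_field_derivative
            (2 * of_real pi * \<i> * Eisenstein2 t * modular_discriminant t)) (at t)"
proof (rule has_field_derivative_transform_within_open[OF _ open_upper_half_plane])
  define q where "q = nome t"
  have q: "norm q < 1" using norm_nome_less_1[OF t] by (simp add: q_def)
  define e where "e = euler_product q"
  define e' where "e' = deriv euler_product q"
  have e0: "e \<noteq> 0" using euler_product_props(2)[OF q] by (simp add: e_def)
  have d: "(euler_product has_field_derivative e') (at (nome t))"
    using holomorphic_derivI[OF euler_product_holomorphic, of q UNIV] q by (simp add: e'_def q_def)
  have d': "((\<lambda>t. euler_product (nome t)) has_field_derivative (e' * (2 * of_real pi * \<i> * q))) (at t)"
    using DERIV_chain2[OF d nome_has_field_derivative[of t UNIV]] by (simp add: q_def)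
  have "((\<lambda>t. nome t * euler_product (nome t) ^ 24) has_field_derivative
     (2 * of_real pi * \<i> * q) * e ^ 24 + (of_nat 24 * (e' * (2 * of_real pi * \<i> * q) * e ^ (24 - Suc 0))) * q) (at t)"
    using DERIV_mult'[OF nome_has_field_derivative[of t UNIV] DERIV_power[OF d', of 24]]
    by (simp add: q_def e_def mult_ac add_ac)
  moreover have "(2 * of_real pi * \<i> * q) * e ^ 24 + (of_nat 24 * (e' * (2 * of_real pi * \<i> * q) * e ^ (24 - Suc 0))) * q =
    2 * of_real pi * \<i> * (1 + 24 * (q * e' / e)) * (q * e ^ 24)"
  proof -
    have "e ^ 24 = e * e ^ 23" by (simp flip: power_Suc)
    then show ?thesis using e0 by (simp add: field_simps)
  qed
  moreover have "1 + 24 * (q * e' / e) = Eisenstein2 t"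
    unfolding e_def e'_def euler_product_logderiv[OF q] by (simp add: Eisenstein2_def q_def)
  moreover have "q * e ^ 24 = modular_discriminant t"
    using modular_discriminant_euler[OF t] by (simp add: q_def e_def)
  ultimately show "((\<lambda>t. nome t * euler_product (nome t) ^ 24) has_field_derivative
     (2 * of_real pi * \<i> * Eisenstein2 t * modular_discriminant t)) (at t)" by simp
qed (use t in \<open>auto simp: upper_half_plane_def modular_discriminant_euler\<close>)

text \<open>The quotient of the two sides has derivative 0: the extra term in the law for
  \<open>Eisenstein2\<close> contributes 12 / u, the logarithmic derivative of u^12. The constant is
  read off at the fixed point i, where i^12 = 1.\<close>

lemma modular_discriminant_S:
  assumes t: "Im t > 0"
  shows "modular_discriminant (- (1 / t)) = t ^ 12 * modular_discriminant t"
proof -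
  define f where "f t = modular_discriminant (- (1 / t)) / (t ^ 12 * modular_discriminant t)" for t
  have der: "(f has_field_derivative 0) (at u within upper_half_plane)" if u: "u \<in> upper_half_plane" for u
  proof -
    have im: "Im u > 0" using u by (simp add: upper_half_plane_def)
    then have u0: "u \<noteq> 0" by auto
    define D where "D = modular_discriminant u"
    define A where "A = modular_discriminant (- (1 / u))"
    have D0: "D \<noteq> 0" using modular_discriminant_nonzero[OF im] by (simp add: D_def)
    define a where "a = 2 * of_real pi * \<i> * Eisenstein2 (- (1 / u))"
    define b where "b = 2 * of_real pi * \<i> * Eisenstein2 u"
    have ab: "a = u ^ 2 * b + 12 * u"
    proof -
      have "2 * of_real pi * \<i> * (6 * u / (of_real pi * \<i>)) = 12 * u" by simp
      then show ?thesis unfolding a_def b_def Eisenstein2_S[OF im] by (simp add: distrib_left mult_ac)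
    qed
    have dA: "((\<lambda>u. modular_discriminant (- (1 / u))) has_field_derivative (a * A * (1 / u ^ 2))) (at u)"
    proof -
      have 1: "(modular_discriminant has_field_derivative (a * A)) (at (- (1 / u)))"
        using modular_discriminant_has_field_derivative[OF Im_minus_inverse_pos[OF im]] by (simp add: a_def A_def)
      have 2: "((\<lambda>u. - (1 / u)) has_field_derivative 1 / u ^ 2) (at u)"
        using u0 by (auto intro!: derivative_eq_intros simp: power2_eq_square)
      show ?thesis by (rule DERIV_chain2[OF 1 2])
    qed
    have dD: "((\<lambda>u. u ^ 12 * modular_discriminant u) has_field_derivative (u ^ 12 * (b * D) + (of_nat 12 * (1 * u ^ (12 - Suc 0))) * D)) (at u)"
      using DERIV_mult'[OF DERIV_power[OF DERIV_ident, of 12] modular_discriminant_has_field_derivative[OF im]]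
      by (simp add: b_def D_def)
    have "(f has_field_derivative ((a * A * (1 / u ^ 2)) * (u ^ 12 * D) - A * (u ^ 12 * (b * D) + (of_nat 12 * (1 * u ^ (12 - Suc 0))) * D)) /
        ((u ^ 12 * D) * (u ^ 12 * D))) (at u)"
      unfolding f_def using DERIV_divide[OF dA dD] u0 D0 by (simp add: A_def D_def)
    moreover have "(a * A * (1 / u ^ 2)) * (u ^ 12 * D) = A * (u ^ 12 * (b * D) + (of_nat 12 * (1 * u ^ (12 - Suc 0))) * D)"
    proof -
      have "u ^ 12 = u ^ 2 * u ^ 10" "u ^ 11 = u * u ^ 10" by (simp_all flip: power_add power_Suc)
      then show ?thesis unfolding ab using u0 by (simp add: field_simps)
    qed
    ultimately have "(f has_field_derivative 0) (at u)" by simp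
    then show ?thesis by (rule has_field_derivative_at_within)
  qed
  have "convex upper_half_plane" unfolding upper_half_plane_def by (rule convex_halfspace_Im_gt)
  then obtain c where c: "\<And>u. u \<in> upper_half_plane \<Longrightarrow> f u = c"
    using has_field_derivative_zero_constant[of upper_half_plane f] der by metis
  have "f \<i> = 1"
  proof -
    have "\<i> ^ 12 = (1 :: complex)" by (simp add: power_numeral_reduce)
    moreover have "- (1 / \<i>) = \<i>" by simp
    ultimately show ?thesis using modular_discriminant_nonzero[of \<i>] by (simp add: f_def)
  qed
  then have "c = 1" using c[of \<i>] by (simp add: upper_half_plane_def)
  then have "f t = 1" using c[of t] t by (simp add: upper_half_plane_def)
  moreover have "t ^ 12 * modular_discriminant t \<noteq> 0" using modular_discriminant_nonzero[OF t] t by auto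
  ultimately show ?thesis by (simp add: f_def)
qed

lemma J_invariant_S:
  assumes t: "Im t > 0"
  shows "J_invariant (- (1 / t)) = J_invariant t"
proof -
  have "t \<noteq> 0" using t by auto
  then have "(t ^ 4 * Eisenstein4 t) ^ 3 / (t ^ 12 * modular_discriminant t) = Eisenstein4 t ^ 3 / modular_discriminant t"
    by (simp add: power_mult_distrib flip: power_mult)
  then show ?thesis unfolding J_invariant_def Eisenstein4_S[OF t] modular_discriminant_S[OF t] by simp
qed

lemma nome_plus_of_int: "nome (t + of_int n) = nome t"
proof -
  have "nome (t + of_int n) = nome t * exp (2 * of_int n * of_real pi * \<i>)"
    by (simp add: nome_def ring_distribs exp_add mult_ac)
  also have "exp (2 * of_int n * of_real pi * \<i>) = 1"
    using exp_eq_1[of "2 * of_int n * of_real pi * \<i>"] by auto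
  finally show ?thesis by simp
qed

lemma J_invariant_T: "J_invariant (t + of_int n) = J_invariant t"
  by (simp add: J_invariant_def Eisenstein4_def modular_discriminant_def nome_plus_of_int)

section \<open>Coefficients of the modular invariant\<close>

definition nat_coeffs :: "complex fps \<Rightarrow> bool" where
  "nat_coeffs F \<longleftrightarrow> (\<forall>n. fps_nth F n \<in> \<nat>)"

lemma sum_in_Nats: "(\<And>i. i \<in> A \<Longrightarrow> f i \<in> \<nat>) \<Longrightarrow> sum f A \<in> (\<nat> :: 'a :: semiring_1 set)"
  by (induction A rule: infinite_finite_induct) auto

lemma nat_coeffs_mult: "nat_coeffs F \<Longrightarrow> nat_coeffs G \<Longrightarrow> nat_coeffs (F * G)"
  by (auto simp: nat_coeffs_def fps_mult_nth intro!: sum_in_Nats Nats_mult)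

lemma nat_coeffs_1: "nat_coeffs 1"
  by (simp add: nat_coeffs_def)

lemma nat_coeffs_add: "nat_coeffs F \<Longrightarrow> nat_coeffs G \<Longrightarrow> nat_coeffs (F + G)"
  by (auto simp: nat_coeffs_def)

lemma nat_coeffs_power: "nat_coeffs F \<Longrightarrow> nat_coeffs (F ^ n)"
  by (induction n) (auto simp: nat_coeffs_1 nat_coeffs_mult)

lemma nat_coeffs_prod: "(\<And>i. i \<in> A \<Longrightarrow> nat_coeffs (F i)) \<Longrightarrow> nat_coeffs (\<Prod>i\<in>A. F i)"
  by (induction A rule: infinite_finite_induct) (auto simp: nat_coeffs_1 nat_coeffs_mult)

text \<open>The equation g = 1 + X^m g computes each coefficient from an earlier one.\<close>

lemma nat_coeffs_inverse_one_minus_X_power: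
  assumes "m > 0"
  shows "nat_coeffs (inverse (1 - fps_X ^ m))"
proof -
  define g where "g = (inverse (1 - fps_X ^ m) :: complex fps)"
  have "fps_nth (1 - fps_X ^ m :: complex fps) 0 \<noteq> 0" using assms by (simp add: fps_X_power_nth)
  then have "(1 - fps_X ^ m) * g = 1" unfolding g_def by (rule inverse_mult_eq_1')
  then have g: "g = 1 + fps_X ^ m * g" by (simp add: algebra_simps)
  have "fps_nth g n \<in> \<nat>" for n
  proof (induction n rule: less_induct)
    case (less n)
    have "fps_nth g n = fps_nth (1 + fps_X ^ m * g) n" using g by simp
    also have "\<dots> = (if n = 0 then 1 else 0) + (if n < m then 0 else fps_nth g (n - m))"
      by (simp add: fps_X_power_mult_nth)
    also have "\<dots> \<in> \<nat>" using less[of "n - m"] assms by auto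
    finally show ?case .
  qed
  then show ?thesis by (simp add: nat_coeffs_def g_def)
qed

lemma closed_Nats_complex: "closed (\<nat> :: complex set)"
proof -
  have "(\<nat> :: complex set) = \<int> \<inter> {z. Re z \<ge> 0}"
    by (auto elim!: Ints_cases Nats_cases) (metis nat_0_le of_int_of_nat_eq of_nat_in_Nats)
  then show ?thesis by (simp add: closed_Int closed_Ints closed_halfspace_Re_ge)
qed

text \<open>The generating function of partitions, introduced as a Taylor expansion so that
  identities between functions carry over to the coefficients.\<close>

definition partition_fps :: "complex fps" where
  "partition_fps = fps_expansion (\<lambda>q. inverse (euler_product q)) 0"

lemma ball_1_eventually: "eventually (\<lambda>q :: complex. norm q < 1) (nhds 0)"
  using eventually_nhds_in_open[of "ball 0 1" "0 :: complex"] by simp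

lemma inverse_euler_product_holomorphic: "(\<lambda>q. inverse (euler_product q)) holomorphic_on ball 0 1"
  using euler_product_props(2) by (intro holomorphic_intros euler_product_holomorphic) auto

lemma partition_fps_expansion: "(\<lambda>q. inverse (euler_product q)) has_fps_expansion partition_fps"
  unfolding partition_fps_def
  by (rule has_fps_expansion_fps_expansion[OF _ _ inverse_euler_product_holomorphic]) auto

lemma euler_product_0: "euler_product 0 = 1"
  using LIMSEQ_unique[OF euler_product_props(1)[of 0]] by simp

lemma partition_fps_nth_0: "fps_nth partition_fps 0 = 1"
  using fps_nth_fps_expansion[OF partition_fps_expansion, of 0] by (simp add: euler_product_0)

text \<open>The finite products have natural Taylor coefficients; by uniform convergence near 0
  these tend to the coefficients of the infinite product, and the naturals are closed in the complex
  plane.\<close>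

lemma nat_coeffs_partition_fps: "nat_coeffs partition_fps"
  unfolding nat_coeffs_def
proof
  fix m
  define f where "f N q = inverse (\<Prod>k<N. 1 - q ^ Suc k)" for N and q :: complex
  define F where "F N = (\<Prod>k<N. inverse (1 - fps_X ^ Suc k) :: complex fps)" for N
  have "continuous_on (cball 0 (1/2)) euler_product"
    using holomorphic_on_imp_continuous_on[OF euler_product_holomorphic] by (rule continuous_on_subset) auto
  then have "continuous_on (cball 0 (1/2)) (\<lambda>q. norm (euler_product q))" by (intro continuous_intros)
  \<comment> \<open>The minimum of the modulus on a compact disc is positive; bounded away from 0,
    the limit lets uniform convergence pass to the reciprocals.\<close>
  then obtain x where x: "x \<in> cball 0 (1/2)" "\<And>q. q \<in> cball 0 (1/2) \<Longrightarrow> norm (euler_product x) \<le> norm (euler_product q)"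
    using continuous_attains_inf[of "cball 0 (1/2)" "\<lambda>q. norm (euler_product q)"] by auto
  have b: "norm (euler_product x) > 0" using euler_product_props(2)[of x] x by auto
  have "uniform_limit (cball 0 (1/2)) (\<lambda>N q. inverse (\<Prod>k<N. 1 - q ^ Suc k)) (inverse \<circ> euler_product) sequentially"
    by (rule uniform_lim_inverse[OF euler_product_uniform_limit x(2) b]) auto
  then have ul: "uniform_limit (ball 0 (1/2)) f (\<lambda>q. inverse (euler_product q)) sequentially"
    unfolding f_def o_def by (rule uniform_limit_on_subset) auto
  have nz: "(\<Prod>k<N. 1 - q ^ Suc k) \<noteq> 0" if "q \<in> ball 0 (1/2)" for N and q :: complex
    using one_minus_power_nonzero[of q] that by (auto simp: prod_zero_iff)
  have "(\<lambda>N. (deriv ^^ m) (f N) 0) \<longlonglongrightarrow> (deriv ^^ m) (\<lambda>q. inverse (euler_product q)) 0"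
  proof (rule higher_deriv_complex_uniform_limit[OF ul])
    show "\<forall>\<^sub>F N in sequentially. f N holomorphic_on ball 0 (1/2)"
      unfolding f_def using nz by (intro always_eventually allI holomorphic_intros) blast
  qed auto
  then have lim: "(\<lambda>N. (deriv ^^ m) (f N) 0 / fact m) \<longlonglongrightarrow> (deriv ^^ m) (\<lambda>q. inverse (euler_product q)) 0 / fact m"
    by (intro tendsto_intros) auto
  have exp: "f N has_fps_expansion F N" for N
  proof -
    have "(\<lambda>q. \<Prod>k<N. inverse (1 - q ^ Suc k)) has_fps_expansion F N"
      unfolding F_def by (intro fps_expansion_intros) (simp add: fps_X_power_nth)
    moreover have "f N = (\<lambda>q. \<Prod>k<N. inverse (1 - q ^ Suc k))"
      using prod_inversef[of "\<lambda>k. 1 - q ^ Suc k" "{..<N}" for q :: complex] by (simp add: f_def o_def fun_eq_iff)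
    ultimately show ?thesis by simp
  qed
  have "(deriv ^^ m) (f N) 0 / fact m = fps_nth (F N) m" for N
    by (rule fps_nth_fps_expansion[OF exp, symmetric])
  moreover have "nat_coeffs (F N)" for N
    unfolding F_def by (intro nat_coeffs_prod nat_coeffs_inverse_one_minus_X_power) auto
  ultimately have "(deriv ^^ m) (f N) 0 / fact m \<in> \<nat>" for N by (simp add: nat_coeffs_def)
  then have "(deriv ^^ m) (\<lambda>q. inverse (euler_product q)) 0 / fact m \<in> \<nat>"
    using closed_sequentially[OF closed_Nats_complex _ lim] by blast
  then show "fps_nth partition_fps m \<in> \<nat>"
    by (simp add: fps_nth_fps_expansion[OF partition_fps_expansion])
qed

definition divisor_fps :: "nat \<Rightarrow> complex fps" where
  "divisor_fps k = Abs_fps (\<lambda>n. if n = 0 then 0 else of_nat (\<Sum>d | d dvd n. d ^ k))"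

lemma divisor_fps_sums:
  assumes q: "norm q < 1"
  shows "(\<lambda>n. fps_nth (divisor_fps k) n * q ^ n) sums divisor_series k q"
  using lambert_series_has_sum(2)[OF q, of k] sums_Suc_iff[of "\<lambda>n. fps_nth (divisor_fps k) n * q ^ n"]
  by (simp add: divisor_fps_def)

lemma divisor_series_expansion: "divisor_series k has_fps_expansion divisor_fps k"
  by (intro has_fps_expansionI eventually_mono[OF ball_1_eventually] divisor_fps_sums)

lemma divisor_series_holomorphic: "divisor_series k holomorphic_on ball 0 1"
  using divisor_fps_sums by (intro power_series_holomorphic) simp

lemma nat_coeffs_divisor_fps: "nat_coeffs (divisor_fps k)"
  by (simp add: nat_coeffs_def divisor_fps_def del: of_nat_sum)

definition delta_inverse_fps :: "complex fps" where
  "delta_inverse_fps = partition_fps ^ 24"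

text \<open>Reads the coefficient of a series with \<open>nat_coeffs\<close> on type nat, where the
  later congruences and inequalities live.\<close>

definition nat_coeff :: "complex fps \<Rightarrow> nat \<Rightarrow> nat" where
  "nat_coeff F n = nat \<lfloor>Re (fps_nth F n)\<rfloor>"

lemma of_nat_coeff: "nat_coeffs F \<Longrightarrow> of_nat (nat_coeff F n) = fps_nth F n"
  unfolding nat_coeffs_def nat_coeff_def by (auto elim!: allE[of _ n] Nats_cases)

lemma nat_coeffs_delta_inverse: "nat_coeffs delta_inverse_fps"
  unfolding delta_inverse_fps_def by (intro nat_coeffs_power nat_coeffs_partition_fps)

text \<open>With h the 24th power of the reciprocal Euler product, q h' / h is 24 times the divisor
  series; both sides are expansions of the same function at 0.\<close>

lemma delta_inverse_recursion_fps:
  "fps_X * fps_deriv delta_inverse_fps = 24 * divisor_fps 1 * delta_inverse_fps"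
proof -
  define h where "h = (\<lambda>q. inverse (euler_product q) ^ 24)"
  have h: "h has_fps_expansion delta_inverse_fps"
    unfolding h_def delta_inverse_fps_def by (intro has_fps_expansion_power partition_fps_expansion)
  have L: "(\<lambda>q. q * deriv h q) has_fps_expansion fps_X * fps_deriv delta_inverse_fps"
    by (intro fps_expansion_intros h)
  have R: "(\<lambda>q. 24 * divisor_series 1 q * h q) has_fps_expansion 24 * divisor_fps 1 * delta_inverse_fps"
    by (intro fps_expansion_intros h divisor_series_expansion)
  have eq: "q * deriv h q = 24 * divisor_series 1 q * h q" if q: "norm q < 1" for q
  proof -
    define e where "e = euler_product q"
    define e' where "e' = deriv euler_product q"
    have e0: "e \<noteq> 0" using euler_product_props(2)[OF q] by (simp add: e_def)
    have d: "(euler_product has_field_derivative e') (at q)"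
      using holomorphic_derivI[OF euler_product_holomorphic, of q UNIV] q by (simp add: e'_def)
    have "(h has_field_derivative (of_nat 24 * (- (inverse e * e' * inverse e) * inverse e ^ (24 - Suc 0)))) (at q)"
      unfolding h_def using DERIV_power[OF DERIV_inverse_fun[OF d], of 24] e0 by (simp add: e_def mult_ac)
    then have "deriv h q = - 24 * (e' / e) * (inverse e * inverse e ^ 23)"
      by (subst DERIV_imp_deriv) (auto simp: divide_inverse mult_ac)
    also have "inverse e * inverse e ^ 23 = inverse e ^ 24" by (simp flip: power_Suc)
    finally have "q * deriv h q = - 24 * (q * e' / e) * inverse e ^ 24" by simp
    also have "q * e' / e = - divisor_series 1 q"
      using euler_product_logderiv[OF q] by (simp add: e_def e'_def)
    finally show ?thesis by (simp add: h_def e_def)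
  qed
  have "(\<lambda>q. 24 * divisor_series 1 q * h q) has_fps_expansion fps_X * fps_deriv delta_inverse_fps"
    using L by (rule has_fps_expansion_cong[THEN iffD1, rotated 2]) (use eventually_mono[OF ball_1_eventually eq] in auto)
  then show ?thesis using R by (metis fps_expansion_eqI)
qed

lemma delta_inverse_recursion:
  fixes n :: nat
  defines "p \<equiv> nat_coeff delta_inverse_fps"
  shows "n * p n = 24 * (\<Sum>i=1..n. (\<Sum>d | d dvd i. d) * p (n - i))"
proof -
  note p = of_nat_coeff[OF nat_coeffs_delta_inverse, folded p_def, symmetric]
  have "complex_of_nat (n * p n) = fps_nth (fps_X * fps_deriv delta_inverse_fps) n"
    by (cases n) (simp_all add: p algebra_simps)
  also have "\<dots> = 24 * (\<Sum>i=0..n. fps_nth (divisor_fps 1) i * fps_nth delta_inverse_fps (n - i))"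
  proof -
    have eq: "24 * divisor_fps 1 * delta_inverse_fps = fps_const 24 * (divisor_fps 1 * delta_inverse_fps)"
      by (simp add: numeral_fps_const mult.assoc)
    show ?thesis unfolding delta_inverse_recursion_fps eq by (subst fps_mult_left_const_nth) (simp only: fps_mult_nth)
  qed
  also have "(\<Sum>i=0..n. fps_nth (divisor_fps 1) i * fps_nth delta_inverse_fps (n - i)) =
      (\<Sum>i=1..n. of_nat ((\<Sum>d | d dvd i. d) * p (n - i)))"
  proof (rule sum.mono_neutral_cong_right)
    show "\<forall>i\<in>{0..n} - {1..n}. fps_nth (divisor_fps 1) i * fps_nth delta_inverse_fps (n - i) = 0"
      by (auto simp: divisor_fps_def)
  qed (auto simp: divisor_fps_def p)
  finally have "complex_of_nat (n * p n) = of_nat (24 * (\<Sum>i=1..n. (\<Sum>d | d dvd i. d) * p (n - i)))" by simp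
  then show ?thesis by (simp only: of_nat_eq_iff)
qed

text \<open>The recursion is used twice, with sigma(i) >= i. A single term gives p j <= p t for 3 k
  / 4 <= t <= k, because then t - j >= t / 3. The m = k div 4 terms whose index k - i lies in this
  range then give 12 m (m + 1) p j <= k p k, and k <= 4 (m + 1) finishes.\<close>

lemma delta_inverse_growth:
  defines "p \<equiv> nat_coeff delta_inverse_fps"
  assumes jk: "2 * j \<le> k"
  shows "3 * (k div 4) * p j \<le> p k"
proof (cases "k = 0")
  case True
  then show ?thesis by simp
next
  case False
  note rec = delta_inverse_recursion[folded p_def]
  have sig: "i \<le> (\<Sum>d | d dvd i. d)" if "i > 0" for i :: nat
    using that by (intro member_le_sum[of i _ "\<lambda>d. d", simplified]) auto
  have single: "24 * (t - j) * p j \<le> t * p t" if t: "j < t" for t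
  proof -
    have "(t - j) * p j \<le> (\<Sum>d | d dvd (t - j). d) * p (t - (t - j))"
      using t sig[of "t - j"] by (intro mult_mono) auto
    also have "\<dots> \<le> (\<Sum>i=1..t. (\<Sum>d | d dvd i. d) * p (t - i))"
      by (rule member_le_sum[of "t - j" "{1..t}" "\<lambda>i. (\<Sum>d | d dvd i. d) * p (t - i)"]) (use t in auto)
    finally show ?thesis using rec[of t] by simp
  qed
  have mono: "p j \<le> p t" if t: "3 * k \<le> 4 * t" "t \<le> k" for t
  proof -
    have "j < t" "t > 0" using jk t False by linarith+
    have "t * p j \<le> 24 * (t - j) * p j" using jk t by (intro mult_right_mono) linarith+
    also have "\<dots> \<le> t * p t" using single \<open>j < t\<close> by simp
    finally show ?thesis using \<open>t > 0\<close> by simp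
  qed
  define m where "m = k div 4"
  have "(\<Sum>i=1..m. i * p j) \<le> (\<Sum>i=1..m. (\<Sum>d | d dvd i. d) * p (k - i))"
  proof (intro sum_mono mult_mono)
    fix i assume i: "i \<in> {1..m}"
    then have "4 * i \<le> k" by (auto simp: m_def)
    then show "p j \<le> p (k - i)" by (intro mono) auto
  qed (use sig in auto)
  also have "\<dots> \<le> (\<Sum>i=1..k. (\<Sum>d | d dvd i. d) * p (k - i))"
    by (intro sum_mono2) (auto simp: m_def)
  finally have "24 * (\<Sum>i=1..m. i * p j) \<le> k * p k" using rec[of k] by simp
  moreover have "2 * (\<Sum>i=1..m. i * p j) = m * (m + 1) * p j"
    by (induction m) (auto simp: algebra_simps)
  ultimately have "12 * (m * (m + 1) * p j) \<le> k * p k" by linarith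
  moreover have "k * (3 * m * p j) \<le> (4 * (m + 1)) * (3 * m * p j)"
    by (intro mult_right_mono) (auto simp: m_def)
  moreover have "12 * (m * (m + 1) * p j) = (4 * (m + 1)) * (3 * m * p j)" by (simp add: algebra_simps)
  ultimately have "k * (3 * m * p j) \<le> k * p k" by linarith
  then show ?thesis using False by (simp add: m_def)
qed

text \<open>The expansion of q j instead of j, a power series without a pole; the coefficient of q^n
  in j has index n + 1 here.\<close>

definition j_fps :: "complex fps" where
  "j_fps = (1 + 240 * divisor_fps 3) ^ 3 * delta_inverse_fps"

definition j_function :: "complex \<Rightarrow> complex" where
  "j_function q = (1 + 240 * divisor_series 3 q) ^ 3 * inverse (euler_product q) ^ 24"

lemma nat_coeffs_Eisenstein4_cube: "nat_coeffs ((1 + 240 * divisor_fps 3) ^ 3)"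
proof -
  have "nat_coeffs (240 :: complex fps)"
    by (auto simp: nat_coeffs_def numeral_fps_const)
  then show ?thesis by (intro nat_coeffs_power nat_coeffs_add nat_coeffs_mult nat_coeffs_1 nat_coeffs_divisor_fps)
qed

lemma nat_coeffs_j_fps: "nat_coeffs j_fps"
  unfolding j_fps_def by (intro nat_coeffs_mult nat_coeffs_Eisenstein4_cube nat_coeffs_delta_inverse)

lemma j_function_expansion: "j_function has_fps_expansion j_fps"
  unfolding j_function_def[abs_def] j_fps_def delta_inverse_fps_def
  by (intro fps_expansion_intros has_fps_expansion_power divisor_series_expansion partition_fps_expansion)

lemma j_function_holomorphic: "j_function holomorphic_on ball 0 1"
  unfolding j_function_def[abs_def]
  by (intro holomorphic_intros divisor_series_holomorphic inverse_euler_product_holomorphic)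

lemma j_function_sums:
  assumes "norm q < 1"
  shows "(\<lambda>n. of_nat (nat_coeff j_fps n) * q ^ n) sums j_function q"
  using holomorphic_power_series[OF j_function_holomorphic, of q] assms
  by (simp add: of_nat_coeff[OF nat_coeffs_j_fps] fps_nth_fps_expansion[OF j_function_expansion])

text \<open>Convolution with natural numbers preserves the growth. The index k - i is at least k / 2
  because i <= j, so the factor k div 4 weakens to k div 8.\<close>

lemma j_fps_growth:
  assumes jk: "2 * j \<le> k"
  shows "3 * (k div 8) * nat_coeff j_fps j \<le> nat_coeff j_fps k"
proof -
  define s where "s = nat_coeff ((1 + 240 * divisor_fps 3) ^ 3)"
  define p where "p = nat_coeff delta_inverse_fps"
  have conv: "nat_coeff j_fps n = (\<Sum>i=0..n. s i * p (n - i))" for n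
  proof -
    have "complex_of_nat (nat_coeff j_fps n) = fps_nth j_fps n"
      by (rule of_nat_coeff[OF nat_coeffs_j_fps])
    also have "\<dots> = of_nat (\<Sum>i=0..n. s i * p (n - i))"
      by (simp add: s_def p_def of_nat_coeff[OF nat_coeffs_Eisenstein4_cube]
          of_nat_coeff[OF nat_coeffs_delta_inverse] j_fps_def fps_mult_nth)
    finally have "complex_of_nat (nat_coeff j_fps n) = of_nat (\<Sum>i=0..n. s i * p (n - i))" .
    then show ?thesis by (simp only: of_nat_eq_iff)
  qed
  have "3 * (k div 8) * nat_coeff j_fps j = (\<Sum>i=0..j. s i * (3 * (k div 8) * p (j - i)))"
    by (simp add: conv sum_distrib_left mult_ac)
  also have "\<dots> \<le> (\<Sum>i=0..j. s i * p (k - i))"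
  proof (intro sum_mono mult_left_mono)
    fix i assume i: "i \<in> {0..j}"
    have "3 * (k div 8) * p (j - i) \<le> 3 * ((k - i) div 4) * p (j - i)"
      using i jk by (intro mult_right_mono mult_left_mono) auto
    also have "\<dots> \<le> p (k - i)" unfolding p_def by (rule delta_inverse_growth) (use i jk in auto)
    finally show "3 * (k div 8) * p (j - i) \<le> p (k - i)" .
  qed auto
  also have "\<dots> \<le> (\<Sum>i=0..k. s i * p (k - i))" using jk by (intro sum_mono2) auto
  finally show ?thesis by (simp add: conv)
qed

lemma j_fps_initial: "nat_coeff j_fps 0 = 1" "nat_coeff j_fps 1 = 744"
proof -
  have d0: "fps_nth delta_inverse_fps 0 = 1"
    by (simp add: delta_inverse_fps_def partition_fps_nth_0 fps_power_zeroth)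
  then have p0: "nat_coeff delta_inverse_fps 0 = 1" by (simp add: nat_coeff_def)
  have "nat_coeff delta_inverse_fps 1 = 24" using delta_inverse_recursion[of 1] p0 by simp
  then have d1: "fps_nth delta_inverse_fps 1 = 24"
    using of_nat_coeff[OF nat_coeffs_delta_inverse, of 1] by simp
  define E where "E = 1 + 240 * divisor_fps 3"
  have E: "fps_nth E 0 = 1" "fps_nth E 1 = 240"
    by (simp_all add: E_def divisor_fps_def fps_mult_nth numeral_fps_const)
  have "fps_nth (E ^ 3) 0 = 1" "fps_nth (E ^ 3) 1 = 720"
    using E by (simp_all add: power3_eq_cube fps_mult_nth)
  then have "fps_nth j_fps 0 = 1" "fps_nth j_fps 1 = 744"
    using d0 d1 by (simp_all add: j_fps_def E_def[symmetric] fps_mult_nth)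
  then show "nat_coeff j_fps 0 = 1" "nat_coeff j_fps 1 = 744" by (simp_all add: nat_coeff_def)
qed

definition J_coeff :: "int \<Rightarrow> nat" where
  "J_coeff n = (if n = 0 \<or> n < -1 then 0 else nat_coeff j_fps (nat (n + 1)))"

lemma J_coeff_simps: "J_coeff (-1) = 1" "J_coeff 0 = 0" "n < -1 \<Longrightarrow> J_coeff n = 0"
  by (simp_all add: J_coeff_def j_fps_initial)

text \<open>The index shift by one: 4 j <= k and k >= 2 give 2 (j + 1) <= k + 1, and j > 0 keeps
  away from the removed constant term.\<close>

lemma J_coeff_growth:
  fixes j k :: int
  assumes "4 * j \<le> k" "k \<ge> 2" "j > 0"
  shows "3 * (nat (k + 1) div 8) * J_coeff j \<le> J_coeff k"
  using j_fps_growth[of "nat (j + 1)" "nat (k + 1)"] assms by (auto simp: J_coeff_def)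

text \<open>The growth bound against the leading coefficient 1 is positive once k + 1 >= 8.\<close>

lemma J_coeff_pos:
  fixes k :: int
  assumes "k \<ge> 7"
  shows "J_coeff k > 0"
proof -
  have "8 div 8 \<le> nat (k + 1) div 8" using assms by (intro div_le_mono) auto
  then have "3 * (nat (k + 1) div 8) * 1 > 0" by simp
  then show ?thesis using j_fps_growth[of 0 "nat (k + 1)"] assms by (auto simp: J_coeff_def j_fps_initial)
qed

lemma J_q_expansion:
  assumes t: "Im t > 0"
  shows "((\<lambda>n. of_nat (J_coeff n) * nome t powi n) has_sum J_invariant t) UNIV"
proof -
  define q where "q = nome t"
  have q: "norm q < 1" and q0: "q \<noteq> 0" using norm_nome_less_1[OF t] by (auto simp: q_def)
  define c where "c = nat_coeff j_fps"
  have sq: "(\<lambda>n. of_nat (c n) * q ^ n) sums j_function q" unfolding c_def by (rule j_function_sums[OF q])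
  have "summable (\<lambda>n. complex_of_real (of_nat (c n) * norm q ^ n))"
    using sums_summable[OF j_function_sums[of "of_real (norm q)"]] q by (simp add: c_def)
  then have "summable (\<lambda>n. norm (of_nat (c n) * q ^ n))"
    by (subst (asm) summable_of_real_iff) (simp add: norm_mult norm_power)
  then have "((\<lambda>n. of_nat (c n) * q ^ n) has_sum j_function q) UNIV"
    using sq by (rule norm_summable_imp_has_sum)
  then have "((\<lambda>n. inverse q * (of_nat (c n) * q ^ n)) has_sum (inverse q * j_function q)) UNIV"
    by (rule has_sum_cmult_right)
  moreover have "inverse q * (of_nat (c n) * q ^ n) = of_nat (c n) * q powi (int n - 1)" for n
    using q0 by (simp add: power_int_diff divide_inverse mult_ac)
  ultimately have 1: "((\<lambda>n. of_nat (c n) * q powi (int n - 1)) has_sum (inverse q * j_function q)) UNIV" by simp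
  have bij: "bij_betw (\<lambda>n. int n - 1) UNIV {-1..}"
    by (rule bij_betwI[where g = "\<lambda>x. nat (x + 1)"]) auto
  have "((\<lambda>n. of_nat (c (nat (n + 1))) * q powi n) has_sum (inverse q * j_function q)) {-1..}"
    by (subst has_sum_reindex_bij_betw[OF bij, symmetric]) (use 1 in simp)
  \<comment> \<open>The constant 744 as a series supported at n = 0, to be subtracted
    termwise.\<close>
  moreover have "((\<lambda>n::int. if n = 0 then 744 else 0 :: complex) has_sum 744) {-1..}"
    by (subst has_sum_cong_neutral[where T = "{0}" and g = "\<lambda>_. 744"]) (auto intro!: has_sum_finiteI)
  ultimately have "((\<lambda>n. of_nat (c (nat (n + 1))) * q powi n - (if n = 0 then 744 else 0)) has_sum
      (inverse q * j_function q - 744)) {-1..}" by (rule has_sum_difference)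
  then have "((\<lambda>n. of_nat (J_coeff n) * q powi n) has_sum (inverse q * j_function q - 744)) UNIV"
    by (subst has_sum_cong_neutral[where T = "{-1..}" and g = "\<lambda>n. of_nat (c (nat (n + 1))) * q powi n - (if n = 0 then 744 else 0)"])
       (auto simp: J_coeff_def c_def j_fps_initial(2)[unfolded One_nat_def])
  moreover have "inverse q * j_function q - 744 = J_invariant t"
    unfolding J_invariant_def modular_discriminant_euler[OF t] Eisenstein4_divisor_series
    by (simp add: j_function_def q_def divide_inverse power_inverse mult_ac)
  ultimately show ?thesis by (simp add: q_def)
qed

lemma J_invariant_holomorphic: "J_invariant holomorphic_on upper_half_plane"
proof -
  have nm: "nome holomorphic_on upper_half_plane" unfolding nome_def[abs_def] by (intro holomorphic_intros)
  have im: "nome ` upper_half_plane \<subseteq> ball 0 1"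
    using norm_nome_less_1 by (auto simp: upper_half_plane_def)
  have "(\<lambda>t. inverse (nome t) * (j_function \<circ> nome) t - 744) holomorphic_on upper_half_plane"
    by (intro holomorphic_intros nm holomorphic_on_compose_gen[OF nm j_function_holomorphic im]) auto
  moreover have "inverse (nome t) * (j_function \<circ> nome) t - 744 = J_invariant t" if "t \<in> upper_half_plane" for t
    using that unfolding J_invariant_def upper_half_plane_def
    by (simp add: modular_discriminant_euler Eisenstein4_divisor_series j_function_def divide_inverse power_inverse mult_ac)
  ultimately show ?thesis using holomorphic_transform by blast
qed

section \<open>Weighted Hecke sums\<close>

type_synonym mat2 = "int \<times> int \<times> int \<times> int"

text \<open>Quadruples list the entries row by row, so that identities between products,
  determinants and adjugates unfold to polynomial ones; the matrices of \<open>Gamma0\<close> are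
  converted only when the level is established.\<close>

fun mat2_mult :: "mat2 \<Rightarrow> mat2 \<Rightarrow> mat2" (infixl "\<star>" 70) where
  "(a, b, c, d) \<star> (a', b', c', d') = (a * a' + b * c', a * b' + b * d', c * a' + d * c', c * b' + d * d')"

fun mat2_det :: "mat2 \<Rightarrow> int" where
  "mat2_det (a, b, c, d) = a * d - b * c"

fun mat2_adj :: "mat2 \<Rightarrow> mat2" where
  "mat2_adj (a, b, c, d) = (d, - b, - c, a)"

fun mat2_act :: "mat2 \<Rightarrow> complex \<Rightarrow> complex" where
  "mat2_act (a, b, c, d) t = (of_int a * t + of_int b) / (of_int c * t + of_int d)"

lemma mat2_mult_assoc: "A \<star> B \<star> C = A \<star> (B \<star> C)"
  by (cases A; cases B; cases C) (simp add: algebra_simps)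

lemma mat2_det_mult: "mat2_det (A \<star> B) = mat2_det A * mat2_det B"
  by (cases A; cases B) (simp add: algebra_simps)

lemma mat2_det_adj [simp]: "mat2_det (mat2_adj A) = mat2_det A"
  by (cases A) simp

lemma mat2_one_mult [simp]: "(1, 0, 0, 1) \<star> A = A" "A \<star> (1, 0, 0, 1) = A"
  by (cases A, simp)+

lemma mat2_adj_mult: "mat2_det A = 1 \<Longrightarrow> mat2_adj A \<star> A = (1, 0, 0, 1)"
  "mat2_det A = 1 \<Longrightarrow> A \<star> mat2_adj A = (1, 0, 0, 1)"
  by (cases A, simp add: algebra_simps)+

lemma denominator_nonzero:
  assumes "a * d - b * c \<noteq> (0 :: int)" "Im t > 0"
  shows "of_int c * t + of_int d \<noteq> (0 :: complex)"
proof
  assume 0: "of_int c * t + of_int d = (0 :: complex)"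
  then have "Im (of_int c * t + of_int d) = 0" by simp
  then have "c = 0" using assms by simp
  then have "d = 0" using 0 by simp
  then show False using assms \<open>c = 0\<close> by simp
qed

lemma Im_mat2_act:
  assumes A: "mat2_det A > 0" and t: "Im t > 0"
  shows "Im (mat2_act A t) > 0"
proof -
  obtain a b c d where A': "A = (a, b, c, d)" by (cases A)
  have det: "a * d - b * c > 0" using A A' by simp
  define z where "z = of_int c * t + of_int d"
  have z: "z \<noteq> 0" unfolding z_def using denominator_nonzero[of a d b c t] det t by simp
  have "mat2_act A t = (of_int a * t + of_int b) / z" by (simp add: A' z_def)
  also have "\<dots> = (of_int a * t + of_int b) * cnj z / of_real ((norm z)\<^sup>2)"
    by (subst complex_div_cnj) simp
  finally have "mat2_act A t = (of_int a * t + of_int b) * cnj z / of_real ((norm z)\<^sup>2)" .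
  then have "Im (mat2_act A t) = Im ((of_int a * t + of_int b) * cnj z) / (norm z)\<^sup>2"
    by (simp only: Im_divide_of_real)
  also have "Im ((of_int a * t + of_int b) * cnj z) = of_int (a * d - b * c) * Im t"
    by (simp add: z_def algebra_simps)
  finally have "Im (mat2_act A t) = of_int (a * d - b * c) * Im t / (norm z)\<^sup>2" .
  moreover have "real_of_int (a * d - b * c) * Im t > 0"
    using det t by (intro mult_pos_pos) (simp_all only: of_int_0_less_iff)
  ultimately show ?thesis using z by simp
qed

lemma mat2_act_mult:
  assumes "mat2_det B \<noteq> 0" "Im t > 0"
  shows "mat2_act (A \<star> B) t = mat2_act A (mat2_act B t)"
proof -
  obtain a b c d where A: "A = (a, b, c, d)" by (cases A)
  obtain p q r s where B: "B = (p, q, r, s)" by (cases B)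
  define z where "z = of_int r * t + of_int s"
  define n where "n = of_int p * t + of_int q"
  have z: "z \<noteq> 0" unfolding z_def using denominator_nonzero[of p s q r t] assms B by simp
  have 1: "of_int a * (n / z) + of_int b = (of_int a * n + of_int b * z) / z"
    and 2: "of_int c * (n / z) + of_int d = (of_int c * n + of_int d * z) / z" using z by (simp_all add: field_simps)
  have "mat2_act A (mat2_act B t) = (of_int a * (n / z) + of_int b) / (of_int c * (n / z) + of_int d)"
    by (simp add: A B n_def z_def)
  also have "\<dots> = (of_int a * n + of_int b * z) / (of_int c * n + of_int d * z)" unfolding 1 2 using z by simp
  finally show ?thesis by (simp add: A B n_def z_def algebra_simps)
qed

text \<open>Euclid's algorithm on the first column: a translation reduces a modulo c and the
  inversion exchanges the rows, so the lower left entry decreases in absolute value until it is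
  0.\<close>

lemma J_invariant_SL2:
  assumes "a * d - b * c = 1" "Im t > 0"
  shows "J_invariant (mat2_act (a, b, c, d) t) = J_invariant t"
  using assms
proof (induction "nat \<bar>c\<bar>" arbitrary: a b c d t rule: less_induct)
  case less
  show ?case
  proof (cases "c = 0")
    case True
    then have ad: "a * d = 1" using less.prems by simp
    then have "(a = 1 \<and> d = 1) \<or> (a = -1 \<and> d = -1)" by (simp add: zmult_eq_1_iff)
    then have "mat2_act (a, b, c, d) t = t + of_int (b * d)" using True by auto
    then show ?thesis by (simp only: J_invariant_T)
  next
    case False
    define k where "k = a div c"
    define w where "w = mat2_act (a - k * c, b - k * d, c, d) t"
    have det: "(a - k * c) * d - (b - k * d) * c = 1" using less.prems by (simp add: algebra_simps)
    have z: "of_int c * t + of_int d \<noteq> 0" by (rule denominator_nonzero[of a d b c]) (use less.prems in auto)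
    have imw: "Im w > 0" unfolding w_def by (rule Im_mat2_act) (use det less.prems in auto)
    have 1: "mat2_act (a, b, c, d) t = w + of_int k"
      using z by (simp add: w_def field_simps)
    have "a - k * c = a mod c" by (simp add: k_def minus_div_mult_eq_mod)
    then have lt: "nat \<bar>a - k * c\<bar> < nat \<bar>c\<bar>" using False by (simp add: abs_mod_less)
    have "J_invariant (mat2_act (a, b, c, d) t) = J_invariant w" unfolding 1 by (rule J_invariant_T)
    also have "\<dots> = J_invariant (- (1 / w))" using J_invariant_S[OF imw] by simp
    also have "- (1 / w) = mat2_act (- c, - d, a - k * c, b - k * d) t"
      unfolding w_def mat2_act.simps by (simp add: minus_divide_left)
    also have "J_invariant \<dots> = J_invariant t"
      by (rule less.hyps[OF lt]) (use det less.prems in \<open>auto simp: algebra_simps\<close>)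
    finally show ?thesis .
  qed
qed

lemma J_invariant_mat2: "mat2_det A = 1 \<Longrightarrow> Im t > 0 \<Longrightarrow> J_invariant (mat2_act A t) = J_invariant t"
  using J_invariant_SL2 by (cases A) simp

section \<open>Representatives for integral matrices of determinant D\<close>

definition hecke_reps :: "nat \<Rightarrow> (nat \<times> nat \<times> nat) set" where
  "hecke_reps D = {(a, b, d). a * d = D \<and> b < d}"

definition rep_mat :: "nat \<times> nat \<times> nat \<Rightarrow> mat2" where
  "rep_mat = (\<lambda>(a, b, d). (int a, int b, 0, int d))"

lemma det_rep_mat: "x \<in> hecke_reps D \<Longrightarrow> mat2_det (rep_mat x) = int D"
  by (auto simp: hecke_reps_def rep_mat_def)

lemma finite_hecke_reps:
  assumes "D > 0"
  shows "finite (hecke_reps D)"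
proof (rule finite_subset)
  show "hecke_reps D \<subseteq> {..D} \<times> {..D} \<times> {..D}"
  proof
    fix x assume "x \<in> hecke_reps D"
    then obtain a b d where x: "x = (a, b, d)" "a * d = D" "b < d" by (auto simp: hecke_reps_def)
    then have "a dvd D" "d dvd D" by auto
    then have "a \<le> D" "d \<le> D" using assms by (auto intro: dvd_imp_le)
    then show "x \<in> {..D} \<times> {..D} \<times> {..D}" using x by auto
  qed
qed auto

lemma hermite_normal_form:
  assumes D: "mat2_det M = int D" "D > 0"
  obtains B x where "mat2_det B = 1" "x \<in> hecke_reps D" "M = B \<star> rep_mat x"
proof -
  obtain p q r s where M: "M = (p, q, r, s)" by (cases M)
  define a where "a = gcd p r"
  have "p \<noteq> 0 \<or> r \<noteq> 0" using D M by auto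
  then have a: "a > 0" by (auto simp: a_def)
  obtain \<alpha> \<gamma> where pr: "p = \<alpha> * a" "r = \<gamma> * a" "coprime \<alpha> \<gamma>"
    using gcd_coprime_exists[of p r] a unfolding a_def by auto
  obtain u v where uv: "u * \<alpha> + v * \<gamma> = 1"
    using bezout_int[of \<alpha> \<gamma>] pr(3) by (metis coprime_iff_gcd_eq_1)
  \<comment> \<open>\<open>(\<alpha>, -v; \<gamma>, u)\<close> completes the primitive first column; a translation then reduces \<open>b\<close> modulo \<open>d\<close>.\<close>
  define b0 where "b0 = u * q + v * s"
  define d where "d = \<alpha> * s - \<gamma> * q"
  have ad: "a * d = int D" using D M pr by (simp add: d_def algebra_simps)
  then have d: "d > 0" using a D by (metis of_nat_0_less_iff zero_less_mult_pos)
  define k where "k = b0 div d"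
  define b where "b = b0 mod d"
  have b: "0 \<le> b" "b < d" "b0 = k * d + b" using d by (simp_all add: b_def k_def)
  define B where "B = (\<alpha>, - v + k * \<alpha>, \<gamma>, u + k * \<gamma>)"
  have dB: "mat2_det B = 1" using uv by (simp add: B_def algebra_simps)
  define x where "x = (nat a, nat b, nat d)"
  have "nat a * nat d = D" using ad a d by (metis nat_int nat_mult_distrib order_less_imp_le)
  then have x: "x \<in> hecke_reps D" using b by (auto simp: x_def hecke_reps_def)
  have q: "\<alpha> * b0 - v * d = q"
  proof -
    have "\<alpha> * b0 - v * d = (u * \<alpha> + v * \<gamma>) * q" by (simp add: b0_def d_def algebra_simps)
    then show ?thesis using uv by simp
  qed
  have s: "\<gamma> * b0 + u * d = s"
  proof -
    have "\<gamma> * b0 + u * d = (u * \<alpha> + v * \<gamma>) * s" by (simp add: b0_def d_def algebra_simps)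
    then show ?thesis using uv by simp
  qed
  have "M = B \<star> rep_mat x"
    using a d b q s pr unfolding M B_def rep_mat_def x_def b(3) by (simp add: algebra_simps)
  then show ?thesis using that dB x by blast
qed

text \<open>\<open>B\<close> must be upper triangular, positivity of the diagonals makes its
  diagonal entries 1, and then b and b' agree modulo d.\<close>

lemma hermite_unique:
  assumes x: "x \<in> hecke_reps D" "y \<in> hecke_reps D" "D > 0" and B: "mat2_det B = 1" "rep_mat x = B \<star> rep_mat y"
  shows "x = y"
proof -
  obtain a b d where xx: "x = (a, b, d)" "a * d = D" "b < d" using x by (auto simp: hecke_reps_def)
  obtain a' b' d' where yy: "y = (a', b', d')" "a' * d' = D" "b' < d'" using x by (auto simp: hecke_reps_def)
  obtain p q r s where BB: "B = (p, q, r, s)" by (cases B)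
  have pos: "a > 0" "d > 0" "a' > 0" "d' > 0" using xx yy \<open>D > 0\<close> by (auto intro!: Nat.gr0I)
  have e: "int a = p * int a'" "int b = p * int b' + q * int d'" "0 = r * int a'" "int d = r * int b' + s * int d'"
    using B(2) by (simp_all add: xx yy BB rep_mat_def)
  have r: "r = 0" using e(3) pos by simp
  then have "p * s = 1" using B(1) BB by simp
  moreover have "p > 0" using e(1) pos by (metis of_nat_0_less_iff of_nat_0_le_iff not_less zero_less_mult_iff)
  ultimately have ps: "p = 1" "s = 1" by (auto simp: zmult_eq_1_iff)
  then have aa: "a = a'" "d = d'" using e r by auto
  have "int b = int b' + q * int d" using e ps aa by simp
  then have "int b mod int d = int b' mod int d" by simp
  then have "b = b'" using xx yy aa by simp
  then show ?thesis using xx yy aa by simp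
qed

text \<open>Two representatives with the same image differ by a left factor of determinant 1 after
  \<open>A\<close> is cancelled on the right, so they coincide; surjectivity follows from
  finiteness.\<close>

lemma hecke_permutation:
  assumes A: "mat2_det A = 1" and D: "D > 0"
  obtains \<phi> where "bij_betw \<phi> (hecke_reps D) (hecke_reps D)"
    "\<And>x. x \<in> hecke_reps D \<Longrightarrow> \<exists>B. mat2_det B = 1 \<and> rep_mat x \<star> A = B \<star> rep_mat (\<phi> x)"
proof -
  have "\<exists>y. y \<in> hecke_reps D \<and> (\<exists>B. mat2_det B = 1 \<and> rep_mat x \<star> A = B \<star> rep_mat y)" if "x \<in> hecke_reps D" for x
  proof -
    have "mat2_det (rep_mat x \<star> A) = int D" using that A by (simp add: mat2_det_mult det_rep_mat)
    then show ?thesis using hermite_normal_form[of "rep_mat x \<star> A" D] D by metis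
  qed
  then obtain \<phi> where \<phi>: "\<And>x. x \<in> hecke_reps D \<Longrightarrow> \<phi> x \<in> hecke_reps D \<and>
      (\<exists>B. mat2_det B = 1 \<and> rep_mat x \<star> A = B \<star> rep_mat (\<phi> x))" by metis
  have "inj_on \<phi> (hecke_reps D)"
  proof (rule inj_onI)
    fix x y assume xy: "x \<in> hecke_reps D" "y \<in> hecke_reps D" "\<phi> x = \<phi> y"
    obtain B where B: "mat2_det B = 1" "rep_mat x \<star> A = B \<star> rep_mat (\<phi> x)" using \<phi> xy by blast
    obtain C where C: "mat2_det C = 1" "rep_mat y \<star> A = C \<star> rep_mat (\<phi> x)" using \<phi> xy by metis
    have "mat2_adj C \<star> (rep_mat y \<star> A) = rep_mat (\<phi> x)"
      unfolding C(2) mat2_mult_assoc[symmetric] mat2_adj_mult(1)[OF C(1)] by simp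
    then have "rep_mat x \<star> A = B \<star> (mat2_adj C \<star> (rep_mat y \<star> A))" using B by simp
    then have "(rep_mat x \<star> A) \<star> mat2_adj A = (B \<star> (mat2_adj C \<star> (rep_mat y \<star> A))) \<star> mat2_adj A" by simp
    then have "rep_mat x = (B \<star> mat2_adj C) \<star> rep_mat y"
      by (simp add: mat2_mult_assoc mat2_adj_mult(2)[OF A])
    moreover have "mat2_det (B \<star> mat2_adj C) = 1" using B C by (simp add: mat2_det_mult)
    ultimately show "x = y" using hermite_unique[OF xy(1,2) D] by blast
  qed
  moreover have "\<phi> ` hecke_reps D \<subseteq> hecke_reps D" using \<phi> by blast
  ultimately have "bij_betw \<phi> (hecke_reps D) (hecke_reps D)"
    using finite_hecke_reps[OF D] by (simp add: bij_betw_def endo_inj_surj)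
  then show ?thesis using that \<phi> by blast
qed

definition weighted_hecke :: "(nat \<Rightarrow> complex) \<Rightarrow> nat \<Rightarrow> complex \<Rightarrow> complex" where
  "weighted_hecke w D t = (\<Sum>x\<in>hecke_reps D. w (fst x) * J_invariant (mat2_act (rep_mat x) t))"

lemma hecke_eq_weighted: "hecke D J_invariant = weighted_hecke (\<lambda>_. 1) D"
  by (rule ext) (auto simp: hecke_def weighted_hecke_def hecke_reps_def rep_mat_def intro!: sum.cong)

text \<open>The weights stay with x while the matrices move to \<open>\<phi> x\<close>. This holds
  for arbitrary weights, and so it describes the behaviour at every cusp, not only the
  invariance.\<close>

lemma weighted_hecke_act:
  assumes A: "mat2_det A = 1" and D: "D > 0"
    and \<phi>: "\<And>x. x \<in> hecke_reps D \<Longrightarrow> \<exists>B. mat2_det B = 1 \<and> rep_mat x \<star> A = B \<star> rep_mat (\<phi> x)"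
    and in_reps: "\<And>x. x \<in> hecke_reps D \<Longrightarrow> \<phi> x \<in> hecke_reps D"
    and t: "Im t > 0"
  shows "weighted_hecke w D (mat2_act A t) =
           (\<Sum>x\<in>hecke_reps D. w (fst x) * J_invariant (mat2_act (rep_mat (\<phi> x)) t))"
  unfolding weighted_hecke_def
proof (intro sum.cong refl arg_cong2[where f = "(*)"])
  fix x assume x: "x \<in> hecke_reps D"
  obtain B where B: "mat2_det B = 1" "rep_mat x \<star> A = B \<star> rep_mat (\<phi> x)" using \<phi>[OF x] by blast
  have pos: "mat2_det (rep_mat (\<phi> x)) > 0" using det_rep_mat[OF in_reps[OF x]] D by simp
  have "mat2_act (rep_mat x) (mat2_act A t) = mat2_act (rep_mat x \<star> A) t"
    using A t by (simp add: mat2_act_mult)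
  also have "\<dots> = mat2_act B (mat2_act (rep_mat (\<phi> x)) t)"
    unfolding B(2) using pos t by (intro mat2_act_mult) auto
  finally show "J_invariant (mat2_act (rep_mat x) (mat2_act A t)) = J_invariant (mat2_act (rep_mat (\<phi> x)) t)"
    using J_invariant_mat2[OF B(1) Im_mat2_act[OF pos t]] by simp
qed

text \<open>Left multiplication by a matrix of determinant 1 preserves the gcd of the first column,
  and the first column of a representative is (a, 0).\<close>

lemma first_entry_gcd:
  assumes "mat2_det B = 1" "(p, q, r, s) = B \<star> rep_mat (a, b, d)"
  shows "int a = gcd p r"
proof -
  obtain \<alpha> \<beta> \<gamma> \<delta> where B: "B = (\<alpha>, \<beta>, \<gamma>, \<delta>)" by (cases B)
  have "\<alpha> * \<delta> + \<gamma> * (- \<beta>) = 1" using assms(1) B by (simp add: algebra_simps)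
  then have "coprime \<alpha> \<gamma>" by (metis coprimeI dvd_add dvd_mult2)
  then have "gcd (\<alpha> * int a) (\<gamma> * int a) = int a"
    using gcd_mult_distrib_int[of "int a" \<alpha> \<gamma>] by (simp add: mult.commute coprime_iff_gcd_eq_1)
  moreover have "p = \<alpha> * int a" "r = \<gamma> * int a" using assms(2) B by (simp_all add: rep_mat_def)
  ultimately show ?thesis by simp
qed

text \<open>The first column of the product is (a p + b r, d r). As m divides r, its gcd with m is
  that of m and a p, and p is prime to m because p s - q r = 1.\<close>

lemma gcd_first_entry_invariant:
  assumes A: "mat2_det (p, q, r, s) = 1" "int m dvd r" and m: "m dvd D"
    and x: "(a, b, d) \<in> hecke_reps D"
    and B: "mat2_det B = 1" "rep_mat (a, b, d) \<star> (p, q, r, s) = B \<star> rep_mat (a', b', d')"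
  shows "gcd m a' = gcd m a"
proof -
  have "int a' = gcd (int a * p + int b * r) (int d * r)"
    by (rule first_entry_gcd[OF B(1)]) (use B(2) in \<open>simp add: rep_mat_def\<close>)
  then have "gcd (int m) (int a') = gcd (gcd (int m) (int d * r)) (int a * p + int b * r)"
    by (simp add: gcd.assoc gcd.commute gcd.left_commute)
  also have "gcd (int m) (int d * r) = int m" using A(2) by (simp add: gcd_proj1_iff)
  also have "gcd (int m) (int a * p + int b * r) = gcd (int m) (int a * p)"
  proof -
    obtain k where "r = int m * k" using A(2) by (auto elim: dvdE)
    then have "int a * p + int b * r = (int b * k) * int m + int a * p" by (simp add: algebra_simps)
    then show ?thesis by (simp only: gcd_add_mult)
  qed
  also have "\<dots> = gcd (int m) (int a)"
  proof (rule gcd_mult_right_right_cancel)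
    obtain k where k: "r = int m * k" using A(2) by (auto elim: dvdE)
    have "p * s + int m * (- q * k) = 1" using A(1) k by (simp add: algebra_simps)
    then show "coprime (int m) p" by (metis coprimeI dvd_add dvd_mult2)
  qed
  finally show ?thesis by (simp only: gcd_int_int_eq of_nat_eq_iff)
qed

lemma weighted_hecke_invariant:
  assumes A: "mat2_det A = 1" "A = (p, q, r, s)" "int m dvd r" and m: "m dvd D" "D > 0"
    and w: "\<And>a a'. gcd m a = gcd m a' \<Longrightarrow> w a = w a'" and t: "Im t > 0"
  shows "weighted_hecke w D (mat2_act A t) = weighted_hecke w D t"
proof -
  obtain \<phi> where \<phi>: "bij_betw \<phi> (hecke_reps D) (hecke_reps D)"
    "\<And>x. x \<in> hecke_reps D \<Longrightarrow> \<exists>B. mat2_det B = 1 \<and> rep_mat x \<star> A = B \<star> rep_mat (\<phi> x)"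
    using hecke_permutation[OF A(1) m(2)] by blast
  have in_reps: "\<phi> x \<in> hecke_reps D" if "x \<in> hecke_reps D" for x using \<phi>(1) that by (auto simp: bij_betw_def)
  have "weighted_hecke w D (mat2_act A t) =
      (\<Sum>x\<in>hecke_reps D. w (fst x) * J_invariant (mat2_act (rep_mat (\<phi> x)) t))"
    by (rule weighted_hecke_act[OF A(1) m(2) \<phi>(2) in_reps t])
  also have "\<dots> = (\<Sum>x\<in>hecke_reps D. w (fst (\<phi> x)) * J_invariant (mat2_act (rep_mat (\<phi> x)) t))"
  proof (intro sum.cong refl arg_cong2[where f = "(*)"])
    fix x assume x: "x \<in> hecke_reps D"
    obtain B where B: "mat2_det B = 1" "rep_mat x \<star> A = B \<star> rep_mat (\<phi> x)" using \<phi>(2)[OF x] by blast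
    obtain a b d a' b' d' where xx: "x = (a, b, d)" "\<phi> x = (a', b', d')" by (cases x; cases "\<phi> x")
    have "gcd m a' = gcd m a"
      by (rule gcd_first_entry_invariant[of p q r s m D a b d B a' b' d']) (use A m x xx B in auto)
    moreover have "fst x = a" "fst (\<phi> x) = a'" using xx(1) by simp (use xx(2) in simp)
    ultimately show "w (fst x) = w (fst (\<phi> x))" using w[of a a'] by simp
  qed
  also have "\<dots> = weighted_hecke w D t"
    unfolding weighted_hecke_def by (rule sum.reindex_bij_betw[OF \<phi>(1)])
  finally show ?thesis .
qed

section \<open>Growth at the cusps\<close>

lemma J_invariant_bound:
  obtains C where "C \<ge> 0" "\<And>t. Im t \<ge> 1 \<Longrightarrow> norm (J_invariant t - inverse (nome t)) \<le> C"
proof -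
  \<comment> \<open>The value of |q| on the line Im t = 1. As the coefficients are nonnegative, the
    series at \<open>r\<close> bounds the series at all points above that line.\<close>
  define r where "r = exp (- 2 * pi)"
  have r: "0 < r" "r < 1" by (auto simp: r_def)
  define c where "c n = real (nat_coeff j_fps (Suc n))" for n
  have "summable (\<lambda>n. complex_of_real (real (nat_coeff j_fps n) * r ^ n))"
    using sums_summable[OF j_function_sums[of "of_real r"]] r by simp
  then have "summable (\<lambda>n. real (nat_coeff j_fps (Suc n)) * r ^ Suc n)"
    by (subst (asm) summable_of_real_iff) (subst summable_Suc_iff)
  then have "summable (\<lambda>n. inverse r * (real (nat_coeff j_fps (Suc n)) * r ^ Suc n))" by (rule summable_mult)
  moreover have "inverse r * (real (nat_coeff j_fps (Suc n)) * r ^ Suc n) = c n * r ^ n" for n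
    using r by (simp add: c_def field_simps)
  ultimately have sm: "summable (\<lambda>n. c n * r ^ n)" by (simp only:)
  define C where "C = suminf (\<lambda>n. c n * r ^ n) + 744"
  have "norm (J_invariant t - inverse (nome t)) \<le> C" if t: "Im t \<ge> 1" for t
  proof -
    define q where "q = nome t"
    have q: "norm q < 1" and q0: "q \<noteq> 0" using norm_nome_less_1[of t] t by (auto simp: q_def)
    have qr: "norm q \<le> r" using t by (simp add: q_def nome_def r_def)
    have "(\<lambda>n. of_nat (nat_coeff j_fps (Suc n)) * q ^ Suc n) sums (j_function q - 1)"
      using j_function_sums[OF q] by (subst sums_Suc_iff) (simp add: j_fps_initial)
    then have "(\<lambda>n. inverse q * (of_nat (nat_coeff j_fps (Suc n)) * q ^ Suc n)) sums (inverse q * (j_function q - 1))"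
      by (rule sums_mult)
    moreover have "inverse q * (of_nat (nat_coeff j_fps (Suc n)) * q ^ Suc n) = of_real (c n) * q ^ n" for n
      using q0 by (simp add: c_def field_simps)
    ultimately have s: "(\<lambda>n. of_real (c n) * q ^ n) sums (inverse q * (j_function q - 1))"
      by (simp only:)
    have le: "norm (of_real (c n) * q ^ n) \<le> c n * r ^ n" for n
      using qr by (simp add: norm_mult norm_power c_def mult_left_mono power_mono)
    have "norm (inverse q * (j_function q - 1)) \<le> suminf (\<lambda>n. c n * r ^ n)"
      using norm_suminf_le[OF le sm] sums_unique[OF s] by simp
    moreover have "J_invariant t - inverse (nome t) = inverse q * (j_function q - 1) - 744"
      unfolding J_invariant_def Eisenstein4_divisor_series using modular_discriminant_euler[of t] t
      by (simp add: j_function_def q_def divide_inverse power_inverse algebra_simps)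
    moreover have "norm (inverse q * (j_function q - 1) - 744) \<le> norm (inverse q * (j_function q - 1)) + norm (744 :: complex)"
      by (rule norm_triangle_ineq4)
    ultimately show ?thesis by (simp add: C_def)
  qed
  moreover have "C \<ge> 0" unfolding C_def using sm r by (intro add_nonneg_nonneg suminf_nonneg) (auto simp: c_def)
  ultimately show ?thesis using that by blast
qed

lemma norm_nome: "norm (nome t) = exp (- 2 * pi * Im t)"
  by (simp add: nome_def)

lemma mat2_act_rep_mat: "mat2_act (rep_mat (a, b, d)) t = (of_nat a * t + of_nat b) / of_nat d"
  by (simp add: rep_mat_def)

lemma Im_rep_mat: "Im (mat2_act (rep_mat (a, b, d)) t) = real a / real d * Im t"
  by (simp add: mat2_act_rep_mat)

text \<open>For Im t >= D the transformed point has imaginary part (a / d) Im t >= 1, since d <= D,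
  so the estimate near infinity applies to it.\<close>

lemma J_rep_bound:
  assumes C: "\<And>t. Im t \<ge> 1 \<Longrightarrow> norm (J_invariant t - inverse (nome t)) \<le> C" "C \<ge> 0"
    and x: "(a, b, d) \<in> hecke_reps D" "D > 0" and t: "Im t \<ge> real D"
  shows "norm (J_invariant (mat2_act (rep_mat (a, b, d)) t)) \<le> (1 + C) * exp (2 * pi * (real a / real d * Im t))"
proof -
  define u where "u = mat2_act (rep_mat (a, b, d)) t"
  have ad: "a * d = D" "d > 0" "a > 0" using x by (auto simp: hecke_reps_def intro!: Nat.gr0I)
  have "real d \<le> real D" using ad by (metis Suc_leI le_square mult.commute mult_le_mono1 nat_mult_1 of_nat_le_iff One_nat_def)
  then have "real d \<le> real a * Im t" using ad t by (metis (no_types, opaque_lifting) Suc_leI mult_mono' nat_mult_1 of_nat_0_le_iff of_nat_1 of_nat_le_iff One_nat_def order_trans mult_1)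
  then have im: "Im u \<ge> 1" using ad by (simp add: u_def Im_rep_mat field_simps)
  have "norm (J_invariant u) \<le> norm (inverse (nome u)) + norm (J_invariant u - inverse (nome u))"
    by (metis add.commute diff_add_cancel norm_triangle_ineq)
  also have "\<dots> \<le> exp (2 * pi * Im u) + C"
    using C(1)[OF im] by (simp add: norm_inverse norm_nome flip: exp_minus)
  also have "\<dots> \<le> exp (2 * pi * Im u) + C * exp (2 * pi * Im u)"
    using C(2) im by (simp add: mult_le_cancel_left1)
  finally show ?thesis by (simp add: u_def Im_rep_mat algebra_simps)
qed

text \<open>At every cusp the same matrices occur, only permuted, and each grows at most like exp(2
  pi (a / d) Im t) with a / d <= D.\<close>

lemma weighted_hecke_growth:
  assumes A: "mat2_det A = 1" and D: "D > 0"
  shows "\<exists>K C y\<^sub>0 :: real. \<forall>t\<in>upper_half_plane. Im t > y\<^sub>0 \<longrightarrow>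
           norm (weighted_hecke w D (mat2_act A t)) \<le> K * exp (C * Im t)"
proof -
  obtain C where C: "C \<ge> 0" "\<And>t. Im t \<ge> 1 \<Longrightarrow> norm (J_invariant t - inverse (nome t)) \<le> C"
    using J_invariant_bound by blast
  obtain \<phi> where \<phi>: "bij_betw \<phi> (hecke_reps D) (hecke_reps D)"
    "\<And>x. x \<in> hecke_reps D \<Longrightarrow> \<exists>B. mat2_det B = 1 \<and> rep_mat x \<star> A = B \<star> rep_mat (\<phi> x)"
    using hecke_permutation[OF A D] by blast
  have in_reps: "\<phi> x \<in> hecke_reps D" if "x \<in> hecke_reps D" for x using \<phi>(1) that by (auto simp: bij_betw_def)
  have "norm (weighted_hecke w D (mat2_act A t)) \<le>
      (\<Sum>x\<in>hecke_reps D. norm (w (fst x)) * (1 + C)) * exp (2 * pi * real D * Im t)"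
    if t: "t \<in> upper_half_plane" "Im t > real D" for t
  proof -
    have imt: "Im t > 0" using t by (simp add: upper_half_plane_def)
    have "weighted_hecke w D (mat2_act A t) =
        (\<Sum>x\<in>hecke_reps D. w (fst x) * J_invariant (mat2_act (rep_mat (\<phi> x)) t))"
      by (rule weighted_hecke_act[OF A D \<phi>(2) in_reps imt])
    also have "norm \<dots> \<le> (\<Sum>x\<in>hecke_reps D. norm (w (fst x)) * ((1 + C) * exp (2 * pi * real D * Im t)))"
    proof (rule sum_norm_le)
      fix x assume x: "x \<in> hecke_reps D"
      obtain a b d where abd: "\<phi> x = (a, b, d)" by (cases "\<phi> x")
      have rep: "(a, b, d) \<in> hecke_reps D" using in_reps[OF x] abd by simp
      then have ad: "a * d = D" "d > 0" by (auto simp: hecke_reps_def)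
      have "real a / real d \<le> real D"
      proof -
        have "real a * 1 \<le> real a * real d" using ad by (intro mult_left_mono) auto
        then have "real a / real d \<le> real a" using ad by (simp add: field_simps)
        moreover have "a \<le> D" using ad D by (intro dvd_imp_le) auto
        ultimately show ?thesis by linarith
      qed
      then have "real a / real d * Im t \<le> real D * Im t" using imt by (intro mult_right_mono) auto
      then have "2 * pi * (real a / real d * Im t) \<le> 2 * pi * (real D * Im t)" by (intro mult_left_mono) auto
      then have "exp (2 * pi * (real a / real d * Im t)) \<le> exp (2 * pi * real D * Im t)"
        by (simp only: exp_le_cancel_iff mult.assoc)
      moreover have "norm (J_invariant (mat2_act (rep_mat (a, b, d)) t)) \<le> (1 + C) * exp (2 * pi * (real a / real d * Im t))"
        by (rule J_rep_bound[OF C(2) C(1) rep D]) (use t in auto)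
      ultimately have "norm (J_invariant (mat2_act (rep_mat (a, b, d)) t)) \<le> (1 + C) * exp (2 * pi * real D * Im t)"
        using C(1) by (meson add_nonneg_nonneg mult_left_mono order_trans zero_le_one)
      then show "norm (w (fst x) * J_invariant (mat2_act (rep_mat (\<phi> x)) t)) \<le>
          norm (w (fst x)) * ((1 + C) * exp (2 * pi * real D * Im t))"
        by (simp add: abd norm_mult mult_left_mono)
    qed
    finally show ?thesis by (simp add: sum_distrib_right mult.assoc)
  qed
  then show ?thesis by blast
qed

lemma weighted_hecke_holomorphic:
  assumes D: "D > 0"
  shows "weighted_hecke w D holomorphic_on upper_half_plane"
  unfolding weighted_hecke_def[abs_def]
proof (intro holomorphic_intros)
  fix x assume x: "x \<in> hecke_reps D"
  obtain a b d where abd: "x = (a, b, d)" by (cases x)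
  then have d: "d > 0" using x by (auto simp: hecke_reps_def)
  have 1: "(\<lambda>t. (of_nat a * t + of_nat b) / of_nat d) holomorphic_on upper_half_plane"
    using d by (intro holomorphic_intros) auto
  have "(\<lambda>t. (of_nat a * t + of_nat b) / of_nat d) ` upper_half_plane \<subseteq> upper_half_plane"
  proof
    fix u assume "u \<in> (\<lambda>t. (of_nat a * t + of_nat b) / of_nat d) ` upper_half_plane"
    then obtain t where t: "Im t > 0" "u = mat2_act (rep_mat x) t"
      by (auto simp: upper_half_plane_def abd mat2_act_rep_mat)
    then show "u \<in> upper_half_plane"
      using Im_mat2_act[of "rep_mat x" t] det_rep_mat[OF x] D by (simp add: upper_half_plane_def)
  qed
  from holomorphic_on_compose_gen[OF 1 J_invariant_holomorphic this]
  show "(\<lambda>t. J_invariant (mat2_act (rep_mat x) t)) holomorphic_on upper_half_plane"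
    by (simp add: abd mat2_act_rep_mat o_def)
qed

section \<open>Leading terms at the cusps and the exact level\<close>

lemma J_rep_limit:
  assumes x: "x \<in> hecke_reps D" "D > 0"
  shows "((\<lambda>y. J_invariant (mat2_act (rep_mat x) (\<i> * of_real y)) * nome (\<i> * of_real y) ^ D) \<longlongrightarrow>
            (if x = (D, 0, 1) then 1 else 0)) at_top"
proof -
  obtain C where C: "C \<ge> 0" "\<And>t. Im t \<ge> 1 \<Longrightarrow> norm (J_invariant t - inverse (nome t)) \<le> C"
    using J_invariant_bound by blast
  obtain a b d where abd: "x = (a, b, d)" by (cases x)
  then have ad: "a * d = D" "b < d" using x by (auto simp: hecke_reps_def)
  have nm: "norm (nome (\<i> * of_real y) ^ D) = exp (- 2 * pi * real D * y)" for y
    by (simp add: norm_power norm_nome flip: exp_of_nat_mult)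
  have lim: "((\<lambda>y. K * exp (- pi * real D * y)) \<longlongrightarrow> 0) at_top" for K :: real
  proof -
    define c where "c = pi * real D"
    have "c > 0" using x by (simp add: c_def)
    then have "((\<lambda>y. K * exp (- c * y)) \<longlongrightarrow> 0) at_top" by real_asymp
    then show ?thesis by (simp add: c_def)
  qed
  show ?thesis
  proof (cases "x = (D, 0, 1)")
    case True
    have "((\<lambda>y. J_invariant (mat2_act (rep_mat x) (\<i> * of_real y)) * nome (\<i> * of_real y) ^ D - 1) \<longlongrightarrow> 0) at_top"
    proof (rule Lim_null_comparison[OF _ lim[of C]])
      show "\<forall>\<^sub>F y in at_top. norm (J_invariant (mat2_act (rep_mat x) (\<i> * of_real y)) * nome (\<i> * of_real y) ^ D - 1) \<le>
          C * exp (- pi * real D * y)"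
        using eventually_ge_at_top[of 1]
      proof eventually_elim
        case (elim y)
        define u where "u = mat2_act (rep_mat x) (\<i> * of_real y)"
        have u: "u = of_nat D * (\<i> * of_real y)" by (simp add: u_def True mat2_act_rep_mat)
        have "1 * 1 \<le> real D * y" using elim x by (intro mult_mono) auto
        then have im: "Im u \<ge> 1" by (simp add: u)
        have nu: "nome u = nome (\<i> * of_real y) ^ D" unfolding u by (rule nome_of_nat_mult)
        have "J_invariant u * nome u - 1 = (J_invariant u - inverse (nome u)) * nome u"
          by (simp add: algebra_simps)
        then have "norm (J_invariant u * nome u - 1) \<le> C * norm (nome u)"
          using C(2)[OF im] by (simp add: norm_mult mult_right_mono)
        also have "\<dots> \<le> C * exp (- pi * real D * y)"
          unfolding nu nm using C elim by (intro mult_left_mono) auto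
        finally show ?case by (simp add: u_def[symmetric] nu)
      qed
    qed
    from tendsto_add[OF this tendsto_const[of 1]] show ?thesis using True by simp
  next
    case False
    have d2: "d \<ge> 2"
    proof (rule ccontr)
      assume "\<not> d \<ge> 2"
      then have "d = 1" using ad by linarith
      then show False using ad abd False by simp
    qed
    have "((\<lambda>y. J_invariant (mat2_act (rep_mat x) (\<i> * of_real y)) * nome (\<i> * of_real y) ^ D) \<longlongrightarrow> 0) at_top"
    proof (rule Lim_null_comparison[OF _ lim[of "1 + C"]])
      show "\<forall>\<^sub>F y in at_top. norm (J_invariant (mat2_act (rep_mat x) (\<i> * of_real y)) * nome (\<i> * of_real y) ^ D) \<le>
          (1 + C) * exp (- pi * real D * y)"
        using eventually_ge_at_top[of "real D"] eventually_ge_at_top[of 0]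
      proof eventually_elim
        case (elim y)
        \<comment> \<open>In fact a / d = D / d^2; the bound D / 2 is generous and leaves the decay
          exp(- pi D y) after multiplication by q^D.\<close>
        have "real a / real d \<le> real D / 2"
        proof -
          have "a * 2 \<le> a * d" "a * d * 1 \<le> a * d * d" using d2 by (intro mult_le_mono2; linarith)+
          then have "2 * a \<le> a * d * d" by linarith
          then have "2 * real a \<le> real D * real d" unfolding ad(1)[symmetric] by (metis of_nat_le_iff of_nat_mult of_nat_numeral)
          then show ?thesis using d2 by (simp add: field_simps)
        qed
        then have le: "real a / real d * y \<le> real D / 2 * y" using elim by (intro mult_right_mono) auto
        have "norm (J_invariant (mat2_act (rep_mat x) (\<i> * of_real y))) \<le> (1 + C) * exp (2 * pi * (real a / real d * Im (\<i> * of_real y)))"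
          unfolding abd by (rule J_rep_bound[OF C(2) C(1)]) (use x abd elim in auto)
        also have "\<dots> \<le> (1 + C) * exp (pi * real D * y)"
        proof -
          have "2 * pi * (real a / real d * y) \<le> 2 * pi * (real D / 2 * y)"
            using le by (intro mult_left_mono) auto
          then have "2 * pi * (real a / real d * Im (\<i> * of_real y)) \<le> pi * real D * y" by simp
          then have "exp (2 * pi * (real a / real d * Im (\<i> * of_real y))) \<le> exp (pi * real D * y)"
            by (simp only: exp_le_cancel_iff)
          then show ?thesis using C(1) by (intro mult_left_mono) auto
        qed
        finally have "norm (J_invariant (mat2_act (rep_mat x) (\<i> * of_real y)) * nome (\<i> * of_real y) ^ D) \<le>
            (1 + C) * exp (pi * real D * y) * exp (- 2 * pi * real D * y)"
          unfolding norm_mult nm by (intro mult_right_mono) auto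
        also have "\<dots> = (1 + C) * exp (- pi * real D * y)" by (simp flip: exp_add)
        finally show ?case .
      qed
    qed
    then show ?thesis using False by simp
  qed
qed

text \<open>Let x0 be the representative that the matrix carries to (D, 0, 1). Invariance forces its
  weight to be \<open>w D\<close>, so m divides its first entry. Comparing lower left entries in the
  relation that defines x0 shows that this entry divides M. Hence m divides M, which a proper
  divisor excludes.\<close>

lemma weighted_hecke_not_invariant:
  assumes M: "M dvd m" "M \<noteq> m" "M > 0" and m: "m dvd D" "D > 0"
    and w: "\<And>a. \<not> m dvd a \<Longrightarrow> w a \<noteq> w D"
  shows "\<not> (\<forall>t. Im t > 0 \<longrightarrow> weighted_hecke w D (mat2_act (1, 0, int M, 1) t) = weighted_hecke w D t)"
proof
  assume inv: "\<forall>t. Im t > 0 \<longrightarrow> weighted_hecke w D (mat2_act (1, 0, int M, 1) t) = weighted_hecke w D t"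
  define A where "A = (1 :: int, 0 :: int, int M, 1 :: int)"
  have A: "mat2_det A = 1" by (simp add: A_def)
  define top where "top = (D, 0 :: nat, 1 :: nat)"
  have top: "top \<in> hecke_reps D" by (simp add: top_def hecke_reps_def)
  obtain \<phi> where \<phi>: "bij_betw \<phi> (hecke_reps D) (hecke_reps D)"
    "\<And>x. x \<in> hecke_reps D \<Longrightarrow> \<exists>B. mat2_det B = 1 \<and> rep_mat x \<star> A = B \<star> rep_mat (\<phi> x)"
    using hecke_permutation[OF A m(2)] by blast
  have in_reps: "\<phi> x \<in> hecke_reps D" if "x \<in> hecke_reps D" for x using \<phi>(1) that by (auto simp: bij_betw_def)
  obtain x0 where x0: "x0 \<in> hecke_reps D" "\<phi> x0 = top" 
    using \<phi>(1) top by (metis bij_betw_imp_surj_on imageE)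
  \<comment> \<open>After multiplication by q^D only the term whose matrix is (D, 0, 1) survives.
    The identity is used for the cusp at infinity and \<open>\<phi>\<close> for the cusp
    1/M.\<close>
  have lim: "((\<lambda>y. (\<Sum>x\<in>hecke_reps D. w (fst x) * (J_invariant (mat2_act (rep_mat (\<theta> x)) (\<i> * of_real y)) * nome (\<i> * of_real y) ^ D)))
      \<longlongrightarrow> w (fst z)) at_top"
    if \<theta>: "\<And>x. x \<in> hecke_reps D \<Longrightarrow> \<theta> x \<in> hecke_reps D" "inj_on \<theta> (hecke_reps D)" and z: "z \<in> hecke_reps D" "\<theta> z = top" for \<theta> z
  proof -
    have "((\<lambda>y. (\<Sum>x\<in>hecke_reps D. w (fst x) * (J_invariant (mat2_act (rep_mat (\<theta> x)) (\<i> * of_real y)) * nome (\<i> * of_real y) ^ D)))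
      \<longlongrightarrow> (\<Sum>x\<in>hecke_reps D. w (fst x) * (if \<theta> x = (D, 0, 1) then 1 else 0))) at_top"
      by (intro tendsto_sum tendsto_mult tendsto_const J_rep_limit \<theta> m)
    also have "(\<Sum>x\<in>hecke_reps D. w (fst x) * (if \<theta> x = (D, 0, 1) then 1 else 0)) = (\<Sum>x\<in>hecke_reps D. if x = z then w (fst z) else 0)"
      using \<theta>(2) z unfolding top_def[symmetric] by (intro sum.cong refl) (auto dest: inj_onD)
    also have "\<dots> = w (fst z)" using z finite_hecke_reps[OF m(2)] by simp
    finally show ?thesis .
  qed
  have L1: "((\<lambda>y. weighted_hecke w D (\<i> * of_real y) * nome (\<i> * of_real y) ^ D) \<longlongrightarrow> w D) at_top"
    using lim[of "\<lambda>x. x" top] top unfolding weighted_hecke_def sum_distrib_right by (simp add: top_def mult.assoc)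
  have "((\<lambda>y. weighted_hecke w D (mat2_act A (\<i> * of_real y)) * nome (\<i> * of_real y) ^ D) \<longlongrightarrow> w (fst x0)) at_top"
  proof (rule Lim_transform_eventually[OF lim[of \<phi> x0]])
    show "\<forall>\<^sub>F y in at_top. (\<Sum>x\<in>hecke_reps D. w (fst x) * (J_invariant (mat2_act (rep_mat (\<phi> x)) (\<i> * of_real y)) * nome (\<i> * of_real y) ^ D)) =
        weighted_hecke w D (mat2_act A (\<i> * of_real y)) * nome (\<i> * of_real y) ^ D"
      using eventually_gt_at_top[of "0 :: real"]
    proof eventually_elim
      case (elim y)
      have "weighted_hecke w D (mat2_act A (\<i> * of_real y)) =
        (\<Sum>x\<in>hecke_reps D. w (fst x) * J_invariant (mat2_act (rep_mat (\<phi> x)) (\<i> * of_real y)))"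
      proof (rule weighted_hecke_act[OF A m(2) \<phi>(2) in_reps])
        show "Im (\<i> * of_real y) > 0" using elim by simp
      qed
      then show ?case by (simp add: sum_distrib_right mult.assoc)
    qed
  qed (use in_reps \<phi>(1) x0 in \<open>auto simp: bij_betw_def\<close>)
  then have "((\<lambda>y. weighted_hecke w D (\<i> * of_real y) * nome (\<i> * of_real y) ^ D) \<longlongrightarrow> w (fst x0)) at_top"
  proof (rule Lim_transform_eventually)
    show "\<forall>\<^sub>F y in at_top. weighted_hecke w D (mat2_act A (\<i> * of_real y)) * nome (\<i> * of_real y) ^ D =
        weighted_hecke w D (\<i> * of_real y) * nome (\<i> * of_real y) ^ D"
      using eventually_gt_at_top[of "0 :: real"]
    proof eventually_elim
      case (elim y)
      have "Im (\<i> * of_real y) > 0" using elim by simp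
      then have "weighted_hecke w D (mat2_act A (\<i> * of_real y)) = weighted_hecke w D (\<i> * of_real y)"
        using inv unfolding A_def by blast
      then show ?case by (simp only:)
    qed
  qed
  then have "w (fst x0) = w D" using L1 tendsto_unique trivial_limit_at_top_linorder by blast
  then have "m dvd fst x0" using w by blast
  moreover obtain a b d where abd: "x0 = (a, b, d)" by (cases x0)
  moreover have "int a dvd int M"
  proof -
    obtain B where B: "mat2_det B = 1" "rep_mat x0 \<star> A = B \<star> rep_mat top" using \<phi>(2)[OF x0(1)] x0(2) by auto
    obtain \<alpha> \<beta> \<gamma> \<delta> where BB: "B = (\<alpha>, \<beta>, \<gamma>, \<delta>)" by (cases B)
    have "int d * int M = \<gamma> * int D" using B(2) by (auto simp: BB abd A_def top_def rep_mat_def)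
    moreover have "int D = int a * int d" "d > 0" using x0(1) abd by (auto simp: hecke_reps_def)
    ultimately have "int d * int M = int d * (\<gamma> * int a)" "d > 0" by (simp_all add: mult_ac)
    then have "int M = \<gamma> * int a" by simp
    then show ?thesis by simp
  qed
  ultimately have "m dvd M" by auto
  then show False using M by (meson dvd_antisym)
qed

section \<open>Expansions of weighted Hecke sums\<close>

lemma has_sum_finite_sum:
  fixes f :: "'b \<Rightarrow> 'a \<Rightarrow> complex"
  assumes "\<And>b. b \<in> F \<Longrightarrow> (f b has_sum s b) A"
  shows "((\<lambda>x. \<Sum>b\<in>F. f b x) has_sum (\<Sum>b\<in>F. s b)) A"
  using assms by (induction F rule: infinite_finite_induct) (auto intro!: has_sum_add has_sum_0)

lemma nome_powi: "nome z powi n = exp (of_int n * (2 * complex_of_real pi * \<i> * z))"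
  by (simp add: nome_def exp_power_int)

lemma sum_roots_of_unity_int:
  fixes n :: int
  assumes d: "d > 0"
  shows "(\<Sum>b<d. exp (of_int n * (2 * complex_of_real pi * \<i> * (of_nat b / of_nat d)))) =
           (if int d dvd n then of_nat d else 0)"
proof -
  define w where "w = exp (of_int n * (2 * complex_of_real pi * \<i> / of_nat d))"
  have pw: "exp (of_int n * (2 * complex_of_real pi * \<i> * (of_nat b / of_nat d))) = w ^ b" for b
    by (simp add: w_def mult_ac flip: exp_of_nat_mult)
  have "w = 1 \<longleftrightarrow> int d dvd n"
  proof
    assume "w = 1"
    then obtain k :: int where "Im (of_int n * (2 * complex_of_real pi * \<i> / of_nat d)) = of_int (2 * k) * pi"
      unfolding w_def exp_eq_1 by auto
    then have "pi * (2 * (real_of_int n / real d)) = pi * (2 * of_int k)" by (simp add: field_simps)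
    then have "real_of_int n / real d = of_int k" by (subst (asm) mult_left_cancel) auto
    then have "real_of_int n = of_int (int d * k)" using d by (simp add: field_simps)
    then have "n = int d * k" by (simp only: of_int_eq_iff)
    then show "int d dvd n" by simp
  next
    assume "int d dvd n"
    then obtain k where "n = int d * k" by (auto elim: dvdE)
    then have "w = exp (2 * of_int k * complex_of_real pi * \<i>)" using d by (simp add: w_def mult_ac)
    then show "w = 1" using exp_eq_1[of "2 * of_int k * of_real pi * \<i>"] by auto
  qed
  moreover have "w ^ d = 1"
  proof -
    have "w ^ d = exp (2 * of_int n * complex_of_real pi * \<i>)"
      using d by (simp add: w_def flip: exp_of_nat_mult) (simp add: mult_ac)
    then show ?thesis using exp_eq_1[of "2 * of_int n * of_real pi * \<i>"] by auto
  qed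
  ultimately show ?thesis unfolding pw using geometric_sum[of w d] by (cases "w = 1") auto
qed

text \<open>The sum over b is a sum of roots of unity which keeps only the exponents n = d k of J,
  each with a factor d; in terms of t such a term is a power q^(a k). This accounts for the two
  changes of index.\<close>

lemma hecke_row_q_expansion:
  assumes ad: "a > 0" "d > 0" and t: "Im t > 0"
  shows "((\<lambda>N. if int a dvd N then of_nat d * of_nat (J_coeff (int d * (N div int a))) * nome t powi N else 0)
           has_sum (\<Sum>b<d. J_invariant (mat2_act (rep_mat (a, b, d)) t))) UNIV"
proof -
  define S where "S = (\<Sum>b<d. J_invariant (mat2_act (rep_mat (a, b, d)) t))"
  define g where "g n = (\<Sum>b<d. of_nat (J_coeff n) * nome (mat2_act (rep_mat (a, b, d)) t) powi n)" for n
  have gS: "(g has_sum S) UNIV"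
    unfolding g_def S_def
  proof (rule has_sum_finite_sum)
    fix b
    have "Im (mat2_act (rep_mat (a, b, d)) t) > 0" using ad t by (simp add: Im_rep_mat)
    then show "((\<lambda>n. of_nat (J_coeff n) * nome (mat2_act (rep_mat (a, b, d)) t) powi n) has_sum
        J_invariant (mat2_act (rep_mat (a, b, d)) t)) UNIV" by (rule J_q_expansion)
  qed
  have g: "g n = of_nat (J_coeff n) * nome (of_nat a * t / of_nat d) powi n * (if int d dvd n then of_nat d else 0)" for n
  proof -
    have "nome (mat2_act (rep_mat (a, b, d)) t) powi n = nome (of_nat a * t / of_nat d) powi n *
        exp (of_int n * (2 * complex_of_real pi * \<i> * (of_nat b / of_nat d)))" for b
      unfolding nome_powi mat2_act_rep_mat by (simp add: add_divide_distrib ring_distribs flip: exp_add)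
    then show ?thesis unfolding g_def sum_roots_of_unity_int[OF ad(2), symmetric]
      by (simp add: sum_distrib_left mult.assoc)
  qed
  have gk: "g (int d * k) = of_nat d * of_nat (J_coeff (int d * k)) * nome t powi (int a * k)" for k
  proof -
    have "nome (of_nat a * t / of_nat d) powi (int d * k) = nome t powi (int a * k)"
      unfolding nome_powi using ad by (simp add: mult_ac)
    then show ?thesis by (simp add: g mult_ac)
  qed
  have bij: "bij_betw (\<lambda>k. int e * k) UNIV {n. int e dvd n}" if "e > 0" for e :: nat
    by (rule bij_betwI[where g = "\<lambda>n. n div int e"]) (use that in auto)
  have "(g has_sum S) {n. int d dvd n}"
    using gS by (rule has_sum_cong_neutral[THEN iffD1, rotated -1]) (auto simp: g)
  then have "((\<lambda>k. g (int d * k)) has_sum S) UNIV"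
    by (subst has_sum_reindex_bij_betw[OF bij[OF ad(2)]])
  then have "((\<lambda>k. of_nat d * of_nat (J_coeff (int d * k)) * nome t powi (int a * k)) has_sum S) UNIV"
    by (simp only: gk)
  then have "((\<lambda>N. of_nat d * of_nat (J_coeff (int d * (N div int a))) * nome t powi N) has_sum S) {N. int a dvd N}"
    by (subst has_sum_reindex_bij_betw[OF bij[OF ad(1)], symmetric]) (use ad in simp)
  then show ?thesis unfolding S_def
    by (rule has_sum_cong_neutral[THEN iffD1, rotated -1]) auto
qed

lemma sum_hecke_reps:
  assumes D: "D > 0"
  shows "(\<Sum>x\<in>hecke_reps D. F x) = (\<Sum>a | a dvd D. \<Sum>b<D div a. F (a, b, D div a))"
proof -
  have fin: "finite {a. a dvd D}" using D by simp
  have "bij_betw (\<lambda>(a, b). (a, b, D div a)) (SIGMA a:{a. a dvd D}. {..<D div a}) (hecke_reps D)"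
  proof (rule bij_betwI[where g = "\<lambda>(a, b, d). (a, b)"])
    show "(\<lambda>(a, b, d). (a, b)) \<in> hecke_reps D \<rightarrow> (SIGMA a:{a. a dvd D}. {..<D div a})"
      using D by (auto simp: hecke_reps_def)
  qed (use D in \<open>auto simp: hecke_reps_def\<close>)
  then have "(\<Sum>x\<in>hecke_reps D. F x) = (\<Sum>p\<in>(SIGMA a:{a. a dvd D}. {..<D div a}). F (case p of (a, b) \<Rightarrow> (a, b, D div a)))"
    by (rule sum.reindex_bij_betw[symmetric])
  also have "\<dots> = (\<Sum>a | a dvd D. \<Sum>b<D div a. F (a, b, D div a))"
    by (subst sum.Sigma) (use fin in \<open>auto intro!: sum.cong\<close>)
  finally show ?thesis .
qed

lemma weighted_hecke_q_expansion:
  assumes D: "D > 0" and t: "Im t > 0"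
  shows "((\<lambda>N. (\<Sum>a | a dvd D \<and> int a dvd N. w a * of_nat (D div a) * of_nat (J_coeff (int (D div a) * (N div int a)))) * nome t powi N)
           has_sum weighted_hecke w D t) UNIV"
proof -
  have fin: "finite {a. a dvd D}" using D by simp
  define f where "f a N = w a * (if int a dvd N then of_nat (D div a) * of_nat (J_coeff (int (D div a) * (N div int a))) * nome t powi N else 0)" for a N
  have "((\<lambda>N. \<Sum>a | a dvd D. f a N) has_sum (\<Sum>a | a dvd D. w a * (\<Sum>b<D div a. J_invariant (mat2_act (rep_mat (a, b, D div a)) t)))) UNIV"
    unfolding f_def
    by (intro has_sum_finite_sum has_sum_cmult_right hecke_row_q_expansion t) (use D in \<open>auto intro!: Nat.gr0I\<close>)
  moreover have "(\<Sum>a | a dvd D. f a N) =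
      (\<Sum>a | a dvd D \<and> int a dvd N. w a * of_nat (D div a) * of_nat (J_coeff (int (D div a) * (N div int a)))) * nome t powi N" for N
  proof -
    have "(\<Sum>a | a dvd D. f a N) = (\<Sum>a | a dvd D \<and> int a dvd N. f a N)"
      using fin by (intro sum.mono_neutral_right) (auto simp: f_def)
    also have "\<dots> = (\<Sum>a | a dvd D \<and> int a dvd N. w a * of_nat (D div a) * of_nat (J_coeff (int (D div a) * (N div int a)))) * nome t powi N"
      by (simp add: f_def sum_distrib_left mult_ac)
    finally show ?thesis .
  qed
  ultimately show ?thesis
    unfolding weighted_hecke_def sum_hecke_reps[OF D] by (simp add: sum_distrib_left)
qed

text \<open>With \<open>r = m / gcd(m, a)\<close>, reducing the numerator of \<open>r\<^sup>B / r\<^sup>B = 1\<close> modulo \<open>y\<close> makes the weight small for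
  \<open>r > 1\<close> but does not change \<open>r\<^sup>B\<close> times it modulo \<open>y\<close>.\<close>

definition level_weight :: "nat \<Rightarrow> nat \<Rightarrow> nat \<Rightarrow> nat \<Rightarrow> complex" where
  "level_weight y B m a = of_nat ((m div gcd m a) ^ B mod y) / of_nat ((m div gcd m a) ^ B)"

text \<open>The coefficient of the weighted sum, written on type nat:
  \<open>quotient_power_dvd\<close> makes the inner division exact.\<close>

definition level_coeff :: "nat \<Rightarrow> nat \<Rightarrow> nat \<Rightarrow> nat \<Rightarrow> int \<Rightarrow> nat" where
  "level_coeff y B D m N = (\<Sum>a | a dvd D \<and> int a dvd N.
     ((m div gcd m a) ^ B mod y) * ((D div a) div (m div gcd m a) ^ B) * J_coeff (int (D div a) * (N div int a)))"

text \<open>Checked at each prime p, with v the multiplicity, g = gcd(m, a) and r = m / g. If p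
  divides r, it does not divide a / g, so v(r^B a) = B v(r) + v(g) <= (B + 1) v(m), which explains
  the exponent B + 1. If p does not divide r, only a counts.\<close>

lemma quotient_power_dvd:
  fixes m n a B D :: nat
  assumes n: "n ^ (B + 1) dvd D" "m dvd n" "n > 0" and a: "a dvd D" and D: "D > 0"
  shows "(m div gcd m a) ^ B dvd D div a"
proof -
  define g where "g = gcd m a"
  define r where "r = m div g"
  define b where "b = a div g"
  have pos: "m > 0" "a > 0" using assms by (auto intro!: Nat.gr0I)
  then have g: "g > 0" by (simp add: g_def)
  have m: "m = g * r" and ab: "a = g * b" by (simp_all add: r_def b_def g_def)
  have rb: "r > 0" "b > 0" using pos m ab by (auto intro!: Nat.gr0I)
  have cop: "coprime r b" unfolding r_def b_def g_def using pos by (intro div_gcd_coprime) auto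
  have "r ^ B * a dvd D"
  proof (rule multiplicity_le_imp_dvd)
    show "r ^ B * a \<noteq> 0" using rb pos by simp
    fix p :: nat assume p: "prime p"
    then have pe: "prime_elem p" by simp
    have v: "multiplicity p (r ^ B * a) = B * multiplicity p r + multiplicity p a"
      using rb pos pe by (simp add: prime_elem_multiplicity_mult_distrib prime_elem_multiplicity_power_distrib)
    show "multiplicity p (r ^ B * a) \<le> multiplicity p D"
    proof (cases "p dvd r")
      case True
      then have "\<not> p dvd b" using cop p by (metis coprime_common_divisor not_prime_unit)
      then have "multiplicity p a = multiplicity p g"
        using ab g rb pe by (simp add: prime_elem_multiplicity_mult_distrib not_dvd_imp_multiplicity_0)
      then have "multiplicity p (r ^ B * a) \<le> (B + 1) * (multiplicity p g + multiplicity p r)"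
        unfolding v by (simp add: algebra_simps)
      also have "\<dots> = (B + 1) * multiplicity p m"
        using m g rb pe by (simp add: prime_elem_multiplicity_mult_distrib)
      also have "\<dots> \<le> (B + 1) * multiplicity p n"
        using n by (intro mult_le_mono2 dvd_imp_multiplicity_le) auto
      also have "\<dots> = multiplicity p (n ^ (B + 1))"
        using n pe by (subst prime_elem_multiplicity_power_distrib) auto
      also have "\<dots> \<le> multiplicity p D" using n D by (intro dvd_imp_multiplicity_le) auto
      finally show ?thesis .
    next
      case False
      then have "multiplicity p r = 0" by (rule not_dvd_imp_multiplicity_0)
      then show ?thesis unfolding v using a D by (simp add: dvd_imp_multiplicity_le)
    qed
  qed
  then show ?thesis using a pos unfolding r_def[symmetric] g_def[symmetric] by (simp add: dvd_div_iff_mult)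
qed

text \<open>Here n is the group order in the application, and y is the modulus for numerators. The
  bound y >= 2 makes 1 mod y = 1, so that terms with r = 1 keep the weight 1.\<close>

context
  fixes y B D n :: nat
  assumes y: "y \<ge> 2" and n: "n > 0" "n ^ (B + 1) dvd D" and D: "D > 0"
begin

lemma level_weight_mult:
  assumes "m dvd n" "a dvd D"
  shows "level_weight y B m a * of_nat (D div a) =
           of_nat (((m div gcd m a) ^ B mod y) * ((D div a) div (m div gcd m a) ^ B))"
proof -
  define r where "r = (m div gcd m a) ^ B"
  have "r dvd D div a" unfolding r_def by (rule quotient_power_dvd[OF n(2) assms(1) n(1) assms(2) D])
  then obtain k where k: "D div a = r * k" by (auto elim: dvdE)
  have "D div a > 0" using assms(2) D by (auto elim!: dvdE)
  then have "r > 0" using k by (auto intro!: Nat.gr0I)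
  then show ?thesis unfolding level_weight_def r_def[symmetric] k by simp
qed

lemma weighted_hecke_level_expansion:
  assumes m: "m dvd n" and t: "Im t > 0"
  shows "((\<lambda>N. of_nat (level_coeff y B D m N) * nome t powi N) has_sum weighted_hecke (level_weight y B m) D t) UNIV"
proof -
  have "(\<Sum>a | a dvd D \<and> int a dvd N. level_weight y B m a * of_nat (D div a) * of_nat (J_coeff (int (D div a) * (N div int a)))) =
      of_nat (level_coeff y B D m N)" for N
    using level_weight_mult[OF m] by (simp add: level_coeff_def)
  then show ?thesis using weighted_hecke_q_expansion[OF D t, of "level_weight y B m"] by simp
qed

lemma level_coeff_1: "level_coeff y B D 1 N = (\<Sum>a | a dvd D \<and> int a dvd N. D div a * J_coeff (int (D div a) * (N div int a)))"
  using y by (simp add: level_coeff_def)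

text \<open>Without the reduction modulo y the factor would be r^B times an exact quotient by r^B,
  that is, the factor \<open>D div a\<close> of level 1.\<close>

lemma level_coeff_cong:
  assumes m: "m dvd n"
  shows "[level_coeff y B D m N = level_coeff y B D 1 N] (mod y)"
  unfolding level_coeff_1 unfolding level_coeff_def
proof (intro cong_sum cong_mult cong_refl)
  fix a assume a: "a \<in> {a. a dvd D \<and> int a dvd N}"
  define r where "r = (m div gcd m a) ^ B"
  have "r dvd D div a" unfolding r_def by (rule quotient_power_dvd[OF n(2) m n(1) _ D]) (use a in auto)
  then have "D div a = r * ((D div a) div r)" by simp
  moreover have "[(r mod y) * ((D div a) div r) = r * ((D div a) div r)] (mod y)"
    by (intro cong_mult cong_refl) (simp add: cong_def)
  ultimately show "[(m div gcd m a) ^ B mod y * (D div a div (m div gcd m a) ^ B) = D div a] (mod y)"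
    unfolding r_def by metis
qed

text \<open>The only exponent <= 0 with a coefficient in J is -1, and (D / a) (N / a) = -1 forces a
  = D and N = -D. The weight at a = D is 1 for every m.\<close>

lemma level_coeff_nonpos:
  assumes m: "m dvd D" and N: "N \<le> 0"
  shows "level_coeff y B D m N = (if N = - int D then 1 else 0)"
proof -
  have fin: "finite {a. a dvd D \<and> int a dvd N}" using D by simp
  define F where "F a = ((m div gcd m a) ^ B mod y) * ((D div a) div (m div gcd m a) ^ B) * J_coeff (int (D div a) * (N div int a))" for a
  have zero: "F a = 0" if a: "a dvd D" "int a dvd N" "\<not> (a = D \<and> N = - int D)" for a
  proof -
    obtain e where e: "D = a * e" using a by (auto elim: dvdE)
    obtain k where k: "N = int a * k" using a by (auto elim: dvdE)
    have pos: "a > 0" "e > 0" using e D by (auto intro!: Nat.gr0I)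
    have k0: "k \<le> 0" using k N pos by (simp add: mult_le_0_iff)
    have eq: "int (D div a) * (N div int a) = int e * k" using e k pos by simp
    have "int e * k \<noteq> -1"
    proof
      assume "int e * k = -1"
      then have "int e dvd 1" by (metis dvd_minus_iff dvd_triv_left)
      then have "e = 1" by simp
      then show False using \<open>int e * k = -1\<close> a(3) e k by simp
    qed
    moreover have "int e * k \<le> 0" using k0 by (simp add: mult_nonneg_nonpos)
    ultimately have "int e * k = 0 \<or> int e * k < -1" by linarith
    then have "J_coeff (int e * k) = 0" by (auto simp: J_coeff_def)
    then show ?thesis by (simp add: F_def eq)
  qed
  show ?thesis
  proof (cases "N = - int D")
    case True
    have "level_coeff y B D m N = (\<Sum>a\<in>{a. a dvd D \<and> int a dvd N}. if a = D then F D else 0)"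
      unfolding level_coeff_def F_def[symmetric] by (intro sum.cong refl) (use zero in auto)
    also have "\<dots> = F D" using fin True by simp
    also have "F D = 1"
    proof -
      have "gcd m D = m" using m by (simp add: gcd_proj1_iff)
      moreover have "m > 0" using m D by (auto intro!: Nat.gr0I)
      moreover have "- int D div int D = - 1" using D by (simp add: zdiv_zminus1_eq_if)
      ultimately show ?thesis using True D y by (simp add: F_def J_coeff_simps)
    qed
    finally show ?thesis using True by simp
  next
    case False
    then show ?thesis unfolding level_coeff_def F_def[symmetric] using zero by (auto intro!: sum.neutral)
  qed
qed

lemma level_coeff_1_ge: "D * J_coeff (int D * N) \<le> level_coeff y B D 1 N"
proof -
  have "finite {a. a dvd D \<and> int a dvd N}" using D by simp
  then show ?thesis unfolding level_coeff_1
    using member_le_sum[of 1 "{a. a dvd D \<and> int a dvd N}" "\<lambda>a. D div a * J_coeff (int (D div a) * (N div int a))"] by simp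
qed

text \<open>Each of two parts is at most half of the term a = 1 at level 1, divided by K. The part a
  = 1 is small through its weight, below y / 2^B. For a >= 2 the exponent of J is D N / a^2 <= D N /
  4, where the coefficients are smaller by a factor growing linearly in D N.\<close>

lemma level_coeff_dominated:
  fixes N :: int
  assumes K: "2 * K * y \<le> 2 ^ B" "12 * K \<le> D" "8 \<le> D" and m: "m \<ge> 2" and N: "N > 0"
  shows "K * level_coeff y B D m N \<le> level_coeff y B D 1 N"
proof -
  define S where "S = {a. a dvd D \<and> int a dvd N}"
  define r where "r a = (m div gcd m a) ^ B" for a
  define j where "j a = int (D div a) * (N div int a)" for a
  define F where "F a = (r a mod y) * ((D div a) div r a) * J_coeff (j a)" for a
  define X where "X = J_coeff (int D * N)"
  have finS: "finite S" unfolding S_def using D by simp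
  have S1: "1 \<in> S" by (simp add: S_def)
  have split: "level_coeff y B D m N = F 1 + (\<Sum>a\<in>S - {1}. F a)"
    unfolding level_coeff_def S_def[symmetric] F_def[symmetric] r_def[symmetric] j_def[symmetric]
    using sum.remove[OF finS S1, of F] by simp
  have first: "2 * K * F 1 \<le> D * X"
  proof -
    have "r 1 = m ^ B" by (simp add: r_def)
    have "2 * K * ((r 1 mod y) * (D div r 1)) \<le> 2 * K * (y * (D div r 1))"
      using y by (intro mult_le_mono2 mult_le_mono1) (simp add: less_imp_le)
    also have "\<dots> = (2 * K * y) * (D div r 1)" by simp
    also have "\<dots> \<le> r 1 * (D div r 1)"
      using K(1) power_mono[of 2 m B] m unfolding \<open>r 1 = m ^ B\<close> by (intro mult_le_mono1) linarith
    also have "\<dots> \<le> D" by simp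
    finally have "2 * K * ((r 1 mod y) * (D div r 1)) * X \<le> D * X" by (rule mult_le_mono1)
    then show ?thesis by (simp add: F_def j_def X_def mult.assoc)
  qed
  \<comment> \<open>3 Q is the growth factor of the coefficients at the exponent \<open>P\<close> =
    D N. It is about 3/8 of \<open>P\<close> and thus outweighs the number of divisors a, at most N;
    P <= 16 Q is a rounded form valid for P >= 8.\<close>
  define Q where "Q = nat (int D * N + 1) div 8"
  define P where "P = D * nat N"
  have Pint: "int P = int D * N" using N by (simp add: P_def)
  have P8: "P \<ge> 8" unfolding P_def using K(3) N by (metis mult_le_mono nat_mult_1_right zero_less_nat_eq Suc_leI One_nat_def)
  have QP: "P \<le> 16 * Q"
  proof -
    have "Q = (P + 1) div 8" unfolding Q_def Pint[symmetric] by (simp add: nat_add_distrib)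
    then show ?thesis using P8 by presburger
  qed
  have bound: "3 * Q * F a \<le> D * X" if a: "a \<in> S - {1}" for a
  proof -
    obtain e where e: "D = a * e" using a by (auto simp: S_def elim: dvdE)
    obtain k where k: "N = int a * k" using a by (auto simp: S_def elim: dvdE)
    have pos: "a > 0" "e > 0" using e D by (auto intro!: Nat.gr0I)
    then have a2: "a \<ge> 2" using a by auto
    have k0: "k > 0" using k N pos by (simp add: zero_less_mult_iff)
    have ja: "j a = int e * k" using e k pos by (simp add: j_def)
    have "int D * N = int a * int a * (int e * k)" by (simp add: e k mult_ac)
    moreover have "4 * (int e * k) \<le> int a * int a * (int e * k)"
    proof (rule mult_right_mono)
      show "4 \<le> int a * int a" using mult_mono[of 2 "int a" 2 "int a"] a2 by simp
    qed (use pos k0 in simp)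
    ultimately have "4 * j a \<le> int D * N" by (simp add: ja)
    then have g: "3 * Q * J_coeff (j a) \<le> X"
      unfolding Q_def X_def using J_coeff_growth[of "j a" "int D * N"] pos k0 P8 Pint by (simp add: ja)
    have "(r a mod y) * ((D div a) div r a) \<le> r a * ((D div a) div r a)" by (intro mult_le_mono1) simp
    also have "\<dots> \<le> D div a" by simp
    also have "\<dots> \<le> D" by simp
    finally have "(r a mod y) * ((D div a) div r a) \<le> D" .
    from mult_le_mono[OF this g] show ?thesis by (simp add: F_def mult_ac)
  qed
  have card: "card (S - {1}) \<le> nat N"
  proof -
    have "S - {1} \<subseteq> {1..nat N}"
    proof
      fix a assume a: "a \<in> S - {1}"
      then have "int a \<le> N" using N by (auto simp: S_def intro: zdvd_imp_le)
      moreover have "a > 0" using a D by (auto simp: S_def intro!: Nat.gr0I)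
      ultimately show "a \<in> {1..nat N}" by auto
    qed
    then show ?thesis using card_mono[of "{1..nat N}" "S - {1}"] by simp
  qed
  define T where "T = (\<Sum>a\<in>S - {1}. F a)"
  have "3 * Q * T = (\<Sum>a\<in>S - {1}. 3 * Q * F a)" by (simp add: T_def sum_distrib_left)
  also have "\<dots> \<le> card (S - {1}) * (D * X)" using sum_bounded_above[of "S - {1}" "\<lambda>a. 3 * Q * F a" "D * X"] bound by simp
  also have "\<dots> \<le> nat N * (D * X)" using card by (rule mult_le_mono1)
  also have "\<dots> = P * X" by (simp add: P_def mult_ac)
  finally have 1: "3 * Q * T \<le> P * X" .
  have "P * (3 * T) \<le> (16 * Q) * (3 * T)" using QP by (rule mult_le_mono1)
  also have "\<dots> = 16 * (3 * Q * T)" by simp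
  also have "\<dots> \<le> 16 * (P * X)" using 1 by (rule mult_le_mono2)
  also have "\<dots> = P * (16 * X)" by simp
  \<comment> \<open>The ratio 16/3 is rounded up to 6, which is where the requirement 12 K <= D
    comes from.\<close>
  finally have "3 * T \<le> 16 * X" using P8 by simp
  then have "T \<le> 6 * X" by linarith
  then have "2 * K * T \<le> 2 * K * (6 * X)" by (rule mult_le_mono2)
  also have "\<dots> = (12 * K) * X" by simp
  also have "\<dots> \<le> D * X" using K(2) by (rule mult_le_mono1)
  finally have second: "2 * K * T \<le> D * X" .
  have "2 * (K * level_coeff y B D m N) = 2 * K * F 1 + 2 * K * T"
    unfolding split T_def[symmetric] by (simp add: algebra_simps)
  also have "\<dots> \<le> 2 * (D * X)" using first second by linarith
  finally have "K * level_coeff y B D m N \<le> D * X" by linarith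
  also have "\<dots> \<le> level_coeff y B D 1 N" unfolding X_def by (rule level_coeff_1_ge)
  finally show ?thesis .
qed

text \<open>If m does not divide a then r >= 2, so r^B >= 2^B >= y exceeds its residue modulo y and
  the weight differs from 1, its value at D.\<close>

lemma level_weight_not_dvd:
  assumes m: "m dvd D" and yB: "y \<le> 2 ^ B" and a: "\<not> m dvd a"
  shows "level_weight y B m a \<noteq> level_weight y B m D"
proof -
  define r where "r = m div gcd m a"
  have m0: "m > 0" using m D by (auto intro!: Nat.gr0I)
  have "gcd m D = m" using m by (simp add: gcd_proj1_iff)
  then have D1: "level_weight y B m D = 1" using y m0 by (simp add: level_weight_def)
  have mr: "m = gcd m a * r" by (simp add: r_def)
  have "r \<noteq> 0"
  proof
    assume "r = 0"
    then have "m = 0" using mr by simp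
    then show False using m0 by simp
  qed
  moreover have "r \<noteq> 1"
  proof
    assume "r = 1"
    then have "gcd m a = m" using mr by simp
    then show False using a by (metis gcd_dvd2)
  qed
  ultimately have "r \<ge> 2" by linarith
  then have "y \<le> r ^ B" using yB power_mono[of 2 r B] by linarith
  then have "r ^ B mod y < r ^ B" using y by (metis less_le_trans mod_less_divisor not_gr_zero not_numeral_le_zero)
  then have "level_weight y B m a \<noteq> 1" unfolding level_weight_def r_def[symmetric]
    by (simp add: divide_eq_1_iff del: of_nat_power)
  then show ?thesis using D1 by simp
qed

end

lemma act_eq_mat2_act: "act \<gamma> t = mat2_act (\<gamma> $ 1 $ 1, \<gamma> $ 1 $ 2, \<gamma> $ 2 $ 1, \<gamma> $ 2 $ 2) t"
  by (simp add: act_def moebius_def)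

lemma weighted_hecke_strict_level:
  assumes m: "m dvd D" "D > 0"
    and w: "\<And>a a'. gcd m a = gcd m a' \<Longrightarrow> w a = w a'" "\<And>a. \<not> m dvd a \<Longrightarrow> w a \<noteq> w D"
  shows "strictly_of_level m (weighted_hecke w D)"
  unfolding strictly_of_level_def weakly_holomorphic_modular_def
proof (intro conjI allI impI)
  show "weighted_hecke w D holomorphic_on upper_half_plane" by (rule weighted_hecke_holomorphic[OF m(2)])
  show "modular_invariant m (weighted_hecke w D)"
    unfolding modular_invariant_def
  proof (intro ballI)
    fix \<gamma> t assume \<gamma>: "\<gamma> \<in> Gamma0 m" and t: "t \<in> upper_half_plane"
    define A where "A = (\<gamma> $ 1 $ 1, \<gamma> $ 1 $ 2, \<gamma> $ 2 $ 1, \<gamma> $ 2 $ 2)"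
    have det: "mat2_det A = 1" and dvd: "int m dvd \<gamma> $ 2 $ 1"
      using \<gamma> by (simp_all add: A_def Gamma0_def det_2)
    have im: "Im t > 0" using t by (simp add: upper_half_plane_def)
    show "weighted_hecke w D (act \<gamma> t) = weighted_hecke w D t"
      unfolding act_eq_mat2_act A_def[symmetric]
      by (rule weighted_hecke_invariant[OF det A_def dvd m _ im]) (rule w(1))
  qed
  show "exponential_growth_at_cusps (weighted_hecke w D)"
    unfolding exponential_growth_at_cusps_def
  proof
    fix \<gamma> assume \<gamma>: "\<gamma> \<in> Gamma0 1"
    show "\<exists>A C y\<^sub>0 :: real. \<forall>t\<in>upper_half_plane. Im t > y\<^sub>0 \<longrightarrow> norm (weighted_hecke w D (act \<gamma> t)) \<le> A * exp (C * Im t)"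
      unfolding act_eq_mat2_act using \<gamma> by (intro weighted_hecke_growth m) (simp add: Gamma0_def det_2)
  qed
  fix M assume M: "M dvd m \<and> M \<noteq> m"
  have M0: "M > 0" using M m by (auto intro!: Nat.gr0I)
  show "\<not> modular_invariant M (weighted_hecke w D)"
  proof
    assume inv: "modular_invariant M (weighted_hecke w D)"
    \<comment> \<open>An element of \<open>Gamma0 M\<close> that sends infinity to the cusp
      1/M.\<close>
    define \<gamma> :: "int^2^2" where "\<gamma> = vector [vector [1, 0], vector [int M, 1]]"
    have "\<gamma> \<in> Gamma0 M" by (simp add: Gamma0_def det_2 \<gamma>_def)
    then have "\<forall>t. Im t > 0 \<longrightarrow> weighted_hecke w D (act \<gamma> t) = weighted_hecke w D t"
      using inv by (auto simp: modular_invariant_def upper_half_plane_def)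
    then have "\<forall>t. Im t > 0 \<longrightarrow> weighted_hecke w D (mat2_act (1, 0, int M, 1) t) = weighted_hecke w D t"
      unfolding act_eq_mat2_act by (simp add: \<gamma>_def)
    then show False using weighted_hecke_not_invariant[of M m D w] M M0 m w(2) by blast
  qed
qed

theorem theorem1p1:
  fixes G :: "('a, 'b) monoid_scheme"
  assumes "group G" and "finite (carrier G)"
  shows "infinite {d :: nat. d > 0 \<and>
    (\<exists>(scale :: complex \<Rightarrow> (nat \<Rightarrow>\<^sub>0 complex) \<Rightarrow> (nat \<Rightarrow>\<^sub>0 complex)) \<rho> V.
       let I = {- int d} \<union> range int;
           tr = (\<lambda>g n. complex_vector_space.endo_trace scale (V n) (\<rho> g))
       in graded_group_module G scale \<rho> I V \<and>
          \<not> complex_vector_space.finite_dim scale UNIV \<and>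
          (\<forall>g\<in>carrier G. \<exists>f. strictly_of_level (group.ord G g) f \<and> has_q_expansion f I (tr g)) \<and>
          has_q_expansion (hecke d J_invariant) I (tr \<one>\<^bsub>G\<^esub>))}"
    (is "infinite {d. d > 0 \<and> ?P d}")
proof -
  interpret group G by fact
  note fin = assms(2)
  define n where "n = order G"
  have n: "n > 0" using fin by (simp add: n_def order_gt_0_iff_finite)
  obtain K0 where K0: "\<And>a :: nat \<Rightarrow> nat.
     (\<And>g. g \<in> carrier G \<Longrightarrow> g \<noteq> \<one>\<^bsub>G\<^esub> \<Longrightarrow> [a (ord g) = a 1] (mod order G) \<and> K0 * a (ord g) \<le> a 1) \<Longrightarrow>
     realizable G (\<lambda>g. of_nat (a (ord g)))" using realizable_order_function[OF fin] by blast
  \<comment> \<open>The successor makes K positive, so that 2 K y <= 2^B also yields y <=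
    2^B.\<close>
  define K where "K = Suc K0"
  \<comment> \<open>A multiple of the group order that is at least 2 even for the trivial
    group.\<close>
  define y where "y = 2 * n"
  have y: "y \<ge> 2" using n by (simp add: y_def)
  \<comment> \<open>Any exponent with 2 K y <= 2^B would do; this one works because x < 2^x.\<close>
  define B where "B = 2 * K * y"
  have yB: "2 * K * y \<le> 2 ^ B" unfolding B_def by (rule less_imp_le[OF less_exp])
  have "1 * y \<le> 2 * K * y" by (intro mult_le_mono1) (simp add: K_def)
  then have yB': "y \<le> 2 ^ B" using yB by linarith
  \<comment> \<open>The power of n absorbs the denominators of all weights, 12 K and 8 are the
    thresholds of \<open>level_coeff_dominated\<close>, and k supplies infinitely many
    values.\<close>
  define d where "d k = n ^ (B + 1) * (12 * K + 8 + k)" for k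
  show ?thesis
  proof (rule infinite_super)
    have "inj d" using n by (auto simp: inj_def d_def)
    then show "infinite (range d)" by (simp add: finite_image_iff)
    show "range d \<subseteq> {d. d > 0 \<and> ?P d}"
    proof
      fix D assume "D \<in> range d"
      then obtain k where Dk: "D = n ^ (B + 1) * (12 * K + 8 + k)" by (auto simp: d_def)
      have nD: "n ^ (B + 1) dvd D" by (simp add: Dk)
      have "1 * (12 * K + 8 + k) \<le> D" unfolding Dk using n by (intro mult_le_mono1) (simp add: Suc_leI)
      then have le: "12 * K + 8 + k \<le> D" by simp
      have D12: "12 * K \<le> D" using le by linarith
      have D8: "8 \<le> D" using le by linarith
      have D: "D > 0" using D8 by linarith
      note level = y n nD D
      define I where "I = {- int D} \<union> range int"
      define X where "X N g = complex_of_nat (level_coeff y B D (ord g) N)" for N :: int and g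
      have ordn: "ord g dvd n" if "g \<in> carrier G" for g
        using ord_dvd_group_order[OF that] by (simp add: n_def)
      have "n dvd D" using nD by (metis Suc_eq_plus1 dvd_mult_left power_Suc)
      then have ordD: "ord g dvd D" if "g \<in> carrier G" for g using ordn[OF that] by (rule dvd_trans[rotated])
      have real: "realizable G (X N)" for N
      proof (cases "N > 0")
        case True
        have "realizable G (\<lambda>g. of_nat (level_coeff y B D (ord g) N))"
        proof (rule K0)
          fix g assume g: "g \<in> carrier G" "g \<noteq> \<one>\<^bsub>G\<^esub>"
          have "ord g \<noteq> 1" "ord g \<ge> 1" using ord_eq_1[OF g(1)] g ord_ge_1[OF fin g(1)] by auto
          then have m2: "ord g \<ge> 2" by linarith
          have "[level_coeff y B D (ord g) N = level_coeff y B D 1 N] (mod y)"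
            by (rule level_coeff_cong[OF level ordn[OF g(1)]])
          then have "[level_coeff y B D (ord g) N = level_coeff y B D 1 N] (mod order G)"
            by (rule cong_dvd_modulus_nat) (simp add: y_def n_def)
          moreover have "K * level_coeff y B D (ord g) N \<le> level_coeff y B D 1 N"
            by (rule level_coeff_dominated[OF level yB D12 D8 m2 True])
          ultimately show "[level_coeff y B D (ord g) N = level_coeff y B D 1 N] (mod order G) \<and>
              K0 * level_coeff y B D (ord g) N \<le> level_coeff y B D 1 N" by (simp add: K_def)
        qed
        then show ?thesis by (simp add: X_def[abs_def])
      next
        \<comment> \<open>In degrees N <= 0 the function does not depend on g: it is the trivial
          character in degree -D and 0 otherwise.\<close>
        case False
        have "realizable G (\<lambda>g. of_nat (if N = - int D then 1 else 0))"
          using realizable_1 realizable_0 by (cases "N = - int D") auto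
        then show ?thesis
        proof (rule realizable_cong)
          fix g assume "g \<in> carrier G"
          then show "of_nat (if N = - int D then 1 else 0) = X N g"
            unfolding X_def using level_coeff_nonpos[OF level ordD] False by simp
        qed
      qed
      \<comment> \<open>Every positive degree has positive dimension: the term a = 1 contains the
        coefficient of J at D N >= 8.\<close>
      have "infinite {N \<in> I. X N \<one>\<^bsub>G\<^esub> \<noteq> 0}"
      proof (rule infinite_super)
        show "infinite (range (\<lambda>k. int (Suc k)))"
          by (subst finite_image_iff) (auto simp: inj_def)
        show "range (\<lambda>k. int (Suc k)) \<subseteq> {N \<in> I. X N \<one>\<^bsub>G\<^esub> \<noteq> 0}"
        proof
          fix N assume "N \<in> range (\<lambda>k. int (Suc k))"
          then obtain j where "N = int (Suc j)" by blast
          then have N: "N > 0" and NI: "N \<in> I" unfolding I_def by (simp, blast)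
          have "8 * 1 \<le> int D * N" using D8 N by (intro mult_mono) auto
          then have "J_coeff (int D * N) > 0" by (intro J_coeff_pos) simp
          then have "level_coeff y B D 1 N > 0"
            using level_coeff_1_ge[OF level, of N] D by (metis gr0I le_zero_eq mult_is_0 not_gr_zero)
          then show "N \<in> {N \<in> I. X N \<one>\<^bsub>G\<^esub> \<noteq> 0}" using NI by (simp add: X_def)
        qed
      qed
      from graded_module_exists[OF assms(1) real this]
      obtain \<rho> V where V: "graded_group_module G pm_scale \<rho> I V"
        and tr: "\<And>g N. g \<in> carrier G \<Longrightarrow> N \<in> I \<Longrightarrow> pm.endo_trace (V N) (\<rho> g) = X N g" by blast
      have expn: "has_q_expansion (weighted_hecke (level_weight y B (ord g)) D) I (\<lambda>N. pm.endo_trace (V N) (\<rho> g))"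
        if g: "g \<in> carrier G" for g
        unfolding has_q_expansion_def
      proof
        fix t assume "t \<in> upper_half_plane"
        then have t: "Im t > 0" by (simp add: upper_half_plane_def)
        have zero: "level_coeff y B D (ord g) N = 0" if "N \<notin> I" for N
        proof -
          have "N < 0" "N \<noteq> - int D" using that by (auto simp: I_def image_iff) (metis nat_0_le not_less)
          then show ?thesis using level_coeff_nonpos[OF level ordD[OF g], of N] by simp
        qed
        show "((\<lambda>N. pm.endo_trace (V N) (\<rho> g) * nome t powi N) has_sum weighted_hecke (level_weight y B (ord g)) D t) I"
          using weighted_hecke_level_expansion[OF level ordn[OF g] t]
          by (rule has_sum_cong_neutral[THEN iffD1, rotated -1]) (use zero tr[OF g] in \<open>auto simp: X_def\<close>)
      qed
      have strict: "strictly_of_level (ord g) (weighted_hecke (level_weight y B (ord g)) D)" if g: "g \<in> carrier G" for g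
      proof (rule weighted_hecke_strict_level[OF ordD[OF g] D])
        show "level_weight y B (ord g) a = level_weight y B (ord g) a'" if "gcd (ord g) a = gcd (ord g) a'" for a a'
          using that by (simp add: level_weight_def)
        show "level_weight y B (ord g) a \<noteq> level_weight y B (ord g) D" if "\<not> ord g dvd a" for a
          by (rule level_weight_not_dvd[OF level ordD[OF g] yB' that])
      qed
      \<comment> \<open>For the identity m = 1, so r = 1 and all weights are 1 mod y = 1: the
        weighted sum is the Hecke operator itself.\<close>
      have "level_weight y B (ord \<one>\<^bsub>G\<^esub>) = (\<lambda>_. 1)"
        using y by (simp add: level_weight_def fun_eq_iff)
      then have "has_q_expansion (hecke D J_invariant) I (\<lambda>N. pm.endo_trace (V N) (\<rho> \<one>\<^bsub>G\<^esub>))"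
        using expn[OF one_closed] by (simp add: hecke_eq_weighted)
      then have "?P D"
        unfolding Let_def I_def[symmetric] using V pm_infinite_dim strict expn by blast
      with D show "D \<in> {d. d > 0 \<and> ?P d}" by simp
    qed
  qed
qed

end
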